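(* Let $S=k[x_1,\ldots,x_n]$ be a polynomial ring over a field $k$ and $q\ge2$. Let $I\subset S$ be the final squarefree lexsegment ideal generated in degree $q$, determined by the monomial $u=x_1x_{i_2}\cdots x_{i_q}$, $2\leq i_2<\cdots<i_q\leq n$. Then $I$ is sequentially Cohen–Macaulay.
   Context: Monomials are ordered by the lexicographic order with $x_1>x_2>\cdots>x_n$. For a squarefree monomial $u$ of degree $q$, $L^f(u)=\{w: w\text{ a squarefree monomial of degree }q,\ u\geq_{lex}w\}$ and the final squarefree lexsegment ideal determined by $u$ is $(L^f(u))$. A finitely generated graded $S$-module $M$ is sequentially Cohen–Macaulay if there is a finite filtration $0=M_0\subset M_1\subset\cdots\subset M_r=M$ by graded submodules such that each $M_i/M_{i-1}$ is Cohen–Macaulay and $\dim(M_1/M_0)<\dim(M_2/M_1)<\cdots<\dim(M_r/M_{r-1})$. An ideal $I\subset S$ is sequentially Cohen–Macaulay if $S/I$ is a sequentially Cohen–Macaulay module. *)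

theory Defs
  imports "HOL-Algebra.QuotRing" "HOL-Algebra.Module" "HOL-Library.Poly_Mapping"
    "HOL-Library.Extended_Nat"
begin

section \<open>Modules over a commutative ring\<close>

definition regular_module :: "('a, 'c) ring_scheme \<Rightarrow> ('a, 'a) module" where
  "regular_module R =
    \<lparr>carrier = carrier R, mult = mult R, one = one R, zero = zero R, add = add R,
     smult = mult R\<rparr>"

text \<open>The record type of modules extends that of rings; the locale \<open>module\<close> does not refer to
  the fields \<open>mult\<close> and \<open>one\<close>, so they are left unspecified here.\<close>

definition quot_module ::
    "('a, 'c) ring_scheme \<Rightarrow> ('a, 'b, 'd) module_scheme \<Rightarrow> 'b set \<Rightarrow> ('a, 'b set) module" where
  "quot_module R M N =
    \<lparr>carrier = a_rcosets\<^bsub>M\<^esub> N, mult = undefined, one = undefined, zero = N, add = set_add M,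
     smult = (\<lambda>a X. \<Union>x\<in>X. N +>\<^bsub>M\<^esub> (a \<odot>\<^bsub>M\<^esub> x))\<rparr>"

definition gen_submodule ::
    "('a, 'c) ring_scheme \<Rightarrow> ('a, 'b, 'd) module_scheme \<Rightarrow> 'b set \<Rightarrow> 'b set" where
  "gen_submodule R M X = \<Inter>{N. submodule N R M \<and> X \<subseteq> N}"

definition fin_gen_module :: "('a, 'c) ring_scheme \<Rightarrow> ('a, 'b, 'd) module_scheme \<Rightarrow> bool" where
  "fin_gen_module R M \<longleftrightarrow>
    (\<exists>X. finite X \<and> X \<subseteq> carrier M \<and> gen_submodule R M X = carrier M)"

definition annihilator :: "('a, 'c) ring_scheme \<Rightarrow> ('a, 'b, 'd) module_scheme \<Rightarrow> 'a set" where
  "annihilator R M = {a \<in> carrier R. \<forall>x\<in>carrier M. a \<odot>\<^bsub>M\<^esub> x = \<zero>\<^bsub>M\<^esub>}"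


section \<open>Dimension and depth\<close>

text \<open>In \<open>enat\<close> the supremum of the empty set is \<open>0\<close>, so the zero ring and the zero module get
  dimension and depth \<open>0\<close>.\<close>

definition krull_dim :: "('a, 'c) ring_scheme \<Rightarrow> enat" where
  "krull_dim R =
    Sup {enat l | l. \<exists>P. (\<forall>i\<le>l. primeideal (P i) R) \<and> (\<forall>i<l. P i \<subset> P (Suc i))}"

definition module_dim :: "('a, 'c) ring_scheme \<Rightarrow> ('a, 'b, 'd) module_scheme \<Rightarrow> enat" where
  "module_dim R M = krull_dim (R Quot (annihilator R M))"

text \<open>\<open>ideal_mult R M xs\<close> is the submodule \<open>(xs) M\<close>.\<close>

definition ideal_mult ::
    "('a, 'c) ring_scheme \<Rightarrow> ('a, 'b, 'd) module_scheme \<Rightarrow> 'a list \<Rightarrow> 'b set" where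
  "ideal_mult R M xs = gen_submodule R M {a \<odot>\<^bsub>M\<^esub> x | a x. a \<in> set xs \<and> x \<in> carrier M}"

definition nonzerodivisor_on :: "('a, 'b, 'd) module_scheme \<Rightarrow> 'a \<Rightarrow> bool" where
  "nonzerodivisor_on M a \<longleftrightarrow> (\<forall>x\<in>carrier M. a \<odot>\<^bsub>M\<^esub> x = \<zero>\<^bsub>M\<^esub> \<longrightarrow> x = \<zero>\<^bsub>M\<^esub>)"

definition regular_sequence ::
    "('a, 'c) ring_scheme \<Rightarrow> ('a, 'b, 'd) module_scheme \<Rightarrow> 'a list \<Rightarrow> bool" where
  "regular_sequence R M xs \<longleftrightarrow> set xs \<subseteq> carrier R \<and>
    (\<forall>i<length xs. nonzerodivisor_on (quot_module R M (ideal_mult R M (take i xs))) (xs ! i)) \<and>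
    ideal_mult R M xs \<noteq> carrier M"

definition module_depth ::
    "('a, 'c) ring_scheme \<Rightarrow> 'a set \<Rightarrow> ('a, 'b, 'd) module_scheme \<Rightarrow> enat" where
  "module_depth R J M = Sup {enat (length xs) | xs. set xs \<subseteq> J \<and> regular_sequence R M xs}"


section \<open>Graded modules\<close>

definition grading :: "('b, 'd) ring_scheme \<Rightarrow> (int \<Rightarrow> 'b set) \<Rightarrow> bool" where
  "grading A G \<longleftrightarrow>
    (\<forall>d. additive_subgroup (G d) A) \<and>
    (\<forall>x\<in>carrier A. \<exists>!c. (\<forall>d. c d \<in> G d) \<and> finite {d. c d \<noteq> \<zero>\<^bsub>A\<^esub>} \<and>
        x = (\<Oplus>\<^bsub>A\<^esub>d\<in>{d. c d \<noteq> \<zero>\<^bsub>A\<^esub>}. c d))"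

definition graded_ring :: "('a, 'c) ring_scheme \<Rightarrow> (int \<Rightarrow> 'a set) \<Rightarrow> bool" where
  "graded_ring R RG \<longleftrightarrow> cring R \<and> grading R RG \<and> \<one>\<^bsub>R\<^esub> \<in> RG 0 \<and>
    (\<forall>d e. \<forall>a\<in>RG d. \<forall>b\<in>RG e. a \<otimes>\<^bsub>R\<^esub> b \<in> RG (d + e))"

definition graded_module ::
    "('a, 'c) ring_scheme \<Rightarrow> (int \<Rightarrow> 'a set) \<Rightarrow> ('a, 'b, 'd) module_scheme \<Rightarrow> (int \<Rightarrow> 'b set) \<Rightarrow> bool"
  where
  "graded_module R RG M MG \<longleftrightarrow> graded_ring R RG \<and> Module.module R M \<and> grading M MG \<and>
    (\<forall>d e. \<forall>a\<in>RG d. \<forall>x\<in>MG e. a \<odot>\<^bsub>M\<^esub> x \<in> MG (d + e))"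

definition graded_submodule ::
    "'b set \<Rightarrow> ('a, 'c) ring_scheme \<Rightarrow> (int \<Rightarrow> 'a set) \<Rightarrow> ('a, 'b, 'd) module_scheme \<Rightarrow>
      (int \<Rightarrow> 'b set) \<Rightarrow> bool"
  where
  "graded_submodule N R RG M MG \<longleftrightarrow>
    submodule N R M \<and> graded_module R RG (M\<lparr>carrier := N\<rparr>) (\<lambda>d. N \<inter> MG d)"


section \<open>Sequentially Cohen--Macaulay graded modules\<close>

text \<open>The ideal of the elements of positive degree. For the standard grading of
  \<open>k[x\<^sub>1, \<dots>, x\<^sub>n]\<close> this is the graded maximal ideal \<open>(x\<^sub>1, \<dots>, x\<^sub>n)\<close>.\<close>

definition irrelevant_ideal :: "('a, 'c) ring_scheme \<Rightarrow> (int \<Rightarrow> 'a set) \<Rightarrow> 'a set" where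
  "irrelevant_ideal R RG = genideal R (\<Union>d\<in>{0<..}. RG d)"

text \<open>For a finitely generated graded module over a standard graded algebra over a field;
  the depth is taken with respect to the graded maximal ideal.\<close>

definition cohen_macaulay ::
    "('a, 'c) ring_scheme \<Rightarrow> (int \<Rightarrow> 'a set) \<Rightarrow> ('a, 'b, 'd) module_scheme \<Rightarrow> bool" where
  "cohen_macaulay R RG M \<longleftrightarrow> module_depth R (irrelevant_ideal R RG) M = module_dim R M"

definition sequentially_cohen_macaulay ::
    "('a, 'c) ring_scheme \<Rightarrow> (int \<Rightarrow> 'a set) \<Rightarrow> ('a, 'b, 'd) module_scheme \<Rightarrow> (int \<Rightarrow> 'b set) \<Rightarrow> bool"
  where
  "sequentially_cohen_macaulay R RG M MG \<longleftrightarrow>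
    graded_module R RG M MG \<and> fin_gen_module R M \<and>
    (\<exists>r F. F 0 = {\<zero>\<^bsub>M\<^esub>} \<and> F r = carrier M \<and>
      (\<forall>i\<le>r. graded_submodule (F i) R RG M MG) \<and>
      (\<forall>i<r. F i \<subset> F (Suc i)) \<and>
      (let Q = (\<lambda>i. quot_module R (M\<lparr>carrier := F i\<rparr>) (F (i - 1))) in
        (\<forall>i\<in>{1..r}. cohen_macaulay R RG (Q i)) \<and>
        (\<forall>i\<in>{1..<r}. module_dim R (Q i) < module_dim R (Q (Suc i)))))"


section \<open>The polynomial ring\<close>

text \<open>A monomial is its exponent vector; \<open>Poly_Mapping.single j 1\<close> is the variable \<open>x\<^sub>j\<close>,
  and addition of exponent vectors is multiplication of monomials.\<close>

type_synonym monomial = "nat \<Rightarrow>\<^sub>0 nat"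

definition monomials :: "nat \<Rightarrow> monomial set" where
  "monomials n = {m. Poly_Mapping.keys m \<subseteq> {1..n}}"

definition mdeg :: "monomial \<Rightarrow> nat" where
  "mdeg m = (\<Sum>j\<in>Poly_Mapping.keys m. Poly_Mapping.lookup m j)"

definition squarefree_monomial :: "monomial \<Rightarrow> bool" where
  "squarefree_monomial m \<longleftrightarrow> (\<forall>j. Poly_Mapping.lookup m j \<le> 1)"

text \<open>The order of the library on \<open>nat \<Rightarrow>\<^sub>0 nat\<close> is the lexicographic order with
  \<open>x\<^sub>1 > x\<^sub>2 > \<dots>\<close>.\<close>

lemma monomial_less_iff:
  fixes v w :: monomial
  shows "w < v \<longleftrightarrow>
    (\<exists>j. Poly_Mapping.lookup w j < Poly_Mapping.lookup v j \<and>
      (\<forall>j'<j. Poly_Mapping.lookup w j' = Poly_Mapping.lookup v j'))"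
  by (simp add: less_poly_mapping.rep_eq less_fun_def)

definition poly_ring :: "nat \<Rightarrow> (monomial \<Rightarrow>\<^sub>0 'k::field) ring" where
  "poly_ring n =
    \<lparr>carrier = {p. Poly_Mapping.keys p \<subseteq> monomials n}, mult = (*), one = 1, zero = 0, add = (+)\<rparr>"

definition poly_grading :: "nat \<Rightarrow> int \<Rightarrow> (monomial \<Rightarrow>\<^sub>0 'k::field) set" where
  "poly_grading n d = {p \<in> carrier (poly_ring n). \<forall>m\<in>Poly_Mapping.keys p. int (mdeg m) = d}"

text \<open>The grading of \<open>S/I\<close> consists of the images of the homogeneous components of \<open>S\<close>.\<close>

definition sequentially_cohen_macaulay_ideal :: "nat \<Rightarrow> (monomial \<Rightarrow>\<^sub>0 'k::field) set \<Rightarrow> bool" where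
  "sequentially_cohen_macaulay_ideal n I \<longleftrightarrow>
    sequentially_cohen_macaulay (poly_ring n) (poly_grading n)
      (quot_module (poly_ring n) (regular_module (poly_ring n)) I)
      (\<lambda>d. (\<lambda>p. I +>\<^bsub>poly_ring n\<^esub> p) ` poly_grading n d)"


section \<open>Final squarefree lexsegments\<close>

definition final_squarefree_lexsegment :: "nat \<Rightarrow> monomial \<Rightarrow> monomial set" where
  "final_squarefree_lexsegment n u =
    {w \<in> monomials n. squarefree_monomial w \<and> mdeg w = mdeg u \<and> w \<le> u}"

definition final_squarefree_lexsegment_ideal ::
    "nat \<Rightarrow> monomial \<Rightarrow> (monomial \<Rightarrow>\<^sub>0 'k::field) set" where
  "final_squarefree_lexsegment_ideal n u =
    genideal (poly_ring n) ((\<lambda>w. Poly_Mapping.single w 1) ` final_squarefree_lexsegment n u)"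

end

theory Submission
  imports Defs
begin

text \<open>
  Squarefree monomials are identified with finite sets \<open>F\<close> of variable indices, and \<open>U\<close> denotes the
  set of the indices of \<open>u\<close>. Every set of size \<open>q\<close> that is lexicographically greater than \<open>U\<close>
  contains \<open>1\<close>, because \<open>U\<close> does. Hence the simplicial complex of \<open>I\<close> consists of all sets of size
  less than \<open>q\<close> together with the complex \<open>\<Gamma>\<close> generated by the \<open>q\<close>-sets greater than \<open>U\<close>. Let \<open>I'\<close> be
  the ideal spanned by the monomials whose support is not a face of \<open>\<Gamma>\<close>. The filtration
  \<open>0 \<subset> I'/I \<subset> S/I\<close> has the required form: \<open>I'/I\<close> is Cohen--Macaulay of dimension \<open>q - 1\<close> and \<open>S/I'\<close> is
  Cohen--Macaulay of dimension \<open>q\<close> (if \<open>\<Gamma>\<close> is void, then \<open>I' = S\<close> and the filtration has one step).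

  Depth from below. A common regular sequence for all the modules involved is
  \<open>\<theta> = (e\<^sub>d, \<dots>, e\<^sub>1)\<close>, the elementary symmetric polynomials, largest degree first. It is regular on \<open>k[x\<^sub>j | j \<in> F]\<close> for every \<open>F\<close> of size \<open>d\<close>
  (\<open>wregular_theta_face\<close>): there \<open>e\<^sub>d\<close> is the product of the variables, and the quotient by it is an
  iterated extension of polynomial rings in \<open>d - 1\<close> variables. Both \<open>I'/I\<close> and \<open>S/I'\<close> are iterated
  extensions of shifted copies of such polynomial rings, because the lexicographic order is a
  shelling order (\<open>wregular_lex_shelling\<close>), and regularity passes to extensions
  (\<open>wregular_extension\<close>).

  Depth and dimension from above. Both bounds follow from one counting argument
  (\<open>regular_tower_length\<close>). If \<open>a\<^sub>1, \<dots>, a\<^sub>l\<close> is a regular sequence, or if \<open>a\<^sub>i\<close> lies in the \<open>i\<close>-th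
  prime of a chain but not in the one before it, then the products \<open>a\<^sub>1\<^bsup>j\<^sub>1\<^esup> \<cdots> a\<^sub>l\<^bsup>j\<^sub>l\<^esup> v\<close> are
  linearly independent, whereas the available monomials involve at most \<open>d\<close> variables and
  therefore grow only like the \<open>d\<close>-th power of the degree. Chains of face ideals show that the
  dimension is at least \<open>d\<close>.
\<close>

section \<open>Weakly regular sequences on subquotients\<close>

text \<open>All modules below are subquotients \<open>A/B\<close> of a commutative ring, with \<open>B \<subseteq> A\<close> closed under a
  set \<open>S\<close> of scalars. Working with the pairs \<open>(A, B)\<close> inside one type avoids nested quotients.\<close>
definition submod :: "'a::comm_ring_1 set \<Rightarrow> 'a set \<Rightarrow> bool" where
  "submod S A \<longleftrightarrow> 0 \<in> A \<and> (\<forall>x\<in>A. \<forall>y\<in>A. x - y \<in> A) \<and> (\<forall>s\<in>S. \<forall>x\<in>A. s * x \<in> A)"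

lemma submod_zero: "submod S A \<Longrightarrow> 0 \<in> A"
  and submod_diff: "submod S A \<Longrightarrow> x \<in> A \<Longrightarrow> y \<in> A \<Longrightarrow> x - y \<in> A"
  and submod_smult: "submod S A \<Longrightarrow> s \<in> S \<Longrightarrow> x \<in> A \<Longrightarrow> s * x \<in> A"
  by (auto simp: submod_def)

lemma submod_uminus: "submod S A \<Longrightarrow> x \<in> A \<Longrightarrow> - x \<in> A"
  using submod_diff[of S A 0 x] by (simp add: submod_zero)

lemma submod_add: "submod S A \<Longrightarrow> x \<in> A \<Longrightarrow> y \<in> A \<Longrightarrow> x + y \<in> A"
  using submod_diff[of S A x "- y"] by (simp add: submod_uminus)

lemma submod_add_cancel: "submod S A \<Longrightarrow> y \<in> A \<Longrightarrow> x + y \<in> A \<longleftrightarrow> x \<in> A"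
  using submod_diff[of S A "x + y" y] submod_add[of S A x y] by auto

lemma submod_sum:
  assumes "submod S A" "\<And>i. i \<in> J \<Longrightarrow> f i \<in> A"
  shows "sum f J \<in> A"
  using assms(2) by (induction J rule: infinite_finite_induct)
    (auto simp: submod_zero[OF assms(1)] intro: submod_add[OF assms(1)])

definition mul_add :: "'a::comm_ring_1 \<Rightarrow> 'a set \<Rightarrow> 'a set \<Rightarrow> 'a set" where
  "mul_add x A B = {x * a + b | a b. a \<in> A \<and> b \<in> B}"

lemma mul_addI: "a \<in> A \<Longrightarrow> b \<in> B \<Longrightarrow> x * a + b \<in> mul_add x A B"
  by (auto simp: mul_add_def)

lemma mul_addE:
  assumes "y \<in> mul_add x A B"
  obtains a b where "a \<in> A" "b \<in> B" "y = x * a + b"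
  using assms by (auto simp: mul_add_def)

lemma mul_add_right: "0 \<in> A \<Longrightarrow> b \<in> B \<Longrightarrow> b \<in> mul_add x A B"
  using mul_addI[of 0 A b B x] by simp

lemma mul_add_left: "0 \<in> B \<Longrightarrow> a \<in> A \<Longrightarrow> x * a \<in> mul_add x A B"
  using mul_addI[of a A 0 B x] by simp

lemma submod_mul_add:
  assumes A: "submod S A" and B: "submod S B"
  shows "submod S (mul_add x A B)"
  unfolding submod_def
proof (intro conjI ballI)
  show "0 \<in> mul_add x A B" using mul_add_right submod_zero A B by metis
next
  fix y z assume "y \<in> mul_add x A B" "z \<in> mul_add x A B"
  then obtain a b a' b' where "a \<in> A" "b \<in> B" "a' \<in> A" "b' \<in> B"
    "y = x * a + b" "z = x * a' + b'" by (metis mul_addE)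
  then have "y - z = x * (a - a') + (b - b')" "a - a' \<in> A" "b - b' \<in> B"
    by (auto simp: algebra_simps intro: submod_diff[OF A] submod_diff[OF B])
  then show "y - z \<in> mul_add x A B" by (metis mul_addI)
next
  fix s y assume s: "s \<in> S" and "y \<in> mul_add x A B"
  then obtain a b where ab: "a \<in> A" "b \<in> B" "y = x * a + b" by (metis mul_addE)
  then have "s * y = x * (s * a) + s * b" by (simp add: algebra_simps)
  then show "s * y \<in> mul_add x A B"
    using mul_addI[OF submod_smult[OF A s ab(1)] submod_smult[OF B s ab(2)]] by metis
qed

lemma mul_add_subset: "submod S A \<Longrightarrow> x \<in> S \<Longrightarrow> B \<subseteq> A \<Longrightarrow> mul_add x A B \<subseteq> A"
  by (auto elim!: mul_addE intro!: submod_add submod_smult)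

text \<open>A weakly regular sequence on \<open>A/B\<close>. The recursion enlarges \<open>B\<close> and keeps \<open>A\<close>, so that
  \<open>(A/B)/x(A/B)\<close> is again represented by a pair.\<close>
primrec wregular :: "'a::comm_ring_1 set \<Rightarrow> 'a set \<Rightarrow> 'a list \<Rightarrow> bool" where
  "wregular A B [] \<longleftrightarrow> True"
| "wregular A B (x # xs) \<longleftrightarrow> (\<forall>a\<in>A. x * a \<in> B \<longrightarrow> a \<in> B) \<and> wregular A (mul_add x A B) xs"

text \<open>The submodule \<open>(xs) A + B\<close>, by the same recursion as for \<open>wregular\<close>.\<close>
primrec multsum :: "'a::comm_ring_1 set \<Rightarrow> 'a set \<Rightarrow> 'a list \<Rightarrow> 'a set" where
  "multsum A B [] = B"
| "multsum A B (x # xs) = multsum A (mul_add x A B) xs"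

lemma submod_multsum: "submod S A \<Longrightarrow> submod S B \<Longrightarrow> submod S (multsum A B xs)"
  by (induction xs arbitrary: B) (auto intro: submod_mul_add)

lemma multsum_base: "0 \<in> A \<Longrightarrow> B \<subseteq> multsum A B xs"
proof (induction xs arbitrary: B)
  case (Cons x xs)
  have "B \<subseteq> mul_add x A B" using mul_add_right Cons.prems by blast
  also have "\<dots> \<subseteq> multsum A (mul_add x A B) xs" using Cons by blast
  finally show ?case by simp
qed simp

lemma multsum_prod:
  assumes "0 \<in> A" "0 \<in> B" "x \<in> set xs" "a \<in> A"
  shows "x * a \<in> multsum A B xs"
  using assms
proof (induction xs arbitrary: B)
  case (Cons y ys)
  show ?case
  proof (cases "x = y")
    case True
    then show ?thesis
      using mul_add_left[of B a A x] multsum_base[of A "mul_add x A B" ys] Cons.prems by auto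
  next
    case False
    then show ?thesis using Cons mul_add_right[of A 0 B y] by auto
  qed
qed simp

lemma multsum_least:
  assumes "submod S N" "B \<subseteq> N" "\<And>x a. x \<in> set xs \<Longrightarrow> a \<in> A \<Longrightarrow> x * a \<in> N"
  shows "multsum A B xs \<subseteq> N"
  using assms(2,3)
proof (induction xs arbitrary: B)
  case (Cons y ys)
  have "mul_add y A B \<subseteq> N"
    using Cons.prems by (auto elim!: mul_addE intro!: submod_add[OF assms(1)])
  then show ?case using Cons by simp
qed simp

lemma multsum_subset:
  "submod S A \<Longrightarrow> set xs \<subseteq> S \<Longrightarrow> B \<subseteq> A \<Longrightarrow> multsum A B xs \<subseteq> A"
  by (rule multsum_least) (auto intro: submod_smult)

lemma wregular_iff_nth:
  "wregular A B xs \<longleftrightarrow>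
    (\<forall>i<length xs. \<forall>a\<in>A. xs ! i * a \<in> multsum A B (take i xs) \<longrightarrow> a \<in> multsum A B (take i xs))"
proof (induction xs arbitrary: B)
  case (Cons x xs)
  show ?case by (simp add: Cons.IH All_less_Suc2)
qed simp

text \<open>Weak regularity is invariant under isomorphism. The hypotheses say that \<open>f\<close> induces an
  isomorphism \<open>A1/B1 \<cong> A2/B2\<close> without mentioning the quotients, and \<open>f\<close> continues to induce an
  isomorphism after both denominators have been enlarged by the multiples of \<open>x\<close>.\<close>
lemma wregular_transfer:
  assumes A1: "submod S A1" and A2: "submod S A2" and B2: "submod S B2"
    and xs: "set xs \<subseteq> S"
    and maps: "\<And>a. a \<in> A1 \<Longrightarrow> f a \<in> A2"
    and diff: "\<And>a a'. a \<in> A1 \<Longrightarrow> a' \<in> A1 \<Longrightarrow> f (a - a') = f a - f a'"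
    and lin: "\<And>s a. s \<in> S \<Longrightarrow> a \<in> A1 \<Longrightarrow> f (s * a) = s * f a"
    and onto: "\<And>y. y \<in> A2 \<Longrightarrow> \<exists>a\<in>A1. y - f a \<in> B2"
    and ker: "\<And>a. a \<in> A1 \<Longrightarrow> f a \<in> B2 \<longleftrightarrow> a \<in> B1"
    and B12: "B1 \<subseteq> A1" "B2 \<subseteq> A2" and reg: "wregular A1 B1 xs"
  shows "wregular A2 B2 xs"
  using B2 xs onto ker B12 reg
proof (induction xs arbitrary: B1 B2)
  case (Cons x xs)
  note B2 = Cons.prems(1) and onto = Cons.prems(3) and ker = Cons.prems(4)
  have x: "x \<in> S" using Cons.prems by simp
  show ?case
  proof (simp, intro conjI ballI impI)
    fix y assume y: "y \<in> A2" "x * y \<in> B2"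
    obtain a where a: "a \<in> A1" "y - f a \<in> B2" using onto y by blast
    have "f (x * a) = x * y - x * (y - f a)" using lin[OF x a(1)] by (simp add: algebra_simps)
    then have "f (x * a) \<in> B2" using submod_diff[OF B2] submod_smult[OF B2 x a(2)] y by simp
    then have "x * a \<in> B1" using ker a x submod_smult[OF A1] by blast
    then have "a \<in> B1" using a Cons.prems(7) by simp
    then have "f a \<in> B2" using ker a by blast
    then show "y \<in> B2" using submod_add[OF B2 _ a(2), of "f a"] by simp
  next
    have zA: "0 \<in> A1" "0 \<in> A2" "0 \<in> B2" using A1 A2 B2 submod_zero by auto
    show "wregular A2 (mul_add x A2 B2) xs"
    proof (rule Cons.IH[where ?B1.0 = "mul_add x A1 B1"])
      show "submod S (mul_add x A2 B2)" using submod_mul_add A2 B2 by blast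
      show "set xs \<subseteq> S" using Cons.prems by simp
      show "\<exists>a\<in>A1. y - f a \<in> mul_add x A2 B2" if "y \<in> A2" for y
        using onto[OF that] mul_add_right[OF zA(2)] by blast
      show "mul_add x A1 B1 \<subseteq> A1" "mul_add x A2 B2 \<subseteq> A2"
        using mul_add_subset A1 A2 x Cons.prems by blast+
      show "wregular A1 (mul_add x A1 B1) xs" using Cons.prems by simp
      fix a assume a: "a \<in> A1"
      show "f a \<in> mul_add x A2 B2 \<longleftrightarrow> a \<in> mul_add x A1 B1"
      proof
        assume "f a \<in> mul_add x A2 B2"
        then obtain y b where yb: "y \<in> A2" "b \<in> B2" "f a = x * y + b" by (metis mul_addE)
        obtain a' where a': "a' \<in> A1" "y - f a' \<in> B2" using onto yb by blast
        have "f (a - x * a') = x * (y - f a') + b"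
          using diff[OF a submod_smult[OF A1 x a'(1)]] lin[OF x a'(1)] yb by (simp add: algebra_simps)
        moreover have "\<dots> \<in> B2" using submod_add[OF B2] submod_smult[OF B2 x a'(2)] yb by blast
        ultimately have "a - x * a' \<in> B1"
          using ker[OF submod_diff[OF A1 a submod_smult[OF A1 x a'(1)]]] by simp
        then show "a \<in> mul_add x A1 B1" using mul_addI[OF a'(1), of "a - x * a'" B1 x] by simp
      next
        assume "a \<in> mul_add x A1 B1"
        then obtain y b where yb: "y \<in> A1" "b \<in> B1" "a = x * y + b" by (metis mul_addE)
        have "f b = f a - f (x * y)" using diff[OF a submod_smult[OF A1 x yb(1)]] yb by simp
        then have "f a = x * f y + f b" using lin[OF x yb(1)] by simp
        moreover have "f b \<in> B2" using ker yb Cons.prems(5) by blast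
        ultimately show "f a \<in> mul_add x A2 B2" using mul_addI maps yb by metis
      qed
    qed
  qed
qed simp

text \<open>If \<open>x\<close> is regular on the ends \<open>B/C\<close> and \<open>A/B\<close> of an extension, then it is regular on \<open>A/C\<close>, and
  reduction modulo \<open>x\<close> keeps the sequence of modules exact. Exactness on the left is the
  isomorphism \<open>B/(xB + C) \<cong> (xA + B)/(xA + C)\<close>, which holds because \<open>x\<close> is regular on \<open>A/B\<close>.\<close>
lemma wregular_extension:
  assumes A: "submod S A" and B: "submod S B" and C: "submod S C"
    and sub: "C \<subseteq> B" "B \<subseteq> A" and xs: "set xs \<subseteq> S"
    and AB: "wregular A B xs" and BC: "wregular B C xs"
  shows "wregular A C xs"
  using B C sub xs AB BC
proof (induction xs arbitrary: B C)
  case (Cons x xs)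
  note B = Cons.prems(1) and C = Cons.prems(2)
  have x: "x \<in> S" using Cons.prems by simp
  have CB: "C \<subseteq> B" "B \<subseteq> A" using Cons.prems by auto
  have z: "0 \<in> A" "0 \<in> B" "0 \<in> C" using A B C submod_zero by auto
  have regA: "\<And>a. a \<in> A \<Longrightarrow> x * a \<in> B \<Longrightarrow> a \<in> B" and regB: "\<And>a. a \<in> B \<Longrightarrow> x * a \<in> C \<Longrightarrow> a \<in> C"
    using Cons.prems by auto
  let ?B = "mul_add x A B" and ?C = "mul_add x A C"
  have sm: "submod S ?B" "submod S ?C" using submod_mul_add A B C by blast+
  have CB': "?C \<subseteq> ?B" using CB by (auto simp: mul_add_def)
  have BA': "?B \<subseteq> A" using mul_add_subset A x CB by blast
  have "wregular ?B ?C xs"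
  proof (rule wregular_transfer[where f = "\<lambda>a. a" and ?A1.0 = B and ?B1.0 = "mul_add x B C" and S = S])
    show "\<exists>a\<in>B. y - a \<in> ?C" if "y \<in> ?B" for y
      using that mul_add_left[OF z(3)] by (metis add_diff_cancel_right' mul_addE)
    show "a \<in> ?C \<longleftrightarrow> a \<in> mul_add x B C" if a: "a \<in> B" for a
    proof
      assume "a \<in> ?C"
      then obtain y c where yc: "y \<in> A" "c \<in> C" "a = x * y + c" by (metis mul_addE)
      then have "x * y \<in> B" using submod_diff[OF B a, of c] CB by auto
      then show "a \<in> mul_add x B C" using regA yc mul_addI by metis
    qed (use CB in \<open>auto simp: mul_add_def\<close>)
    show "mul_add x B C \<subseteq> B" using mul_add_subset B x CB by blast
    show "wregular B (mul_add x B C) xs" using Cons.prems by simp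
    show "a \<in> ?B" if "a \<in> B" for a using mul_add_right z that by metis
  qed (use B sm CB' Cons.prems in auto)
  then have "wregular A ?C xs"
    using Cons.IH[OF sm CB' BA'] Cons.prems by simp
  then show ?case using regA regB CB submod_smult[OF A x] by auto
qed simp

lemma wregular_refl: "submod S A \<Longrightarrow> set xs \<subseteq> S \<Longrightarrow> wregular A A xs"
proof (induction xs)
  case (Cons x xs)
  have "mul_add x A A = A"
    using mul_add_subset[of S A x A] mul_add_right[of A _ A x] submod_zero Cons.prems by auto
  then show ?case using Cons by simp
qed simp

section \<open>Squarefree monomial ideals\<close>

(* keeps the interval {1..n} in one normal form *)
declare One_nat_def [simp del]

abbreviation supp :: "monomial \<Rightarrow> nat set" where
  "supp m \<equiv> Poly_Mapping.keys m"

abbreviation terms :: "(monomial \<Rightarrow>\<^sub>0 'k::field) \<Rightarrow> monomial set" where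
  "terms p \<equiv> Poly_Mapping.keys p"

abbreviation coeff :: "(monomial \<Rightarrow>\<^sub>0 'k::field) \<Rightarrow> monomial \<Rightarrow> 'k" where
  "coeff p m \<equiv> Poly_Mapping.lookup p m"

abbreviation polys :: "nat \<Rightarrow> (monomial \<Rightarrow>\<^sub>0 'k::field) set" where
  "polys n \<equiv> carrier (poly_ring n)"

lemma polys_iff: "p \<in> polys n \<longleftrightarrow> (\<forall>m\<in>terms p. supp m \<subseteq> {1..n})"
  by (auto simp: poly_ring_def monomials_def)

lemma supp_add: "supp (m + m') = supp m \<union> supp m'"
  by (auto simp: Poly_Mapping.in_keys_iff Poly_Mapping.lookup_add)

lemma terms_diff: "m \<in> terms (p - q) \<Longrightarrow> m \<in> terms p \<or> m \<in> terms q"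
  by (auto simp: Poly_Mapping.in_keys_iff Poly_Mapping.lookup_minus)

lemma terms_mult:
  assumes "m \<in> terms (p * q)"
  obtains a b where "a \<in> terms p" "b \<in> terms q" "m = a + b"
  using assms Poly_Mapping.keys_mult[of p q] by blast

definition restrict_terms ::
    "(monomial \<Rightarrow> bool) \<Rightarrow> (monomial \<Rightarrow>\<^sub>0 'k::field) \<Rightarrow> (monomial \<Rightarrow>\<^sub>0 'k)" where
  "restrict_terms Q p = (\<Sum>m\<in>{m \<in> terms p. Q m}. Poly_Mapping.single m (coeff p m))"

lemma coeff_restrict_terms: "coeff (restrict_terms Q p) m = (if Q m then coeff p m else 0)"
proof -
  have "coeff (restrict_terms Q p) m =
      (\<Sum>k\<in>{k \<in> terms p. Q k}. if k = m then coeff p m else 0)"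
    unfolding restrict_terms_def Poly_Mapping.lookup_sum
    by (rule sum.cong) (auto simp: Poly_Mapping.lookup_single when_def)
  also have "\<dots> = (if Q m then coeff p m else 0)"
    by (auto simp: sum.delta Poly_Mapping.in_keys_iff)
  finally show ?thesis .
qed

lemma terms_restrict_terms [simp]: "terms (restrict_terms Q p) = {m \<in> terms p. Q m}"
  by (auto simp: Poly_Mapping.in_keys_iff coeff_restrict_terms split: if_splits)

lemma restrict_terms_split: "p = restrict_terms Q p + restrict_terms (\<lambda>m. \<not> Q m) p"
  by (rule Poly_Mapping.poly_mapping_eqI) (simp add: coeff_restrict_terms Poly_Mapping.lookup_add)

lemma sum_of_terms: "p = (\<Sum>m\<in>terms p. Poly_Mapping.single m (coeff p m))"
  using restrict_terms_split[of p "\<lambda>_. True"] by (simp add: restrict_terms_def)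

lemma restrict_terms_polys: "p \<in> polys n \<Longrightarrow> restrict_terms Q p \<in> polys n"
  by (auto simp: polys_iff)

lemma coeff_monomial_mult:
  "coeff (Poly_Mapping.single a 1 * p) (a + m) = coeff p m"
proof -
  have "Poly_Mapping.single a 1 * p =
      (\<Sum>k\<in>terms p. Poly_Mapping.single (a + k) (coeff p k))"
    by (subst (1) sum_of_terms[of p]) (simp add: sum_distrib_left Poly_Mapping.mult_single)
  then have "coeff (Poly_Mapping.single a 1 * p) (a + m) =
      (\<Sum>k\<in>terms p. if k = m then coeff p m else 0)"
    by (auto simp: Poly_Mapping.lookup_sum Poly_Mapping.lookup_single when_def intro!: sum.cong)
  also have "\<dots> = coeff p m" by (auto simp: sum.delta Poly_Mapping.in_keys_iff)
  finally show ?thesis .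
qed

lemma terms_monomial_mult: "terms (Poly_Mapping.single a 1 * p) = (+) a ` terms p"
proof
  show "terms (Poly_Mapping.single a 1 * p) \<subseteq> (+) a ` terms p"
    using Poly_Mapping.keys_mult[of "Poly_Mapping.single a 1" p] by auto
  show "(+) a ` terms p \<subseteq> terms (Poly_Mapping.single a 1 * p)"
    by (auto simp: Poly_Mapping.in_keys_iff coeff_monomial_mult)
qed

definition sqm :: "nat set \<Rightarrow> monomial" where
  "sqm F = (\<Sum>j\<in>F. Poly_Mapping.single j 1)"

lemma lookup_sqm: "finite F \<Longrightarrow> Poly_Mapping.lookup (sqm F) j = (if j \<in> F then 1 else 0)"
proof -
  assume "finite F"
  then have "Poly_Mapping.lookup (sqm F) j = (\<Sum>k\<in>F. if k = j then 1 else 0)"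
    unfolding sqm_def Poly_Mapping.lookup_sum
    by (intro sum.cong) (auto simp: Poly_Mapping.lookup_single when_def)
  then show ?thesis using \<open>finite F\<close> by (simp add: sum.delta)
qed

lemma supp_sqm: "finite F \<Longrightarrow> supp (sqm F) = F"
  by (auto simp: Poly_Mapping.in_keys_iff lookup_sqm split: if_splits)

lemma sqm_less_iff:
  assumes "finite F" "finite Z"
  shows "sqm F < sqm Z \<longleftrightarrow> (\<exists>j. j \<in> Z \<and> j \<notin> F \<and> (\<forall>j'<j. j' \<in> F \<longleftrightarrow> j' \<in> Z))"
  unfolding monomial_less_iff lookup_sqm[OF assms(1)] lookup_sqm[OF assms(2)] by (auto split: if_splits)

definition xmon :: "nat set \<Rightarrow> (monomial \<Rightarrow>\<^sub>0 'k::field)" where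
  "xmon F = Poly_Mapping.single (sqm F) 1"

lemma terms_xmon [simp]: "terms (xmon F :: monomial \<Rightarrow>\<^sub>0 'k::field) = {sqm F}"
  by (simp add: xmon_def)

lemma xmon_polys: "F \<subseteq> {1..n} \<Longrightarrow> xmon F \<in> polys n"
  by (auto simp: polys_iff supp_sqm finite_subset[of F "{1..n}"])

lemma xmon_divides:
  assumes y: "y \<in> polys n" and R: "finite R" and dv: "\<And>m. m \<in> terms y \<Longrightarrow> R \<subseteq> supp m"
  obtains a where "a \<in> polys n" "y = xmon R * a"
proof
  let ?a = "\<Sum>m\<in>terms y. Poly_Mapping.single (m - sqm R) (coeff y m)"
  have ins: "sqm R + (m - sqm R) = m" if "m \<in> terms y" for m
    using dv[OF that] R by (intro Poly_Mapping.poly_mapping_eqI)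
      (auto simp: Poly_Mapping.lookup_add Poly_Mapping.lookup_minus lookup_sqm Poly_Mapping.in_keys_iff Suc_le_eq)
  have "xmon R * ?a = (\<Sum>m\<in>terms y. Poly_Mapping.single (sqm R + (m - sqm R)) (coeff y m))"
    by (simp add: xmon_def sum_distrib_left Poly_Mapping.mult_single)
  also have "\<dots> = y" using ins sum_of_terms[of y] by simp
  finally show "y = xmon R * ?a" by simp
  show "?a \<in> polys n"
    unfolding polys_iff
  proof
    fix k assume "k \<in> terms ?a"
    then obtain m where m: "m \<in> terms y" "k \<in> terms (Poly_Mapping.single (m - sqm R) (coeff y m))"
      using Poly_Mapping.keys_sum[of "\<lambda>m. Poly_Mapping.single (m - sqm R) (coeff y m)" "terms y"] by blast
    then have "k = m - sqm R" by (auto split: if_splits)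
    then have "supp k \<subseteq> supp m" by (auto simp: Poly_Mapping.in_keys_iff Poly_Mapping.lookup_minus)
    then show "supp k \<subseteq> {1..n}" using y m by (auto simp: polys_iff)
  qed
qed

definition upset :: "nat \<Rightarrow> nat set set \<Rightarrow> bool" where
  "upset n D \<longleftrightarrow> D \<subseteq> Pow {1..n} \<and> (\<forall>H\<in>D. \<forall>H'\<subseteq>{1..n}. H \<subseteq> H' \<longrightarrow> H' \<in> D)"

lemma upsetD: "upset n D \<Longrightarrow> H \<in> D \<Longrightarrow> H \<subseteq> H' \<Longrightarrow> H' \<subseteq> {1..n} \<Longrightarrow> H' \<in> D"
  and upset_subset: "upset n D \<Longrightarrow> H \<in> D \<Longrightarrow> H \<subseteq> {1..n}"
  by (auto simp: upset_def)

text \<open>For an up-closed family \<open>D\<close> of subsets of \<open>{1..n}\<close> these are the squarefree monomial ideals; the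
  complement of \<open>D\<close> is the Stanley--Reisner complex of the quotient ring.\<close>
definition sqf_ideal :: "nat \<Rightarrow> nat set set \<Rightarrow> (monomial \<Rightarrow>\<^sub>0 'k::field) set" where
  "sqf_ideal n D = {p \<in> polys n. \<forall>m\<in>terms p. supp m \<in> D}"

lemma sqf_ideal_polys: "sqf_ideal n D \<subseteq> polys n"
  by (auto simp: sqf_ideal_def)

lemma sqf_ideal_mono: "D' \<subseteq> D \<Longrightarrow> sqf_ideal n D' \<subseteq> sqf_ideal n D"
  by (auto simp: sqf_ideal_def)

lemma sqf_ideal_Pow: "sqf_ideal n (Pow {1..n}) = polys n"
  by (auto simp: sqf_ideal_def polys_iff subset_iff)

lemma xmon_sqf_ideal:
  assumes "F \<subseteq> {1..n}"
  shows "xmon F \<in> sqf_ideal n D \<longleftrightarrow> F \<in> D"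
  using assms xmon_polys[of F n] supp_sqm[of F] finite_subset[of F "{1..n}"] by (auto simp: sqf_ideal_def)

lemma submod_sqf_ideal:
  assumes "upset n D"
  shows "submod (polys n) (sqf_ideal n D)"
  unfolding submod_def
proof (intro conjI ballI)
  show "0 \<in> sqf_ideal n D" by (auto simp: sqf_ideal_def polys_iff)
next
  fix x y :: "monomial \<Rightarrow>\<^sub>0 'k::field" assume "x \<in> sqf_ideal n D" "y \<in> sqf_ideal n D"
  then show "x - y \<in> sqf_ideal n D"
    by (auto simp: sqf_ideal_def polys_iff dest!: terms_diff)
next
  fix s x :: "monomial \<Rightarrow>\<^sub>0 'k::field" assume sx: "s \<in> polys n" "x \<in> sqf_ideal n D"
  have "supp m \<in> D \<and> supp m \<subseteq> {1..n}" if m: "m \<in> terms (s * x)" for m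
  proof -
    obtain a b where ab: "a \<in> terms s" "b \<in> terms x" "m = a + b" using terms_mult[OF m] .
    then have "supp b \<in> D" "supp b \<subseteq> supp m" "supp m \<subseteq> {1..n}"
      using sx by (auto simp: sqf_ideal_def polys_iff supp_add)
    then show ?thesis using upsetD[OF assms] by blast
  qed
  then show "s * x \<in> sqf_ideal n D" by (auto simp: sqf_ideal_def polys_iff)
qed

lemma submod_polys: "submod (polys n) (polys n :: (monomial \<Rightarrow>\<^sub>0 'k::field) set)"
  using submod_sqf_ideal[of n "Pow {1..n}"] by (simp add: sqf_ideal_Pow upset_def)

lemma polys_mult: "x \<in> polys n \<Longrightarrow> y \<in> polys n \<Longrightarrow> x * y \<in> polys n"
  by (rule submod_smult[OF submod_polys])

lemma one_polys: "1 \<in> polys n"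
  by (simp add: polys_iff)

text \<open>With \<open>D\<close> the family of the nonfaces of a simplex \<open>F\<close>, the ideal \<open>sqf_ideal n D\<close> is generated by the
  variables outside \<open>F\<close>, and the quotient ring is \<open>k[x\<^sub>j | j \<in> F]\<close>.\<close>
definition nonfaces :: "nat \<Rightarrow> nat set \<Rightarrow> nat set set" where
  "nonfaces n F = {H. H \<subseteq> {1..n} \<and> \<not> H \<subseteq> F}"

lemma upset_nonfaces: "upset n (nonfaces n F)"
  by (auto simp: upset_def nonfaces_def)

abbreviation face_ideal :: "nat \<Rightarrow> nat set \<Rightarrow> (monomial \<Rightarrow>\<^sub>0 'k::field) set" where
  "face_ideal n F \<equiv> sqf_ideal n (nonfaces n F)"

lemma face_ideal_iff: "p \<in> face_ideal n F \<longleftrightarrow> p \<in> polys n \<and> (\<forall>m\<in>terms p. \<not> supp m \<subseteq> F)"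
  by (auto simp: sqf_ideal_def nonfaces_def polys_iff)

text \<open>Modulo the ideal, a polynomial may be replaced by its terms in the variables of \<open>F\<close>. A product of
  two such polynomials is again one, so it lies in the ideal only if it vanishes, and polynomials
  over a field have no zero divisors.\<close>
lemma face_ideal_prime:
  fixes a b :: "monomial \<Rightarrow>\<^sub>0 'k::field"
  assumes a: "a \<in> polys n" and b: "b \<in> polys n" and ab: "a * b \<in> face_ideal n F"
  shows "a \<in> face_ideal n F \<or> b \<in> face_ideal n F"
proof -
  note sm = submod_sqf_ideal[OF upset_nonfaces]
  let ?r = "restrict_terms (\<lambda>m. supp m \<subseteq> F)" and ?r' = "restrict_terms (\<lambda>m. \<not> supp m \<subseteq> F)"
  have r': "?r' p \<in> face_ideal n F" if "p \<in> polys n" for p :: "monomial \<Rightarrow>\<^sub>0 'k"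
    using that by (auto simp: face_ideal_iff restrict_terms_polys)
  have iff: "p \<in> face_ideal n F \<longleftrightarrow> ?r p = 0" if "p \<in> polys n" for p :: "monomial \<Rightarrow>\<^sub>0 'k"
  proof -
    have "?r p = 0 \<longleftrightarrow> terms (?r p) = {}" by (simp only: Poly_Mapping.keys_eq_empty)
    then show ?thesis using that by (auto simp: face_ideal_iff)
  qed
  have "a * b = (?r a + ?r' a) * b"
    by (rule arg_cong[where f = "\<lambda>p. p * b", OF restrict_terms_split[of a "\<lambda>m. supp m \<subseteq> F"]])
  also have "\<dots> = ?r a * b + ?r' a * b" by (rule distrib_right)
  also have "?r a * b = ?r a * (?r b + ?r' b)"
    by (rule arg_cong[where f = "\<lambda>p. ?r a * p", OF restrict_terms_split[of b "\<lambda>m. supp m \<subseteq> F"]])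
  finally have "a * b = ?r a * ?r b + (b * ?r' a + ?r a * ?r' b)" by (simp add: algebra_simps)
  moreover have "b * ?r' a + ?r a * ?r' b \<in> face_ideal n F"
    by (intro submod_add[OF sm] submod_smult[OF sm] r' a b restrict_terms_polys)
  ultimately have *: "?r a * ?r b \<in> face_ideal n F"
    using ab submod_add_cancel[OF sm, of "b * ?r' a + ?r a * ?r' b" n F "?r a * ?r b"] by simp
  have "terms (?r a * ?r b) = {}"
  proof (rule ccontr)
    assume "terms (?r a * ?r b) \<noteq> {}"
    then obtain m where m: "m \<in> terms (?r a * ?r b)" by blast
    obtain k l where "k \<in> terms (?r a)" "l \<in> terms (?r b)" "m = k + l" using terms_mult[OF m] .
    then have "supp m \<subseteq> F" by (auto simp: supp_add)
    moreover have "\<not> supp m \<subseteq> F"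
      by (rule bspec[OF conjunct2[OF *[unfolded face_ideal_iff]] m])
    ultimately show False by simp
  qed
  then have "?r a * ?r b = 0" by (simp only: Poly_Mapping.keys_eq_empty)
  then have "?r a = 0 \<or> ?r b = 0" by (simp only: mult_eq_0_iff)
  then show ?thesis using iff[OF a] iff[OF b] by blast
qed

text \<open>If the monomials in \<open>sqf_ideal n D\<close> but not in \<open>sqf_ideal n D'\<close> are those with support in an interval
  \<open>[R, F]\<close>, then multiplication by the squarefree monomial of \<open>R\<close> identifies \<open>k[x\<^sub>j | j \<in> F]\<close> with the
  quotient of the two ideals.\<close>
lemma wregular_interval:
  assumes D: "upset n D" and D': "upset n D'" and sub: "D' \<subseteq> D"
    and int: "D - D' = {H. R \<subseteq> H \<and> H \<subseteq> F}" and RF: "R \<subseteq> F" "F \<subseteq> {1..n}"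
    and xs: "set xs \<subseteq> polys n" and reg: "wregular (polys n) (face_ideal n F) xs"
  shows "wregular (sqf_ideal n D) (sqf_ideal n D') (xs :: (monomial \<Rightarrow>\<^sub>0 'k::field) list)"
proof (rule wregular_transfer[where f = "\<lambda>p. xmon R * p" and ?A1.0 = "polys n"
      and ?B1.0 = "face_ideal n F" and S = "polys n"])
  have fR: "finite R" and Rn: "R \<subseteq> {1..n}" using RF finite_subset[of R "{1..n}"] by auto
  have RD: "R \<in> D" using int RF by blast
  have tm: "terms (xmon R * p) = (+) (sqm R) ` terms p" for p :: "monomial \<Rightarrow>\<^sub>0 'k"
    by (simp add: xmon_def terms_monomial_mult)
  have sp: "supp (sqm R + k) = R \<union> supp k" for k by (simp add: supp_add supp_sqm fR)
  show maps: "xmon R * p \<in> sqf_ideal n D" if "p \<in> polys n" for p :: "monomial \<Rightarrow>\<^sub>0 'k"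
  proof -
    have "xmon R * p \<in> polys n" using that polys_mult xmon_polys[OF Rn] by blast
    moreover have "R \<union> supp k \<in> D" if "k \<in> terms p" for k
      using upsetD[OF D RD, of "R \<union> supp k"] Rn that \<open>p \<in> polys n\<close> by (auto simp: polys_iff)
    ultimately show ?thesis by (auto simp: sqf_ideal_def tm sp)
  qed
  show "\<exists>a\<in>polys n. y - xmon R * a \<in> sqf_ideal n D'" if y: "y \<in> sqf_ideal n D"
    for y :: "monomial \<Rightarrow>\<^sub>0 'k"
  proof -
    let ?Q = "\<lambda>m. supp m \<in> D'"
    let ?y = "restrict_terms (\<lambda>m. \<not> ?Q m) y"
    have yn: "y \<in> polys n" using y sqf_ideal_polys by blast
    have "R \<subseteq> supp m" if "m \<in> terms ?y" for m
      using that y int by (auto simp: sqf_ideal_def)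
    then obtain a where a: "a \<in> polys n" "?y = xmon R * a"
      using xmon_divides[OF restrict_terms_polys[OF yn] fR] by metis
    have "y - ?y = restrict_terms ?Q y" using restrict_terms_split[of y ?Q] by (simp add: diff_eq_eq)
    then have "y - xmon R * a \<in> sqf_ideal n D'"
      using a yn by (auto simp: sqf_ideal_def restrict_terms_polys)
    then show ?thesis using a by blast
  qed
  show "xmon R * p \<in> sqf_ideal n D' \<longleftrightarrow> p \<in> face_ideal n F" if p: "p \<in> polys n" for p :: "monomial \<Rightarrow>\<^sub>0 'k"
  proof -
    have "R \<union> supp k \<in> D' \<longleftrightarrow> \<not> supp k \<subseteq> F" if k: "k \<in> terms p" for k
    proof -
      have "R \<union> supp k \<in> D" using upsetD[OF D RD, of "R \<union> supp k"] Rn k p by (auto simp: polys_iff)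
      moreover have "R \<union> supp k \<in> D - D' \<longleftrightarrow> supp k \<subseteq> F" unfolding int using RF by simp
      ultimately show ?thesis by blast
    qed
    moreover have "xmon R * p \<in> polys n" using p polys_mult xmon_polys[OF Rn] by blast
    ultimately show ?thesis using p by (auto simp: face_ideal_iff) (auto simp: sqf_ideal_def tm sp)
  qed
  show "face_ideal n F \<subseteq> polys n" by (rule sqf_ideal_polys)
  show "sqf_ideal n D' \<subseteq> sqf_ideal n D" using sub by (rule sqf_ideal_mono)
  show "submod (polys n) (polys n :: (monomial \<Rightarrow>\<^sub>0 'k) set)" by (rule submod_polys)
  show "submod (polys n) (sqf_ideal n D :: (monomial \<Rightarrow>\<^sub>0 'k) set)"
    and "submod (polys n) (sqf_ideal n D' :: (monomial \<Rightarrow>\<^sub>0 'k) set)"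
    using D D' by (simp_all only: submod_sqf_ideal)
  show "set xs \<subseteq> polys n" "wregular (polys n) (face_ideal n F) xs" by (fact xs reg)+
  show "xmon R * (a - a') = xmon R * a - xmon R * a'" for a a' :: "monomial \<Rightarrow>\<^sub>0 'k"
    by (rule right_diff_distrib)
  show "xmon R * (s * a) = s * (xmon R * a)" for s a :: "monomial \<Rightarrow>\<^sub>0 'k"
    by (rule mult.left_commute)
qed

section \<open>Elementary symmetric polynomials and the lexicographic shelling\<close>

definition esym :: "nat \<Rightarrow> nat \<Rightarrow> (monomial \<Rightarrow>\<^sub>0 'k::field)" where
  "esym n j = (\<Sum>F\<in>{F. F \<subseteq> {1..n} \<and> card F = j}. xmon F)"

lemma finite_card_subsets: "finite {F. F \<subseteq> {1..n::nat} \<and> card F = j}"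
  by (rule finite_subset[of _ "Pow {1..n}"]) auto

lemma terms_esym:
  assumes "m \<in> terms (esym n j)"
  obtains F where "F \<subseteq> {1..n}" "card F = j" "m = sqm F"
  using Poly_Mapping.keys_sum[of xmon "{F. F \<subseteq> {1..n} \<and> card F = j}"] assms
  unfolding esym_def by auto

lemma esym_polys: "esym n j \<in> polys n"
  unfolding esym_def by (rule submod_sum[OF submod_polys]) (simp add: xmon_polys)

text \<open>Every other squarefree monomial of the same degree involves a variable outside \<open>F\<close>.\<close>
lemma esym_mod_face:
  assumes F: "F \<subseteq> {1..n}"
  shows "esym n (card F) - xmon F \<in> face_ideal n F"
proof -
  let ?J = "{G. G \<subseteq> {1..n} \<and> card G = card F}"
  have "esym n (card F) - xmon F = (\<Sum>G\<in>?J - {F}. xmon G)"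
    unfolding esym_def using finite_card_subsets F by (subst sum.remove[of ?J F]) auto
  also have "\<dots> \<in> face_ideal n F"
  proof (rule submod_sum[OF submod_sqf_ideal[OF upset_nonfaces]])
    fix G assume G: "G \<in> ?J - {F}"
    have "finite F" using F finite_subset by blast
    then have "\<not> G \<subseteq> F" using G card_subset_eq[of F G] by auto
    then have "G \<in> nonfaces n F" "G \<subseteq> {1..n}" using G by (auto simp: nonfaces_def)
    then show "xmon G \<in> face_ideal n F" using xmon_sqf_ideal[of G n "nonfaces n F"] by blast
  qed
  finally show ?thesis .
qed

lemma esym_notin_face_ideal:
  assumes F: "F \<subseteq> {1..n}"
  shows "(esym n (card F) :: monomial \<Rightarrow>\<^sub>0 'k::field) \<notin> face_ideal n F"
proof
  assume *: "(esym n (card F) :: monomial \<Rightarrow>\<^sub>0 'k) \<in> face_ideal n F"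
  have "(xmon F :: monomial \<Rightarrow>\<^sub>0 'k) \<in> face_ideal n F"
    using submod_diff[OF submod_sqf_ideal[OF upset_nonfaces] * esym_mod_face[OF F]] by simp
  then have "F \<in> nonfaces n F" by (simp only: xmon_sqf_ideal[OF F])
  then show False by (simp add: nonfaces_def)
qed

text \<open>The polynomials \<open>e\<^sub>d, \<dots>, e\<^sub>1\<close> in this order: dividing by the product of the variables first makes
  the induction on the number of variables possible.\<close>
primrec theta :: "nat \<Rightarrow> nat \<Rightarrow> (monomial \<Rightarrow>\<^sub>0 'k::field) list" where
  "theta n 0 = []"
| "theta n (Suc d) = esym n (Suc d) # theta n d"

lemma length_theta [simp]: "length (theta n d) = d"
  by (induction d) auto

lemma set_theta: "set (theta n d) = esym n ` {1..d}"
  by (induction d) (auto simp: atLeastAtMostSuc_conv)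

lemma theta_polys: "set (theta n d) \<subseteq> polys n"
  using esym_polys by (auto simp: set_theta)

text \<open>The polynomial \<open>e\<^sub>d\<close> may be replaced by the monomial of \<open>F\<close>, so that the quotient of
  \<open>k[x\<^sub>j | j \<in> F]\<close> by \<open>e\<^sub>d\<close> is the Stanley--Reisner ring of the boundary of the simplex \<open>F\<close>.\<close>
lemma mul_add_esym_face_ideal:
  assumes F: "F \<subseteq> {1..n}"
  shows "mul_add (esym n (card F)) (polys n) (face_ideal n F :: (monomial \<Rightarrow>\<^sub>0 'k::field) set) =
    sqf_ideal n {H. H \<subseteq> {1..n} \<and> (H \<subseteq> F \<longrightarrow> F \<subseteq> H)}"
    (is "?L = sqf_ideal n ?D")
proof
  let ?e = "esym n (card F) :: monomial \<Rightarrow>\<^sub>0 'k"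
  let ?P = "face_ideal n F :: (monomial \<Rightarrow>\<^sub>0 'k) set"
  have fF: "finite F" using F finite_subset by blast
  have D: "upset n ?D" by (auto simp: upset_def)
  have PD: "?P \<subseteq> sqf_ideal n ?D" by (rule sqf_ideal_mono) (auto simp: nonfaces_def)
  note smD = submod_sqf_ideal[OF D] and smP = submod_sqf_ideal[OF upset_nonfaces]
  have xD: "(xmon F :: monomial \<Rightarrow>\<^sub>0 'k) \<in> sqf_ideal n ?D" using F by (simp add: xmon_sqf_ideal)
  have eP: "?e - xmon F \<in> ?P" by (rule esym_mod_face[OF F])
  have eD: "?e \<in> sqf_ideal n ?D"
    using submod_add[OF smD _ xD, of "?e - xmon F"] eP PD by auto
  show "?L \<subseteq> sqf_ideal n ?D"
  proof
    fix y assume "y \<in> ?L"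
    then obtain a b where ab: "a \<in> polys n" "b \<in> ?P" "y = ?e * a + b" by (metis mul_addE)
    have "a * ?e \<in> sqf_ideal n ?D" by (rule submod_smult[OF smD ab(1) eD])
    then show "y \<in> sqf_ideal n ?D"
      using submod_add[OF smD, of "a * ?e" b] ab PD by (auto simp: mult.commute)
  qed
  show "sqf_ideal n ?D \<subseteq> ?L"
  proof
    fix y :: "monomial \<Rightarrow>\<^sub>0 'k" assume y: "y \<in> sqf_ideal n ?D"
    let ?Q = "\<lambda>m. \<not> supp m \<subseteq> F"
    have yn: "y \<in> polys n" using y sqf_ideal_polys by blast
    have "F \<subseteq> supp m" if "m \<in> terms (restrict_terms (\<lambda>m. \<not> ?Q m) y)" for m
      using that y by (auto simp: sqf_ideal_def)
    then obtain a where a: "a \<in> polys n" "restrict_terms (\<lambda>m. \<not> ?Q m) y = xmon F * a"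
      using xmon_divides[OF restrict_terms_polys[OF yn] fF] by metis
    have r: "restrict_terms ?Q y \<in> ?P"
      using yn by (auto simp: face_ideal_iff restrict_terms_polys)
    have "y = restrict_terms ?Q y + xmon F * a"
      using restrict_terms_split[of y ?Q] a by simp
    then have "y = ?e * a + (restrict_terms ?Q y - a * (?e - xmon F))"
      by (simp add: algebra_simps)
    moreover have "restrict_terms ?Q y - a * (?e - xmon F) \<in> ?P"
      by (intro submod_diff[OF smP] submod_smult[OF smP] r a eP)
    ultimately show "y \<in> ?L" using mul_addI[OF a(1)] by metis
  qed
qed

text \<open>The boundary of the simplex \<open>F\<close> is built up by enlarging a set \<open>G \<subseteq> F\<close>: the proper subsets of \<open>F\<close>
  that contain \<open>G\<close> but not \<open>g\<close> form the interval \<open>[G, F - {g}]\<close>, whose top has size \<open>d - 1\<close>, so the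
  induction hypothesis applies to each step.\<close>
lemma wregular_theta_face:
  assumes "F \<subseteq> {1..n}" "card F = d"
  shows "wregular (polys n) (face_ideal n F :: (monomial \<Rightarrow>\<^sub>0 'k::field) set) (theta n d)"
  using assms
proof (induction d arbitrary: F)
  case (Suc d)
  let ?e = "esym n (Suc d) :: monomial \<Rightarrow>\<^sub>0 'k"
  let ?D = "\<lambda>G. {H. H \<subseteq> {1..n} \<and> (H \<subseteq> F \<longrightarrow> G \<subseteq> H)}"
  have F: "F \<subseteq> {1..n}" "finite F" using Suc.prems finite_subset by auto
  have up: "upset n (?D G)" if "G \<subseteq> F" for G by (auto simp: upset_def)
  have "wregular (polys n) (sqf_ideal n (?D G) :: (monomial \<Rightarrow>\<^sub>0 'k) set) (theta n d)"
    if "G \<subseteq> F" for G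
    using finite_subset[OF that F(2)] that
  proof (induction G)
    case empty
    have "?D {} = Pow {1..n}" by auto
    then show ?case using wregular_refl[OF submod_polys theta_polys] by (simp add: sqf_ideal_Pow)
  next
    case (insert g G)
    then have gG: "insert g G \<subseteq> F" "G \<subseteq> F" "g \<in> F" "g \<notin> G" by auto
    have "wregular (sqf_ideal n (?D G)) (sqf_ideal n (?D (insert g G)) :: (monomial \<Rightarrow>\<^sub>0 'k) set) (theta n d)"
    proof (rule wregular_interval[where R = G and F = "F - {g}"])
      show "?D G - ?D (insert g G) = {H. G \<subseteq> H \<and> H \<subseteq> F - {g}}"
        using gG F by blast
      show "wregular (polys n) (face_ideal n (F - {g}) :: (monomial \<Rightarrow>\<^sub>0 'k) set) (theta n d)"
        by (rule Suc.IH) (use gG F Suc.prems in auto)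
      show "upset n (?D G)" "upset n (?D (insert g G))" by (rule up[OF gG(2)], rule up[OF gG(1)])
      show "set (theta n d) \<subseteq> polys n" by (rule theta_polys)
    qed (use gG F in auto)
    moreover have "wregular (polys n) (sqf_ideal n (?D G) :: (monomial \<Rightarrow>\<^sub>0 'k) set) (theta n d)"
      by (rule insert.IH[OF gG(2)])
    ultimately show ?case
      using wregular_extension[OF submod_polys submod_sqf_ideal[OF up[OF gG(2)]]
          submod_sqf_ideal[OF up[OF gG(1)]] sqf_ideal_mono sqf_ideal_polys theta_polys]
      by auto
  qed
  from this[OF subset_refl]
  have "wregular (polys n) (mul_add ?e (polys n) (face_ideal n F)) (theta n d)"
    using mul_add_esym_face_ideal[OF F(1), where 'k = 'k] Suc.prems by simp
  moreover have "a \<in> face_ideal n F" if "a \<in> polys n" "?e * a \<in> face_ideal n F" for a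
    using face_ideal_prime[OF esym_polys that] esym_notin_face_ideal[OF F(1), where 'k = 'k] Suc.prems by auto
  ultimately show ?case by auto
qed simp

text \<open>Among the sets of given size that contain \<open>F - {1..c}\<close>, the lexicographically greatest one uses the
  smallest possible further elements, and these are \<open>1, \<dots>, c\<close>.\<close>
lemma sqm_le_of_run:
  assumes F: "F \<subseteq> {1..n}" and Z: "Z \<subseteq> {1..n}" "card Z = card F"
    and c: "{1..c} \<subseteq> F" and sub: "F - {1..c} \<subseteq> Z"
  shows "sqm Z \<le> sqm F"
proof (cases "{1..c} \<subseteq> Z")
  case True
  then have "F \<subseteq> Z" using sub by blast
  then have "F = Z" using Z card_subset_eq[of Z F] finite_subset[OF Z(1)] by auto
  then show ?thesis by simp
next
  case False
  have fin: "finite F" "finite Z" using F Z finite_subset by auto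
  define j where "j = (LEAST j. j \<in> {1..c} \<and> j \<notin> Z)"
  have "\<exists>j. j \<in> {1..c} \<and> j \<notin> Z" using False by blast
  from LeastI_ex[OF this] have j: "j \<in> {1..c}" "j \<notin> Z" unfolding j_def by blast+
  have below: "j' \<in> Z \<longleftrightarrow> j' \<in> F" if "j' < j" for j'
  proof (cases "j' = 0")
    case True
    then show ?thesis using F Z by auto
  next
    case False
    then have "j' \<in> {1..c}" using that j by auto
    moreover from this have "j' \<in> Z" using not_less_Least[of j'] that unfolding j_def by blast
    ultimately show ?thesis using c by blast
  qed
  have "sqm Z < sqm F"
    unfolding sqm_less_iff[OF fin(2,1)] using j below c by blast
  then show ?thesis by simp
qed

lemma exists_run:
  assumes "finite F"
  obtains c :: nat where "{1..c} \<subseteq> F" "Suc c \<notin> F"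
proof -
  obtain b where b: "\<forall>x\<in>F. x \<le> b" using assms finite_nat_set_iff_bounded_le by blast
  then have ex: "\<exists>c. Suc c \<notin> F" by (metis not_less_eq_eq order_refl)
  define c where "c = (LEAST c. Suc c \<notin> F)"
  have "{1..c} \<subseteq> F"
  proof
    fix x assume "x \<in> {1..c}"
    then obtain y where "x = Suc y" "y < c" by (cases x) auto
    then show "x \<in> F" using not_less_Least[of y] unfolding c_def by blast
  qed
  moreover have "Suc c \<notin> F" using LeastI_ex[OF ex] by (simp add: c_def)
  ultimately show ?thesis using that by blast
qed

text \<open>Trading an element beyond the initial run for the first gap \<open>Suc c\<close> gives a lexicographically
  greater set.\<close>
lemma exchange_run:
  assumes F: "F \<subseteq> {1..n}" and c: "{1..c} \<subseteq> F" "Suc c \<notin> F"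
    and t: "t \<in> F" "t \<notin> {1..c}"
  defines "Z \<equiv> insert (Suc c) (F - {t})"
  shows "Z \<subseteq> {1..n}" "card Z = card F" "sqm F < sqm Z"
proof -
  have fin: "finite F" using F finite_subset by auto
  have tc: "Suc c < t"
    using t F c(2) by (cases "t = Suc c") auto
  show "Z \<subseteq> {1..n}" using F t tc unfolding Z_def by auto
  show "card Z = card F"
    using c t fin card_Suc_Diff1[OF fin t(1)] unfolding Z_def by simp
  have "finite Z" using fin unfolding Z_def by simp
  then show "sqm F < sqm Z"
    unfolding sqm_less_iff[OF fin \<open>finite Z\<close>]
    by (intro exI[of _ "Suc c"]) (use c tc in \<open>auto simp: Z_def\<close>)
qed

text \<open>Adding the sets \<open>F \<in> W\<close> to the complex in lexicographically decreasing order is a shelling. Let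
  \<open>{1..c}\<close> be the initial run of \<open>F\<close>. A face of \<open>F\<close> that omits an element beyond the run lies in an
  earlier facet by \<open>exchange_run\<close>, and a face that contains \<open>F - {1..c}\<close> lies in no earlier facet by
  \<open>sqm_le_of_run\<close>. The new faces are therefore the interval \<open>[F - {1..c}, F]\<close>. The facets are
  added to the complex whose set of nonfaces is \<open>E\<close>; the last hypothesis ensures that a facet in
  \<open>E\<close> contributes its whole interval.\<close>
lemma wregular_lex_shelling:
  assumes E: "upset n E"
    and fin: "finite W" and W: "\<And>F. F \<in> W \<Longrightarrow> F \<subseteq> {1..n} \<and> card F = d"
    and init: "\<And>F Z. F \<in> W \<Longrightarrow> Z \<subseteq> {1..n} \<Longrightarrow> card Z = d \<Longrightarrow> sqm F < sqm Z \<Longrightarrow> Z \<in> W"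
    and restr: "\<And>F c. F \<in> W \<Longrightarrow> F \<in> E \<Longrightarrow> {1..c} \<subseteq> F \<Longrightarrow> Suc c \<notin> F \<Longrightarrow> F - {1..c} \<in> E"
  shows "wregular (sqf_ideal n E)
    (sqf_ideal n {H \<in> E. \<forall>F\<in>W. \<not> H \<subseteq> F} :: (monomial \<Rightarrow>\<^sub>0 'k::field) set) (theta n d)"
  using fin W init restr
proof (induction "card W" arbitrary: W)
  case 0
  then have "{H \<in> E. \<forall>F\<in>W. \<not> H \<subseteq> F} = E" by auto
  then show ?case using wregular_refl[OF submod_sqf_ideal[OF E] theta_polys] by simp
next
  case (Suc k)
  note W = Suc.prems(2)
  let ?D = "\<lambda>W. {H \<in> E. \<forall>F\<in>W. \<not> H \<subseteq> F}"
  have up: "upset n (?D W)" for W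
    unfolding upset_def
  proof (intro conjI ballI allI impI)
    fix H H' assume "H \<in> ?D W" "H' \<subseteq> {1..n}" "H \<subseteq> H'"
    then have "H' \<in> E" "\<forall>F\<in>W. \<not> H' \<subseteq> F" using upsetD[OF E, of H H'] by blast+
    then show "H' \<in> ?D W" by simp
  qed (use upset_subset[OF E] in auto)
  have "W \<noteq> {}" using Suc.hyps(2) by auto
  then obtain F where F: "F \<in> W" and Fmin: "\<And>Z. Z \<in> W \<Longrightarrow> sqm F \<le> sqm Z"
    (* the lexicographically smallest facet is the last one of the shelling *)
    using arg_min_if_finite[OF Suc.prems(1), of sqm] by (metis not_le)
  have Fn: "F \<subseteq> {1..n}" "card F = d" "finite F" using W[OF F] finite_subset by auto
  let ?W = "W - {F}"
  have IH: "wregular (sqf_ideal n E) (sqf_ideal n (?D ?W) :: (monomial \<Rightarrow>\<^sub>0 'k) set) (theta n d)"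
  proof (rule Suc.hyps(1))
    show "k = card ?W" using Suc.hyps(2) F Suc.prems(1) by simp
    show "Z \<in> ?W" if "G \<in> ?W" "Z \<subseteq> {1..n}" "card Z = d" "sqm G < sqm Z" for G Z
      using Suc.prems(3)[of G Z] that Fmin[of G] by auto
  qed (use Suc.prems in auto)
  have sub: "?D W \<subseteq> ?D ?W" by auto
  have "wregular (sqf_ideal n (?D ?W)) (sqf_ideal n (?D W) :: (monomial \<Rightarrow>\<^sub>0 'k) set) (theta n d)"
  proof (cases "F \<in> E")
    case False
    have "\<not> H \<subseteq> F" if "H \<in> E" for H using upsetD[OF E that] Fn False by blast
    then have "?D ?W = ?D W" by auto
    then show ?thesis using wregular_refl[OF submod_sqf_ideal[OF up[of W]] theta_polys] by simp
  next
    case True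
    obtain c where c: "{1..c} \<subseteq> F" "Suc c \<notin> F" using exists_run[OF Fn(3)] .
    show ?thesis
    proof (rule wregular_interval[where R = "F - {1..c}" and F = F])
      show "?D ?W - ?D W = {H. F - {1..c} \<subseteq> H \<and> H \<subseteq> F}"
      proof (intro equalityI subsetI)
        fix H assume H: "H \<in> ?D ?W - ?D W"
        then have HF: "H \<subseteq> F" by auto
        have "t \<in> H" if t: "t \<in> F - {1..c}" for t
        proof (rule ccontr)
          assume tH: "t \<notin> H"
          let ?Z = "insert (Suc c) (F - {t})"
          note Z = exchange_run[OF Fn(1) c, of t]
          have "?Z \<in> W" using Suc.prems(3)[OF F, of ?Z] Z t Fn by auto
          moreover have "?Z \<noteq> F" using c by auto
          moreover have "H \<subseteq> ?Z" using HF tH by auto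
          ultimately show False using H by blast
        qed
        then show "H \<in> {H. F - {1..c} \<subseteq> H \<and> H \<subseteq> F}" using HF by auto
      next
        fix H assume H: "H \<in> {H. F - {1..c} \<subseteq> H \<and> H \<subseteq> F}"
        have "F - {1..c} \<in> E" by (rule Suc.prems(4)[OF F True c])
        then have "H \<in> E" using upsetD[OF E] H Fn by blast
        moreover have "\<not> H \<subseteq> Z" if Z: "Z \<in> ?W" for Z
        proof
          assume "H \<subseteq> Z"
          then have "sqm Z \<le> sqm F" using sqm_le_of_run[OF Fn(1) _ _ c(1)] W[of Z] Z Fn H by auto
          then have "sqm Z = sqm F" using Fmin[of Z] Z by auto
          then have "supp (sqm Z) = supp (sqm F)" by simp
          then have "Z = F" using supp_sqm Fn W[of Z] Z finite_subset[of Z "{1..n}"] by auto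
          then show False using Z by simp
        qed
        ultimately show "H \<in> ?D ?W - ?D W" using F H by auto
      qed
      show "wregular (polys n) (face_ideal n F :: (monomial \<Rightarrow>\<^sub>0 'k) set) (theta n d)"
        by (rule wregular_theta_face[OF Fn(1,2)])
      show "set (theta n d) \<subseteq> polys n" by (rule theta_polys)
    qed (use up Fn in auto)
  qed
  then show ?case
    using wregular_extension[OF submod_sqf_ideal[OF E] submod_sqf_ideal[OF up[of ?W]]
        submod_sqf_ideal[OF up[of W]] sqf_ideal_mono[OF sub] sqf_ideal_mono theta_polys IH]
    by auto
qed

section \<open>A growth bound for regular sequences and chains of primes\<close>

text \<open>Gaussian elimination: one equation is used to eliminate one unknown \<open>j0\<close>.\<close>
lemma underdetermined_system:
  fixes M :: "'j \<Rightarrow> 'i \<Rightarrow> 'f::field"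
  assumes "finite K" "finite J" "card K < card J"
  shows "\<exists>c. (\<exists>j\<in>J. c j \<noteq> 0) \<and> (\<forall>k\<in>K. (\<Sum>j\<in>J. c j * M j k) = 0)"
  using assms
proof (induction K arbitrary: J M)
  case empty
  then have "J \<noteq> {}" by auto
  then show ?case by (intro exI[of _ "\<lambda>_. 1"]) auto
next
  case (insert k K)
  show ?case
  proof (cases "\<forall>j\<in>J. M j k = 0")
    case True
    obtain c where "\<exists>j\<in>J. c j \<noteq> 0" "\<forall>k\<in>K. (\<Sum>j\<in>J. c j * M j k) = 0"
      using insert.IH[of J M] insert.prems insert.hyps by auto
    then show ?thesis using True by auto
  next
    case False
    then obtain j0 where j0: "j0 \<in> J" "M j0 k \<noteq> 0" by blast
    let ?J = "J - {j0}"
    define M' where "M' = (\<lambda>j i. M j i - M j k / M j0 k * M j0 i)"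
    have "card K < card ?J" using insert.prems insert.hyps j0 by simp
    then obtain c where c: "\<exists>j\<in>?J. c j \<noteq> 0" "\<forall>i\<in>K. (\<Sum>j\<in>?J. c j * M' j i) = 0"
      using insert.IH[of ?J M'] insert.prems by auto
    define s where "s = (\<Sum>j\<in>?J. c j * (M j k / M j0 k))"
    define c' where "c' = c(j0 := - s)"
    have split: "(\<Sum>j\<in>J. c' j * M j i) = (\<Sum>j\<in>?J. c j * M' j i)" for i
    proof -
      have "(\<Sum>j\<in>J. c' j * M j i) = - s * M j0 i + (\<Sum>j\<in>?J. c j * M j i)"
        using insert.prems(1) j0 by (simp add: sum.remove[of J j0] c'_def)
      also have "s * M j0 i = (\<Sum>j\<in>?J. c j * (M j k / M j0 k * M j0 i))"
        by (simp add: s_def sum_distrib_right mult.assoc)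
      then have "- s * M j0 i + (\<Sum>j\<in>?J. c j * M j i) = (\<Sum>j\<in>?J. c j * M' j i)"
        by (simp add: M'_def right_diff_distrib sum_subtractf)
      finally show ?thesis .
    qed
    have "M' j k = 0" for j using j0 by (simp add: M'_def)
    then have "(\<Sum>j\<in>J. c' j * M j i) = 0" if "i \<in> insert k K" for i
      using that c(2) unfolding split by auto
    moreover have "\<exists>j\<in>J. c' j \<noteq> 0" using c(1) by (auto simp: c'_def)
    ultimately show ?thesis by blast
  qed
qed

definition const :: "'k::field \<Rightarrow> (monomial \<Rightarrow>\<^sub>0 'k)" where
  "const c = Poly_Mapping.single 0 c"

lemma const_polys: "const c \<in> polys n"
  by (simp add: const_def polys_iff)

lemma const_0 [simp]: "const 0 = 0"
  by (simp add: const_def)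

lemma coeff_const_mult: "coeff (const c * p) m = c * coeff p m"
proof -
  have "const c * p = Poly_Mapping.map ((*) c) p"
    by (simp add: const_def Poly_Mapping.mult_map_scale_conv_mult)
  then show ?thesis by (simp add: Poly_Mapping.map.rep_eq when_def)
qed

lemma polys_power: "a \<in> polys n \<Longrightarrow> a ^ j \<in> polys n"
  by (induction j) (auto simp: one_polys intro: polys_mult)

text \<open>Comparing constant terms: modulo \<open>N'\<close> all summands except the first one vanish, so \<open>y 0\<close> is zero.
  The rest is divisible by \<open>a\<close>, and \<open>a\<close> can be cancelled modulo \<open>N\<close>.\<close>
lemma power_sum_independent:
  assumes A: "submod (polys n) A" and N: "submod (polys n) N" and N': "submod (polys n) N'"
    and sub: "N \<subseteq> N'" and a: "a \<in> polys n"
    and reg: "\<And>p. p \<in> A \<Longrightarrow> a * p \<in> N \<Longrightarrow> p \<in> N" and into: "\<And>p. p \<in> A \<Longrightarrow> a * p \<in> N'"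
    and y: "\<And>j. y j \<in> A" "\<And>j. y j \<in> N' \<Longrightarrow> y j = 0"
    and sum: "(\<Sum>j\<le>t. a ^ j * y j) \<in> N"
  shows "\<forall>j\<le>t. y j = 0"
  using y sum
proof (induction t arbitrary: y)
  case 0
  then show ?case using sub by auto
next
  case (Suc t)
  let ?s = "\<Sum>j\<le>t. a ^ j * y (Suc j)"
  have sA: "?s \<in> A" by (intro submod_sum[OF A] submod_smult[OF A] polys_power a Suc.prems)
  have eq: "(\<Sum>j\<le>Suc t. a ^ j * y j) = y 0 + a * ?s"
    by (simp add: sum.atMost_Suc_shift sum_distrib_left mult.assoc del: sum.atMost_Suc)
  then have "y 0 + a * ?s \<in> N'" using Suc.prems(3) sub by auto
  then have y0: "y 0 = 0"
    using submod_add_cancel[OF N' into[OF sA]] Suc.prems(2) by blast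
  then have "a * ?s \<in> N" using Suc.prems(3) eq by simp
  then have "?s \<in> N" by (rule reg[OF sA])
  then have "\<forall>j\<le>t. y (Suc j) = 0" using Suc.IH[of "\<lambda>j. y (Suc j)"] Suc.prems by blast
  then show ?case using y0 by (metis Suc_le_mono not0_implies_Suc)
qed

definition exponent_lists :: "nat \<Rightarrow> nat \<Rightarrow> nat list set" where
  "exponent_lists l t = {js. set js \<subseteq> {..t} \<and> length js = l}"

lemma exponent_lists_Suc:
  "exponent_lists (Suc l) t = (\<lambda>(j, js). j # js) ` ({..t} \<times> exponent_lists l t)"
proof (intro equalityI subsetI)
  fix x assume "x \<in> exponent_lists (Suc l) t"
  then obtain j js where "x = j # js" "j \<le> t" "js \<in> exponent_lists l t"
    by (cases x) (auto simp: exponent_lists_def)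
  then show "x \<in> (\<lambda>(j, js). j # js) ` ({..t} \<times> exponent_lists l t)" by auto
qed (auto simp: exponent_lists_def)

lemma card_exponent_lists: "card (exponent_lists l t) = (t + 1) ^ l"
  and finite_exponent_lists: "finite (exponent_lists l t)"
  unfolding exponent_lists_def
  by (simp_all add: card_lists_length_eq finite_lists_length_eq Suc_eq_plus1)

text \<open>The product \<open>a\<^sub>0\<^bsup>j\<^sub>0\<^esup> a\<^sub>1\<^bsup>j\<^sub>1\<^esup> \<cdots> v\<close>.\<close>
primrec power_word :: "(nat \<Rightarrow> 'a::comm_ring_1) \<Rightarrow> 'a \<Rightarrow> nat list \<Rightarrow> 'a" where
  "power_word a v [] = v"
| "power_word a v (j # js) = a 0 ^ j * power_word (\<lambda>i. a (Suc i)) v js"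

text \<open>The common features of a regular sequence \<open>a\<close> on \<open>A/N 0\<close>, where \<open>N i\<close> is generated by \<open>N 0\<close> and the
  multiples of the first \<open>i\<close> elements, and of a chain of prime ideals \<open>N i\<close> of the ring \<open>A\<close> with
  \<open>a i \<in> N (Suc i) - N i\<close>.\<close>
definition regular_tower ::
    "nat \<Rightarrow> (monomial \<Rightarrow>\<^sub>0 'k::field) set \<Rightarrow> (nat \<Rightarrow> (monomial \<Rightarrow>\<^sub>0 'k) set) \<Rightarrow>
      (nat \<Rightarrow> monomial \<Rightarrow>\<^sub>0 'k) \<Rightarrow> nat \<Rightarrow> bool" where
  "regular_tower n A N a l \<longleftrightarrow> (\<forall>i\<le>l. submod (polys n) (N i)) \<and>
    (\<forall>i<l. a i \<in> polys n \<and> N i \<subseteq> N (Suc i) \<and>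
      (\<forall>p\<in>A. a i * p \<in> N (Suc i) \<and> (a i * p \<in> N i \<longrightarrow> p \<in> N i)))"

lemma regular_tower_shift:
  "regular_tower n A N a (Suc l) \<Longrightarrow> regular_tower n A (\<lambda>i. N (Suc i)) (\<lambda>i. a (Suc i)) l"
  unfolding regular_tower_def by auto

lemma power_word_mem:
  assumes "submod (polys n) A" "regular_tower n A N a l" "v \<in> A" "js \<in> exponent_lists l t"
  shows "power_word a v js \<in> A"
  using assms(2,4)
proof (induction l arbitrary: N a js)
  case 0
  then show ?case using assms(3) by (simp add: exponent_lists_def)
next
  case (Suc l)
  then obtain j ks where "js = j # ks" "ks \<in> exponent_lists l t"
    by (auto simp: exponent_lists_Suc)
  moreover have "a 0 \<in> polys n" using Suc.prems by (auto simp: regular_tower_def)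
  ultimately show ?case
    using submod_smult[OF assms(1) polys_power[of "a 0" n j] Suc.IH[OF regular_tower_shift[OF Suc.prems(1)], of ks]]
    by simp
qed

text \<open>By induction on \<open>l\<close>: sorting a linear combination by the exponent of \<open>a 0\<close> gives a sum as in
  \<open>power_sum_independent\<close>, whose coefficients \<open>y j\<close> are linear combinations for the shifted tower.\<close>
lemma regular_tower_independent:
  fixes v :: "monomial \<Rightarrow>\<^sub>0 'k::field"
  assumes A: "submod (polys n) A" and tower: "regular_tower n A N a l"
    and v: "v \<in> A" "v \<notin> N l"
    and sum: "(\<Sum>js\<in>exponent_lists l t. const (c js) * power_word a v js) \<in> N 0"
  shows "\<forall>js\<in>exponent_lists l t. c js = 0"
  using tower v(2) sum
proof (induction l arbitrary: N a c)
  case 0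
  have N0: "submod (polys n) (N 0)" using 0 by (auto simp: regular_tower_def)
  have e: "exponent_lists 0 t = {[]}" by (auto simp: exponent_lists_def)
  have cv: "const (c []) * v \<in> N 0" using 0 by (simp add: e)
  have "c [] = 0"
  proof (rule ccontr)
    assume "c [] \<noteq> 0"
    then have "const (inverse (c [])) * (const (c []) * v) = v"
      by (intro Poly_Mapping.poly_mapping_eqI) (simp add: coeff_const_mult)
    then show False using submod_smult[OF N0 const_polys cv] 0 by metis
  qed
  then show ?case by (simp add: e)
next
  case (Suc l)
  let ?a = "\<lambda>i. a (Suc i)" and ?J = "exponent_lists l t"
  define y where "y = (\<lambda>j. if j \<le> t then \<Sum>js\<in>?J. const (c (j # js)) * power_word ?a v js else 0)"
  note tower' = regular_tower_shift[OF Suc.prems(1)]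
  have T: "submod (polys n) (N 0)" "submod (polys n) (N (Suc 0))" "a 0 \<in> polys n"
      "N 0 \<subseteq> N (Suc 0)" "\<And>p. p \<in> A \<Longrightarrow> a 0 * p \<in> N 0 \<Longrightarrow> p \<in> N 0"
      "\<And>p. p \<in> A \<Longrightarrow> a 0 * p \<in> N (Suc 0)"
    using Suc.prems(1) by (auto simp: regular_tower_def)
  have IH: "\<forall>js\<in>?J. c (j # js) = 0" if "y j \<in> N (Suc 0)" "j \<le> t" for j
    using Suc.IH[OF tower' Suc.prems(2), of "\<lambda>js. c (j # js)"] that by (simp add: y_def)
  have "(\<Sum>js\<in>exponent_lists (Suc l) t. const (c js) * power_word a v js) =
      (\<Sum>(j, js)\<in>{..t} \<times> ?J. const (c (j # js)) * (a 0 ^ j * power_word ?a v js))"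
    unfolding exponent_lists_Suc by (subst sum.reindex) (auto simp: inj_on_def intro!: sum.cong)
  also have "\<dots> = (\<Sum>j\<le>t. \<Sum>js\<in>?J. const (c (j # js)) * (a 0 ^ j * power_word ?a v js))"
    by (rule sum.cartesian_product[symmetric])
  also have "\<dots> = (\<Sum>j\<le>t. a 0 ^ j * y j)"
    by (rule sum.cong) (auto simp: y_def sum_distrib_left mult.left_commute)
  finally have "(\<Sum>j\<le>t. a 0 ^ j * y j) \<in> N 0" using Suc.prems(3) by simp
  moreover have "y j \<in> A" for j
    unfolding y_def using power_word_mem[OF A tower' v(1)]
    by (auto intro!: submod_sum[OF A] submod_smult[OF A] const_polys submod_zero[OF A])
  moreover have "y j = 0" if "y j \<in> N (Suc 0)" for j
    using IH[OF that] by (auto simp: y_def)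
  ultimately have "\<forall>j\<le>t. y j = 0"
    using power_sum_independent[OF A T(1,2,4,3,5,6)] by blast
  then have "\<forall>js\<in>?J. c (j # js) = 0" if "j \<le> t" for j
    using IH[OF _ that] submod_zero[OF T(2)] that by simp
  then show ?case by (auto simp: exponent_lists_Suc)
qed

definition exponents_le :: "nat \<Rightarrow> (monomial \<Rightarrow>\<^sub>0 'k::field) \<Rightarrow> bool" where
  "exponents_le E p \<longleftrightarrow> (\<forall>m\<in>terms p. \<forall>x. Poly_Mapping.lookup m x \<le> E)"

text \<open>A polynomial has finitely many terms, and each of them has finite support.\<close>
lemma exponents_le_exists: "\<exists>E. exponents_le E p"
proof -
  have "\<exists>E. \<forall>x. Poly_Mapping.lookup m x \<le> E" for m :: monomial
  proof -
    have "Poly_Mapping.lookup m x \<le> (\<Sum>x\<in>supp m. Poly_Mapping.lookup m x)" for x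
      by (cases "x \<in> supp m") (auto simp: Poly_Mapping.in_keys_iff intro!: member_le_sum)
    then show ?thesis by blast
  qed
  then obtain E where E: "\<And>(m :: monomial) x. Poly_Mapping.lookup m x \<le> E m"
    using choice[of "\<lambda>m E. \<forall>x. Poly_Mapping.lookup (m :: monomial) x \<le> E"] by blast
  have "Poly_Mapping.lookup m x \<le> (\<Sum>m\<in>terms p. E m)" if "m \<in> terms p" for m x
    using E[of m x] member_le_sum[of m "terms p" E] that by simp
  then show ?thesis unfolding exponents_le_def by blast
qed

lemma exponents_le_mono: "exponents_le E p \<Longrightarrow> E \<le> E' \<Longrightarrow> exponents_le E' p"
  unfolding exponents_le_def using le_trans by blast

lemma exponents_le_mult:
  assumes "exponents_le E p" "exponents_le E' q"
  shows "exponents_le (E + E') (p * q)"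
  unfolding exponents_le_def
proof (intro ballI allI)
  fix m x assume m: "m \<in> terms (p * q)"
  obtain a b where "a \<in> terms p" "b \<in> terms q" "m = a + b" using terms_mult[OF m] .
  then show "Poly_Mapping.lookup m x \<le> E + E'"
    using assms by (simp add: exponents_le_def Poly_Mapping.lookup_add add_mono)
qed

lemma exponents_le_power: "exponents_le E p \<Longrightarrow> exponents_le (j * E) (p ^ j)"
proof (induction j)
  case 0
  then show ?case by (simp add: exponents_le_def)
qed (auto dest: exponents_le_mult)

lemma exponents_le_power_word:
  assumes "\<And>i. i < l \<Longrightarrow> exponents_le E (a i)" "exponents_le E v" "js \<in> exponent_lists l t"
  shows "exponents_le ((l * t + 1) * E) (power_word a v js)"
  using assms(1,3)
proof (induction l arbitrary: a js)
  case 0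
  then show ?case using assms(2) by (simp add: exponent_lists_def)
next
  case (Suc l)
  then obtain j ks where js: "js = j # ks" "j \<le> t" "ks \<in> exponent_lists l t"
    by (auto simp: exponent_lists_Suc)
  have "exponents_le (j * E + (l * t + 1) * E) (power_word a v js)"
    using exponents_le_mult[OF exponents_le_power[OF Suc.prems(1)[of 0]] Suc.IH[of "\<lambda>i. a (Suc i)" ks]]
      Suc.prems js by simp
  moreover have "j * E \<le> t * E" using js by simp
  ultimately show ?case by (elim exponents_le_mono) (simp add: algebra_simps)
qed

definition bounded_monomials :: "nat \<Rightarrow> nat \<Rightarrow> nat \<Rightarrow> monomial set" where
  "bounded_monomials n d E =
    {m. supp m \<subseteq> {1..n} \<and> card (supp m) \<le> d \<and> (\<forall>x. Poly_Mapping.lookup m x \<le> E)}"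

text \<open>There are at most \<open>2^n\<close> supports, and each of them leaves at most \<open>d\<close> exponents to choose.\<close>
lemma card_bounded_monomials:
  "finite (bounded_monomials n d E) \<and> card (bounded_monomials n d E) \<le> 2 ^ n * (E + 1) ^ d"
proof -
  let ?K = "\<lambda>F. {m \<in> bounded_monomials n d E. supp m = F}"
  have K: "finite (?K F) \<and> card (?K F) \<le> (E + 1) ^ d" if F: "F \<subseteq> {1..n}" for F
  proof (cases "card F \<le> d")
    case True
    have fF: "finite F" using F finite_subset by auto
    let ?f = "\<lambda>m::monomial. restrict (Poly_Mapping.lookup m) F"
    have inj: "inj_on ?f (?K F)"
    proof (rule inj_onI, rule Poly_Mapping.poly_mapping_eqI)
      fix m m' :: monomial and x assume m: "m \<in> ?K F" "m' \<in> ?K F" "?f m = ?f m'"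
      show "Poly_Mapping.lookup m x = Poly_Mapping.lookup m' x"
      proof (cases "x \<in> F")
        case True
        then show ?thesis using fun_cong[OF m(3), of x] by simp
      next
        case False
        then show ?thesis using m Poly_Mapping.in_keys_iff[of x m] Poly_Mapping.in_keys_iff[of x m'] by auto
      qed
    qed
    have im: "?f ` ?K F \<subseteq> F \<rightarrow>\<^sub>E {..E}" by (auto simp: bounded_monomials_def)
    have fin: "finite (F \<rightarrow>\<^sub>E {..E})" using fF by (simp add: finite_PiE)
    have "finite (?K F)" using finite_imageD[OF finite_subset[OF im fin] inj] .
    moreover have "card (?K F) \<le> card (F \<rightarrow>\<^sub>E {..E})" by (rule card_inj_on_le[OF inj im fin])
    moreover have "card (F \<rightarrow>\<^sub>E {..E}) = (E + 1) ^ card F" using fF by (simp add: card_PiE Suc_eq_plus1)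
    moreover have "(E + 1) ^ card F \<le> (E + 1) ^ d" using True by (intro power_increasing) auto
    ultimately show ?thesis by linarith
  next
    case False
    then have empty: "?K F = {}" by (auto simp: bounded_monomials_def)
    show ?thesis unfolding empty by simp
  qed
  have eq: "bounded_monomials n d E = (\<Union>F\<in>Pow {1..n}. ?K F)"
    by (auto simp: bounded_monomials_def)
  have "card (\<Union>F\<in>Pow {1..n}. ?K F) \<le> (\<Sum>F\<in>Pow {1..n}. card (?K F))" by (rule card_UN_le) simp
  also have "\<dots> \<le> (\<Sum>F\<in>Pow {1..n}. (E + 1) ^ d)" by (rule sum_mono) (use K in blast)
  also have "\<dots> = 2 ^ n * (E + 1) ^ d" by (simp add: card_Pow)
  finally have "card (bounded_monomials n d E) \<le> 2 ^ n * (E + 1) ^ d" using eq by simp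
  moreover have "finite (\<Union>F\<in>Pow {1..n}. ?K F)" using K by auto
  ultimately show ?thesis using eq by simp
qed

text \<open>The \<open>(t + 1)^l\<close> products with exponents at most \<open>t\<close> are linearly independent modulo \<open>N 0\<close>. Modulo
  \<open>N 0\<close> only terms whose support has size at most \<open>d\<close> matter, and their exponents are bounded
  linearly in \<open>t\<close>, so there are at most \<open>C (t + 1)^d\<close> of them. For large \<open>t\<close> this forces \<open>l \<le> d\<close>.\<close>
theorem regular_tower_length:
  fixes A :: "(monomial \<Rightarrow>\<^sub>0 'k::field) set"
  assumes A: "submod (polys n) A" "A \<subseteq> polys n" and tower: "regular_tower n A N a l"
    and v: "v \<in> A" "v \<notin> N l"
    and small: "\<And>p. p \<in> A \<Longrightarrow> restrict_terms (\<lambda>m. card (supp m) > d) p \<in> N 0"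
  shows "l \<le> d"
proof (rule ccontr)
  assume "\<not> l \<le> d"
  then have dl: "Suc d \<le> l" by simp
  have N0: "submod (polys n) (N 0)" using tower by (auto simp: regular_tower_def)
  obtain E1 where E1: "\<And>i. exponents_le (E1 i) (a i)" 
    using choice[of "\<lambda>i E. exponents_le E (a i)"] exponents_le_exists by blast
  obtain E2 where E2: "exponents_le E2 v" using exponents_le_exists by blast
  define E where "E = (\<Sum>i<l. E1 i) + E2"
  have Ea: "exponents_le E (a i)" if "i < l" for i
    using exponents_le_mono[OF E1[of i]] member_le_sum[of i "{..<l}" E1] that unfolding E_def by auto
  have Ev: "exponents_le E v" using exponents_le_mono[OF E2] unfolding E_def by auto
  have count: "(t + 1) ^ l \<le> 2 ^ n * ((l * t + 1) * E + 1) ^ d" for t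
  proof (rule ccontr)
    let ?B = "(l * t + 1) * E" and ?J = "exponent_lists l t" and ?w = "power_word a v"
    let ?K = "bounded_monomials n d ?B"
    let ?r = "restrict_terms (\<lambda>m. card (supp m) > d)"
    assume "\<not> (t + 1) ^ l \<le> 2 ^ n * (?B + 1) ^ d"
    then have "card ?K < card ?J"
      using card_bounded_monomials[of n d ?B] by (simp add: card_exponent_lists)
    then obtain c where c: "\<exists>js\<in>?J. c js \<noteq> 0"
        "\<forall>m\<in>?K. (\<Sum>js\<in>?J. c js * coeff (?w js) m) = 0"
      using underdetermined_system[of ?K ?J "\<lambda>js m. coeff (?w js) m"]
        card_bounded_monomials[of n d ?B] finite_exponent_lists by blast
    have wA: "?w js \<in> A" if "js \<in> ?J" for js using power_word_mem[OF A(1) tower v(1) that] .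
    have "(\<Sum>js\<in>?J. const (c js) * ?w js) = (\<Sum>js\<in>?J. const (c js) * ?r (?w js))"
    proof (rule Poly_Mapping.poly_mapping_eqI)
      fix m :: monomial
      have "(\<Sum>js\<in>?J. c js * coeff (?w js) m) =
          (\<Sum>js\<in>?J. c js * (if card (supp m) > d then coeff (?w js) m else 0))"
      proof (cases "card (supp m) > d \<or> m \<in> ?K")
        case True
        then show ?thesis using c(2) by (cases "card (supp m) > d") auto
      next
        case False
        have "coeff (?w js) m = 0" if js: "js \<in> ?J" for js
        proof (rule ccontr)
          assume "coeff (?w js) m \<noteq> 0"
          then have "m \<in> terms (?w js)" by (simp add: Poly_Mapping.in_keys_iff)
          then have "m \<in> ?K \<or> card (supp m) > d"
            using exponents_le_power_word[OF Ea Ev js] wA[OF js] A(2)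
            unfolding bounded_monomials_def exponents_le_def by (force simp: polys_iff)
          then show False using False by blast
        qed
        then show ?thesis by (intro sum.cong) auto
      qed
      then show "coeff (\<Sum>js\<in>?J. const (c js) * ?w js) m = coeff (\<Sum>js\<in>?J. const (c js) * ?r (?w js)) m"
        by (simp add: Poly_Mapping.lookup_sum coeff_const_mult coeff_restrict_terms)
    qed
    also have "\<dots> \<in> N 0"
      by (intro submod_sum[OF N0] submod_smult[OF N0] const_polys small wA)
    finally show False using regular_tower_independent[OF A(1) tower v] c(1) by blast
  qed
  (* chosen to exceed the constant in front of (t + 1) ^ d *)
  define t where "t = 2 ^ n * ((l + 1) * (E + 1)) ^ d"
  have "(t + 1) * (t + 1) ^ d \<le> (t + 1) ^ l"
    using power_increasing[OF dl, of "t + 1"] by simp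
  also have "\<dots> \<le> 2 ^ n * ((l * t + 1) * E + 1) ^ d" by (rule count)
  also have "\<dots> \<le> 2 ^ n * ((l + 1) * (E + 1) * (t + 1)) ^ d"
    by (intro mult_left_mono power_mono) (auto simp: algebra_simps)
  also have "\<dots> = t * (t + 1) ^ d" by (simp add: t_def power_mult_distrib)
  finally show False by simp
qed

section \<open>Quotient modules and their presentation by pairs of ideals\<close>

lemma poly_ring_simps [simp]:
  "x \<otimes>\<^bsub>poly_ring n\<^esub> y = x * y" "\<one>\<^bsub>poly_ring n\<^esub> = 1" "\<zero>\<^bsub>poly_ring n\<^esub> = 0"
  "x \<oplus>\<^bsub>poly_ring n\<^esub> y = x + y"
  by (simp_all add: poly_ring_def)

lemma abelian_group_poly_ring: "abelian_group (poly_ring n :: (monomial \<Rightarrow>\<^sub>0 'k::field) ring)"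
proof (rule abelian_groupI)
  fix x :: "monomial \<Rightarrow>\<^sub>0 'k" assume "x \<in> polys n"
  then show "\<exists>y\<in>polys n. y \<oplus>\<^bsub>poly_ring n\<^esub> x = \<zero>\<^bsub>poly_ring n\<^esub>"
    using submod_uminus[OF submod_polys] by (intro bexI[of _ "- x"]) auto
qed (auto simp: algebra_simps submod_zero[OF submod_polys] intro: submod_add[OF submod_polys])

lemma cring_poly_ring: "cring (poly_ring n :: (monomial \<Rightarrow>\<^sub>0 'k::field) ring)"
proof (rule cringI[OF abelian_group_poly_ring])
  show "comm_monoid (poly_ring n :: (monomial \<Rightarrow>\<^sub>0 'k) ring)"
    by (rule comm_monoidI) (auto simp: algebra_simps one_polys intro: polys_mult)
qed (auto simp: algebra_simps)

lemma submod_ideal: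
  fixes J :: "(monomial \<Rightarrow>\<^sub>0 'k::field) set"
  assumes "submod (polys n) J" "J \<subseteq> polys n"
  shows "ideal J (poly_ring n)"
proof (rule idealI)
  interpret cring "poly_ring n :: (monomial \<Rightarrow>\<^sub>0 'k) ring" by (rule cring_poly_ring)
  show "ring (poly_ring n :: (monomial \<Rightarrow>\<^sub>0 'k) ring)" by (rule ring_axioms)
  have minus: "\<ominus>\<^bsub>poly_ring n\<^esub> x = - x" if "x \<in> polys n" for x :: "monomial \<Rightarrow>\<^sub>0 'k"
    by (rule minus_equality) (use that submod_uminus[OF submod_polys] in auto)
  show "subgroup J (add_monoid (poly_ring n))"
  proof (rule add.subgroupI)
    show "J \<noteq> {}" using submod_zero[OF assms(1)] by blast
    fix x assume "x \<in> J"
    then show "\<ominus>\<^bsub>poly_ring n\<^esub> x \<in> J"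
      using minus[of x] submod_uminus[OF assms(1)] assms(2) by auto
  qed (use assms(2) submod_add[OF assms(1)] in auto)
  fix a x :: "monomial \<Rightarrow>\<^sub>0 'k" assume "a \<in> J" "x \<in> polys n"
  then have "x * a \<in> J" by (intro submod_smult[OF assms(1)])
  then show "x \<otimes>\<^bsub>poly_ring n\<^esub> a \<in> J" "a \<otimes>\<^bsub>poly_ring n\<^esub> x \<in> J"
    by (simp_all add: mult.commute)
qed

lemma ideal_submod:
  fixes J :: "(monomial \<Rightarrow>\<^sub>0 'k::field) set"
  assumes "ideal J (poly_ring n)"
  shows "submod (polys n) J" "J \<subseteq> polys n"
proof -
  interpret ideal J "poly_ring n :: (monomial \<Rightarrow>\<^sub>0 'k) ring" by (rule assms)
  have [simp]: "- 1 \<in> polys n" using submod_uminus[OF submod_polys one_polys] .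
  show "J \<subseteq> polys n" by (rule a_subset)
  have "- x \<in> J" if "x \<in> J" for x using I_l_closed[OF that, of "- 1"] by simp
  then have "x - y \<in> J" if "x \<in> J" "y \<in> J" for x y 
    using additive_subgroup.a_closed[OF is_additive_subgroup that(1), of "- y"] that by simp
  then show "submod (polys n) J"
    unfolding submod_def
    using additive_subgroup.zero_closed[OF is_additive_subgroup] I_l_closed by auto
qed

text \<open>The only point that is not immediate from the theory of cosets is scalar multiplication, which
  is defined as a union over representatives: all of them give the same coset.\<close>
lemma quot_module_simps:
  fixes R (structure) and M (structure)
  assumes "Module.module R M" "submodule N R M"
  defines "Q \<equiv> quot_module R M N"
  shows "carrier Q = (\<lambda>x. N +>\<^bsub>M\<^esub> x) ` carrier M"
    and "x \<in> carrier M \<Longrightarrow> y \<in> carrier M \<Longrightarrow> (N +>\<^bsub>M\<^esub> x) \<oplus>\<^bsub>Q\<^esub> (N +>\<^bsub>M\<^esub> y) = N +>\<^bsub>M\<^esub> (x \<oplus>\<^bsub>M\<^esub> y)"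
    and "a \<in> carrier R \<Longrightarrow> x \<in> carrier M \<Longrightarrow> a \<odot>\<^bsub>Q\<^esub> (N +>\<^bsub>M\<^esub> x) = N +>\<^bsub>M\<^esub> (a \<odot>\<^bsub>M\<^esub> x)"
    and "x \<in> carrier M \<Longrightarrow> N +>\<^bsub>M\<^esub> x = \<zero>\<^bsub>Q\<^esub> \<longleftrightarrow> x \<in> N"
proof -
  interpret Module.module R M by (rule assms)
  interpret N: submodule N R M by (rule assms)
  have subN: "subgroup N (add_monoid M)" by (rule N.subgroup_axioms)
  interpret N: abelian_subgroup N M
    by (intro abelian_subgroupI3 additive_subgroup.intro subN) (rule M.abelian_group_axioms)
  show "carrier Q = (\<lambda>x. N +>\<^bsub>M\<^esub> x) ` carrier M"
    unfolding Q_def quot_module_def by (auto simp: A_RCOSETS_def')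
  show "(N +>\<^bsub>M\<^esub> x) \<oplus>\<^bsub>Q\<^esub> (N +>\<^bsub>M\<^esub> y) = N +>\<^bsub>M\<^esub> (x \<oplus>\<^bsub>M\<^esub> y)" if "x \<in> carrier M" "y \<in> carrier M"
    using N.a_rcos_sum[OF that] by (simp add: Q_def quot_module_def)
  show "N +>\<^bsub>M\<^esub> x = \<zero>\<^bsub>Q\<^esub> \<longleftrightarrow> x \<in> N" if "x \<in> carrier M"
    using M.a_coset_join1[OF _ that subN] M.a_coset_join2[OF that subN]
    by (auto simp: Q_def quot_module_def)
  show "a \<odot>\<^bsub>Q\<^esub> (N +>\<^bsub>M\<^esub> x) = N +>\<^bsub>M\<^esub> (a \<odot>\<^bsub>M\<^esub> x)" if a: "a \<in> carrier R" and x: "x \<in> carrier M"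
  proof -
    have "N +>\<^bsub>M\<^esub> (a \<odot>\<^bsub>M\<^esub> y) = N +>\<^bsub>M\<^esub> (a \<odot>\<^bsub>M\<^esub> x)" if y: "y \<in> N +>\<^bsub>M\<^esub> x" for y
    proof -
      obtain h where h: "h \<in> N" "y = h \<oplus>\<^bsub>M\<^esub> x" using y unfolding a_r_coset_def' by blast
      then have "a \<odot>\<^bsub>M\<^esub> y = a \<odot>\<^bsub>M\<^esub> h \<oplus>\<^bsub>M\<^esub> a \<odot>\<^bsub>M\<^esub> x" using a x by (simp add: smult_r_distr)
      moreover have "a \<odot>\<^bsub>M\<^esub> h \<in> N" using a h by simp
      ultimately have "a \<odot>\<^bsub>M\<^esub> y \<in> N +>\<^bsub>M\<^esub> (a \<odot>\<^bsub>M\<^esub> x)" unfolding a_r_coset_def' by blast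
      then show ?thesis using M.a_repr_independence[OF _ smult_closed[OF a x] subN] by blast
    qed
    moreover have "N +>\<^bsub>M\<^esub> x \<noteq> {}" using N.a_rcos_self[OF x] by blast
    ultimately have "(\<Union>y\<in>N +>\<^bsub>M\<^esub> x. N +>\<^bsub>M\<^esub> (a \<odot>\<^bsub>M\<^esub> y)) = N +>\<^bsub>M\<^esub> (a \<odot>\<^bsub>M\<^esub> x)"
      by (intro SUP_eq_const)
    then show ?thesis by (simp add: Q_def quot_module_def)
  qed
qed

lemma module_quot_module:
  fixes R (structure) and M (structure)
  assumes M: "Module.module R M" and N: "submodule N R M"
  shows "Module.module R (quot_module R M N)"
proof -
  interpret Module.module R M by (rule M)
  interpret N: submodule N R M by (rule N)
  let ?Q = "quot_module R M N" and ?f = "\<lambda>x. N +>\<^bsub>M\<^esub> x"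
  note Q = quot_module_simps[OF M N]
  have zero: "\<zero>\<^bsub>?Q\<^esub> = ?f \<zero>\<^bsub>M\<^esub>" using Q(4)[of "\<zero>\<^bsub>M\<^esub>"] N.one_closed by simp
  have el: "\<exists>x\<in>carrier M. X = ?f x" if "X \<in> carrier ?Q" for X using that Q(1) by auto
  have im: "?f x \<in> carrier ?Q" if "x \<in> carrier M" for x using that Q(1) by auto
  show ?thesis
  proof (rule moduleI)
    show "cring R" by (rule R.is_cring)
    show "abelian_group ?Q"
    proof (rule abelian_groupI)
      fix X assume "X \<in> carrier ?Q"
      then obtain x where x: "x \<in> carrier M" "X = ?f x" using el by blast
      then have "?f (\<ominus>\<^bsub>M\<^esub> x) \<oplus>\<^bsub>?Q\<^esub> X = \<zero>\<^bsub>?Q\<^esub>" by (simp add: Q(2) zero M.l_neg)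
      then show "\<exists>Y\<in>carrier ?Q. Y \<oplus>\<^bsub>?Q\<^esub> X = \<zero>\<^bsub>?Q\<^esub>" using im x by blast
    qed (auto simp: zero Q(2) M.a_ac dest!: el intro!: im)
  qed (auto simp: Q(2,3) smult_l_distr smult_r_distr smult_assoc1 dest!: el intro!: im)
qed

lemma module_submodule:
  fixes R (structure) and M (structure)
  assumes M: "Module.module R M" and N: "submodule N R M"
  shows "Module.module R (M\<lparr>carrier := N\<rparr>)"
proof -
  interpret Module.module R M by (rule M)
  note E = submoduleE[OF N]
  have [simp]: "x \<in> N \<Longrightarrow> x \<in> carrier M" for x using E(1) by blast
  have z: "\<zero>\<^bsub>M\<^esub> \<in> N" using N by (simp add: submodule_def subgroup_def)
  show ?thesis
  proof (rule moduleI)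
    show "cring R" by (rule R.is_cring)
    show "abelian_group (M\<lparr>carrier := N\<rparr>)"
    proof (rule abelian_groupI)
      fix x assume "x \<in> carrier (M\<lparr>carrier := N\<rparr>)"
      then show "\<exists>y\<in>carrier (M\<lparr>carrier := N\<rparr>). y \<oplus>\<^bsub>M\<lparr>carrier := N\<rparr>\<^esub> x = \<zero>\<^bsub>M\<lparr>carrier := N\<rparr>\<^esub>"
        using E(3)[of x] by (intro bexI[of _ "\<ominus>\<^bsub>M\<^esub> x"]) (auto simp: M.l_neg)
    qed (use E z in \<open>auto simp: M.a_ac\<close>)
  qed (use E in \<open>auto simp: smult_l_distr smult_r_distr smult_assoc1\<close>)
qed

text \<open>The map \<open>f\<close> presents the module \<open>X\<close> as \<open>A/B\<close>. The notion is stable under passing to submodules and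
  to quotients, so it reaches the factors of a filtration of \<open>S/I\<close> in a few steps and reduces
  statements about them to statements about polynomials.\<close>
definition module_onto ::
    "nat \<Rightarrow> (monomial \<Rightarrow>\<^sub>0 'k::field) set \<Rightarrow> (monomial \<Rightarrow>\<^sub>0 'k) set \<Rightarrow>
      (monomial \<Rightarrow>\<^sub>0 'k, 'x, 'd) module_scheme \<Rightarrow> ((monomial \<Rightarrow>\<^sub>0 'k) \<Rightarrow> 'x) \<Rightarrow> bool" where
  "module_onto n A B X f \<longleftrightarrow> Module.module (poly_ring n) X \<and>
    submod (polys n) A \<and> submod (polys n) B \<and> B \<subseteq> A \<and> A \<subseteq> polys n \<and> f ` A = carrier X \<and>
    (\<forall>p\<in>A. \<forall>q\<in>A. f (p + q) = f p \<oplus>\<^bsub>X\<^esub> f q) \<and>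
    (\<forall>s\<in>polys n. \<forall>p\<in>A. f (s * p) = s \<odot>\<^bsub>X\<^esub> f p) \<and> (\<forall>p\<in>A. f p = \<zero>\<^bsub>X\<^esub> \<longleftrightarrow> p \<in> B)"

context
  fixes n A B and X :: "(monomial \<Rightarrow>\<^sub>0 'k::field, 'x, 'd) module_scheme" and f
  assumes onto: "module_onto n A B X f"
begin

lemma onto_module: "Module.module (poly_ring n) X"
  and onto_A: "submod (polys n) A" and onto_B: "submod (polys n) B"
  and onto_sub: "B \<subseteq> A" "A \<subseteq> polys n" and onto_image: "f ` A = carrier X"
  and onto_add: "p \<in> A \<Longrightarrow> q \<in> A \<Longrightarrow> f (p + q) = f p \<oplus>\<^bsub>X\<^esub> f q"
  and onto_smult: "s \<in> polys n \<Longrightarrow> p \<in> A \<Longrightarrow> f (s * p) = s \<odot>\<^bsub>X\<^esub> f p"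
  and onto_ker: "p \<in> A \<Longrightarrow> f p = \<zero>\<^bsub>X\<^esub> \<longleftrightarrow> p \<in> B"
  using onto unfolding module_onto_def by blast+

interpretation X: Module.module "poly_ring n" X by (rule onto_module)

lemma onto_closed: "p \<in> A \<Longrightarrow> f p \<in> carrier X"
  using onto_image by blast

lemma onto_zero: "f 0 = \<zero>\<^bsub>X\<^esub>"
  using onto_ker submod_zero[OF onto_A] submod_zero[OF onto_B] by blast

lemma onto_uminus: "p \<in> A \<Longrightarrow> f (- p) = \<ominus>\<^bsub>X\<^esub> f p"
  using onto_add[of "- p" p] submod_uminus[OF onto_A] onto_closed onto_zero
  by (intro X.M.minus_equality[symmetric]) auto

lemma onto_eq_iff:
  assumes "p \<in> A" "q \<in> A"
  shows "f p = f q \<longleftrightarrow> p - q \<in> B"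
proof -
  have d: "p - q \<in> A" using submod_diff[OF onto_A] assms by blast
  have "f p = f (p - q) \<oplus>\<^bsub>X\<^esub> f q" using onto_add[OF d assms(2)] by simp
  then have "f p = f q \<longleftrightarrow> f (p - q) = \<zero>\<^bsub>X\<^esub>"
    using onto_closed d assms by (simp add: X.M.add.r_cancel_one)
  then show ?thesis using onto_ker[OF d] by simp
qed

lemma onto_image_mem:
  assumes C: "submod (polys n) C" "B \<subseteq> C" "C \<subseteq> A" and p: "p \<in> A"
  shows "f p \<in> f ` C \<longleftrightarrow> p \<in> C"
proof
  assume "f p \<in> f ` C"
  then obtain q where q: "q \<in> C" "f p = f q" by blast
  then have "p - q \<in> C" using onto_eq_iff[OF p, of q] C by auto
  then show "p \<in> C" using submod_add[OF C(1) _ q(1)] by fastforce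
qed simp

lemma onto_image_submodule:
  assumes C: "submod (polys n) C" "C \<subseteq> A"
  shows "submodule (f ` C) (poly_ring n) X"
proof (rule X.submoduleI)
  show "f ` C \<subseteq> carrier X" using C(2) onto_closed by blast
  show "\<zero>\<^bsub>X\<^esub> \<in> f ` C" using submod_zero[OF C(1)] onto_zero by force
  fix y assume "y \<in> f ` C"
  then obtain p where p: "p \<in> C" "y = f p" by blast
  show "\<ominus>\<^bsub>X\<^esub> y \<in> f ` C"
    using onto_uminus[of p] submod_uminus[OF C(1) p(1)] p C(2) by force
  show "s \<odot>\<^bsub>X\<^esub> y \<in> f ` C" if "s \<in> polys n" for s
    using onto_smult[OF that, of p] submod_smult[OF C(1) that p(1)] p C(2) by force
  show "y \<oplus>\<^bsub>X\<^esub> z \<in> f ` C" if "z \<in> f ` C" for z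
    using that onto_add[of p] submod_add[OF C(1) p(1)] p C(2) by force
qed

lemma module_onto_quot:
  assumes C: "submod (polys n) C" "B \<subseteq> C" "C \<subseteq> A"
  shows "module_onto n A C (quot_module (poly_ring n) X (f ` C)) (\<lambda>p. f ` C +>\<^bsub>X\<^esub> f p)"
proof -
  note sub = onto_image_submodule[OF C(1,3)]
  note Q = quot_module_simps[OF onto_module sub]
  show ?thesis
    unfolding module_onto_def
  proof (intro conjI ballI)
    show "Module.module (poly_ring n) (quot_module (poly_ring n) X (f ` C))"
      by (rule module_quot_module[OF onto_module sub])
    show "(\<lambda>p. f ` C +>\<^bsub>X\<^esub> f p) ` A = carrier (quot_module (poly_ring n) X (f ` C))"
      unfolding Q(1) onto_image[symmetric] by (simp add: image_image)
    fix p assume p: "p \<in> A"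
    show "f ` C +>\<^bsub>X\<^esub> f p = \<zero>\<^bsub>quot_module (poly_ring n) X (f ` C)\<^esub> \<longleftrightarrow> p \<in> C"
      using Q(4)[OF onto_closed[OF p]] onto_image_mem[OF C p] by simp
  qed (use onto_A C onto_sub in \<open>auto simp: Q(2,3) onto_closed onto_add onto_smult\<close>)
qed

lemma module_onto_sub:
  assumes C: "submod (polys n) C" "B \<subseteq> C" "C \<subseteq> A"
  shows "module_onto n C B (X\<lparr>carrier := f ` C\<rparr>) f"
  unfolding module_onto_def
proof (intro conjI ballI)
  show "Module.module (poly_ring n) (X\<lparr>carrier := f ` C\<rparr>)"
    by (rule module_submodule[OF onto_module onto_image_submodule[OF C(1,3)]])
qed (use C onto_B onto_sub onto_add[OF C(3)[THEN subsetD] C(3)[THEN subsetD]]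
      onto_smult[OF _ C(3)[THEN subsetD]] onto_ker[OF C(3)[THEN subsetD]] in auto)

lemma onto_nonzerodivisor_iff:
  assumes "a \<in> polys n"
  shows "nonzerodivisor_on X a \<longleftrightarrow> (\<forall>p\<in>A. a * p \<in> B \<longrightarrow> p \<in> B)"
proof -
  have "a \<odot>\<^bsub>X\<^esub> f p = \<zero>\<^bsub>X\<^esub> \<longleftrightarrow> a * p \<in> B" if "p \<in> A" for p
    using onto_smult[OF assms that] onto_ker[OF submod_smult[OF onto_A assms that]] by simp
  then show ?thesis
    unfolding nonzerodivisor_on_def onto_image[symmetric] using onto_ker by auto
qed

lemma onto_annihilator: "annihilator (poly_ring n) X = {a \<in> polys n. \<forall>p\<in>A. a * p \<in> B}"
proof -
  have "a \<odot>\<^bsub>X\<^esub> f p = \<zero>\<^bsub>X\<^esub> \<longleftrightarrow> a * p \<in> B" if "a \<in> polys n" "p \<in> A" for a p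
    using onto_smult[OF that] onto_ker[OF submod_smult[OF onto_A that]] by simp
  then show ?thesis unfolding annihilator_def onto_image[symmetric] by auto
qed

text \<open>The image of \<open>multsum A B xs\<close> is a submodule that contains the generators; conversely, the preimage
  of any such submodule contains \<open>multsum A B xs\<close> by \<open>multsum_least\<close>.\<close>
lemma onto_ideal_mult:
  assumes xs: "set xs \<subseteq> polys n"
  shows "ideal_mult (poly_ring n) X xs = f ` multsum A B xs"
proof
  have sm: "submod (polys n) (multsum A B xs)" by (rule submod_multsum[OF onto_A onto_B])
  have sA: "multsum A B xs \<subseteq> A" by (rule multsum_subset[OF onto_A xs onto_sub(1)])
  let ?G = "{a \<odot>\<^bsub>X\<^esub> x | a x. a \<in> set xs \<and> x \<in> carrier X}"
  have "?G \<subseteq> f ` multsum A B xs"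
  proof
    fix y assume "y \<in> ?G"
    then obtain a p where ap: "a \<in> set xs" "p \<in> A" "y = a \<odot>\<^bsub>X\<^esub> f p"
      unfolding onto_image[symmetric] by blast
    then have "y = f (a * p)" using onto_smult xs by auto
    then show "y \<in> f ` multsum A B xs"
      using multsum_prod[OF submod_zero[OF onto_A] submod_zero[OF onto_B] ap(1,2)] by blast
  qed
  then show "ideal_mult (poly_ring n) X xs \<subseteq> f ` multsum A B xs"
    unfolding ideal_mult_def gen_submodule_def using onto_image_submodule[OF sm sA] by blast
  have "f ` multsum A B xs \<subseteq> N" if N: "submodule N (poly_ring n) X" and G: "?G \<subseteq> N" for N
  proof -
    note E = X.submoduleE[OF N]
    have zN: "\<zero>\<^bsub>X\<^esub> \<in> N" using N by (simp add: submodule_def subgroup_def)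
    let ?P = "{p \<in> A. f p \<in> N}"
    have "submod (polys n) ?P"
      unfolding submod_def
    proof (intro conjI ballI)
      show "0 \<in> ?P" using submod_zero[OF onto_A] onto_zero zN by simp
      show "x - y \<in> ?P" if "x \<in> ?P" "y \<in> ?P" for x y
        using that onto_add[of x "- y"] onto_uminus[of y] submod_uminus[OF onto_A]
          submod_diff[OF onto_A] E(3,5) by auto
      show "s * x \<in> ?P" if "s \<in> polys n" "x \<in> ?P" for s x
        using that onto_smult submod_smult[OF onto_A] E(4) by auto
    qed
    moreover have "B \<subseteq> ?P"
    proof
      fix b assume "b \<in> B"
      then show "b \<in> ?P" using onto_sub(1) onto_ker[of b] zN by auto
    qed
    moreover have "x * a \<in> ?P" if "x \<in> set xs" "a \<in> A" for x a
    proof -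
      have "x \<odot>\<^bsub>X\<^esub> f a \<in> N" using that G onto_closed by blast
      then show ?thesis using that xs onto_smult submod_smult[OF onto_A] by auto
    qed
    ultimately have "multsum A B xs \<subseteq> ?P" by (rule multsum_least)
    then show ?thesis by blast
  qed
  then show "f ` multsum A B xs \<subseteq> ideal_mult (poly_ring n) X xs"
    unfolding ideal_mult_def gen_submodule_def by blast
qed

end

lemma onto_regular_sequence:
  assumes onto: "module_onto n A B X f"
  shows "regular_sequence (poly_ring n) X xs \<longleftrightarrow>
    set xs \<subseteq> polys n \<and> wregular A B xs \<and> multsum A B xs \<noteq> A"
proof (cases "set xs \<subseteq> polys n")
  case True
  note multsum_between = submod_multsum[OF onto_A[OF onto] onto_B[OF onto]]
    multsum_base[OF submod_zero[OF onto_A[OF onto]]]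
    multsum_subset[OF onto_A[OF onto] _ onto_sub(1)[OF onto]]
  have "nonzerodivisor_on (quot_module (poly_ring n) X (ideal_mult (poly_ring n) X (take i xs))) (xs ! i) \<longleftrightarrow>
      (\<forall>p\<in>A. xs ! i * p \<in> multsum A B (take i xs) \<longrightarrow> p \<in> multsum A B (take i xs))" if "i < length xs" for i
  proof -
    have t: "set (take i xs) \<subseteq> polys n" by (rule subset_trans[OF set_take_subset True])
    let ?C = "multsum A B (take i xs)"
    note C = multsum_between(1,2) multsum_between(3)[OF t]
    have "xs ! i \<in> polys n" by (rule subsetD[OF True nth_mem[OF that]])
    from onto_nonzerodivisor_iff[OF module_onto_quot[OF onto C] this]
    show ?thesis unfolding onto_ideal_mult[OF onto t] .
  qed
  moreover have "ideal_mult (poly_ring n) X xs = carrier X \<longleftrightarrow> multsum A B xs = A"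
  proof -
    let ?C = "multsum A B xs"
    note C = multsum_between(1,2) multsum_between(3)[OF True]
    have "f ` ?C = f ` A \<longleftrightarrow> ?C = A"
    proof
      assume eq: "f ` ?C = f ` A"
      have "p \<in> ?C" if "p \<in> A" for p
        using onto_image_mem[OF onto C that] imageI[OF that, of f] unfolding eq by (rule iffD1)
      then show "?C = A" using C(3) by blast
    qed simp
    then show ?thesis using onto_ideal_mult[OF onto True] onto_image[OF onto] by simp
  qed
  ultimately show ?thesis using True by (simp add: regular_sequence_def wregular_iff_nth)
qed (simp add: regular_sequence_def)

section \<open>Dimension and depth of quotients of squarefree monomial ideals\<close>

lemma regular_module_onto:
  "module_onto n (polys n) {0} (regular_module (poly_ring n :: (monomial \<Rightarrow>\<^sub>0 'k::field) ring)) (\<lambda>p. p)"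
proof -
  let ?M = "regular_module (poly_ring n :: (monomial \<Rightarrow>\<^sub>0 'k) ring)"
  have M: "carrier ?M = polys n" "\<And>x y. x \<oplus>\<^bsub>?M\<^esub> y = x + y" "\<zero>\<^bsub>?M\<^esub> = 0" "\<And>a x. a \<odot>\<^bsub>?M\<^esub> x = a * x"
    by (simp_all add: regular_module_def)
  have "abelian_group ?M"
  proof (rule abelian_groupI)
    fix x assume "x \<in> carrier ?M"
    then show "\<exists>y\<in>carrier ?M. y \<oplus>\<^bsub>?M\<^esub> x = \<zero>\<^bsub>?M\<^esub>"
      unfolding M using submod_uminus[OF submod_polys] by (intro bexI[of _ "- x"]) auto
  qed (auto simp: M algebra_simps submod_zero[OF submod_polys] intro: submod_add[OF submod_polys])
  then have "Module.module (poly_ring n) ?M"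
    by (intro moduleI cring_poly_ring) (auto simp: M algebra_simps intro: polys_mult)
  moreover have "submod (polys n) {0 :: monomial \<Rightarrow>\<^sub>0 'k}" by (simp add: submod_def)
  ultimately show ?thesis
    unfolding module_onto_def M using submod_polys submod_zero[OF submod_polys] by auto
qed

lemma psubset_witness: "A \<subseteq> B \<Longrightarrow> x \<in> B \<Longrightarrow> x \<notin> A \<Longrightarrow> A \<subset> B"
  by blast

text \<open>Primes of a quotient ring pull back to primes that contain the ideal.\<close>
lemma krull_dim_quot_le:
  assumes R: "cring R" and J: "ideal J R"
    and chain: "\<And>P l. \<forall>i\<le>l. primeideal (P i) R \<Longrightarrow> \<forall>i<l. P i \<subset> P (Suc i) \<Longrightarrow> J \<subseteq> P 0 \<Longrightarrow> l \<le> d"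
  shows "krull_dim (R Quot J) \<le> enat d"
  unfolding krull_dim_def
proof (rule Sup_least)
  interpret J: ideal J R by (rule J)
  interpret h: ring_hom_ring R "R Quot J" "(+>\<^bsub>R\<^esub>) J" by (rule J.rcos_ring_hom_ring)
  fix x assume "x \<in> {enat l | l. \<exists>P. (\<forall>i\<le>l. primeideal (P i) (R Quot J)) \<and> (\<forall>i<l. P i \<subset> P (Suc i))}"
  then obtain l P where x: "x = enat l" and P: "\<And>i. i \<le> l \<Longrightarrow> primeideal (P i) (R Quot J)"
    "\<And>i. i < l \<Longrightarrow> P i \<subset> P (Suc i)" by blast
  let ?P = "\<lambda>i. {r \<in> carrier R. J +>\<^bsub>R\<^esub> r \<in> P i}"
  have "l \<le> d"
  proof (rule chain)
    show "\<forall>i\<le>l. primeideal (?P i) R" using h.primeideal_vimage[OF R P(1)] by blast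
    show "\<forall>i<l. ?P i \<subset> ?P (Suc i)"
    proof (intro allI impI)
      fix i assume i: "i < l"
      obtain X where X: "X \<in> P (Suc i)" "X \<notin> P i" using P(2)[OF i] by blast
      have "ideal (P (Suc i)) (R Quot J)" using P(1)[of "Suc i"] i by (auto intro: primeideal.axioms)
      then have "X \<in> carrier (R Quot J)" using X(1) ideal.Icarr by metis
      then obtain r where "r \<in> carrier R" "X = J +>\<^bsub>R\<^esub> r"
        unfolding FactRing_def A_RCOSETS_def' by auto
      then have r: "r \<in> ?P (Suc i)" "r \<notin> ?P i" using X by simp_all
      have "?P i \<subseteq> ?P (Suc i)" using P(2)[OF i] by auto
      then show "?P i \<subset> ?P (Suc i)" using r by (rule psubset_witness)
    qed
    show "J \<subseteq> ?P 0"
    proof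
      fix r assume r: "r \<in> J"
      interpret P0: ideal "P 0" "R Quot J" using P(1)[of 0] by (auto intro: primeideal.axioms)
      have "J +>\<^bsub>R\<^esub> r = \<zero>\<^bsub>R Quot J\<^esub>" unfolding J.a_rcos_const[OF r] FactRing_def by simp
      then show "r \<in> ?P 0"
        using additive_subgroup.zero_closed[OF P0.is_additive_subgroup] J.Icarr[OF r] by simp
    qed
  qed
  then show "x \<le> enat d" by (simp add: x)
qed

text \<open>Primes that contain \<open>J\<close> have prime images, and inclusions stay strict because each prime is the full
  preimage of its image.\<close>
lemma krull_dim_quot_ge:
  assumes R: "cring R" and J: "ideal J R"
    and P: "\<And>i. i \<le> l \<Longrightarrow> primeideal (P i) R" "\<And>i. i < l \<Longrightarrow> P i \<subset> P (Suc i)" "J \<subseteq> P 0"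
  shows "enat l \<le> krull_dim (R Quot J)"
proof -
  interpret cring R by (rule R)
  interpret J: ideal J R by (rule J)
  interpret h: ring_hom_ring R "R Quot J" "(+>\<^bsub>R\<^esub>) J" by (rule J.rcos_ring_hom_ring)
  let ?P = "\<lambda>i. (+>\<^bsub>R\<^esub>) J ` P i"
  have JP: "J \<subseteq> P i" if "i \<le> l" for i
    using that
  proof (induction i)
    case (Suc i)
    then show ?case using P(2)[of i] by auto
  qed (rule P(3))
  have mem: "J +>\<^bsub>R\<^esub> r \<in> ?P i \<longleftrightarrow> r \<in> P i" if i: "i \<le> l" and r: "r \<in> carrier R" for i r
  proof
    assume "J +>\<^bsub>R\<^esub> r \<in> ?P i"
    then obtain p where p: "p \<in> P i" "J +>\<^bsub>R\<^esub> r = J +>\<^bsub>R\<^esub> p" by blast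
    interpret Pi: primeideal "P i" R by (rule P(1)[OF i])
    have "r \<in> J +>\<^bsub>R\<^esub> p" using J.a_rcos_self[OF r] p(2) by simp
    then obtain j where "j \<in> J" "r = j \<oplus>\<^bsub>R\<^esub> p" unfolding a_r_coset_def' by blast
    moreover from this(1) have "j \<in> P i" by (rule subsetD[OF JP[OF i]])
    ultimately show "r \<in> P i"
      using additive_subgroup.a_closed[OF Pi.is_additive_subgroup _ p(1), of j] by simp
  qed simp
  have el: "\<exists>r\<in>carrier R. X = J +>\<^bsub>R\<^esub> r" if "X \<in> carrier (R Quot J)" for X
    using that unfolding FactRing_def A_RCOSETS_def' by auto
  have prime: "primeideal (?P i) (R Quot J)" if i: "i \<le> l" for i
  proof (rule primeidealI)
    interpret Pi: primeideal "P i" R by (rule P(1)[OF i])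
    show "ideal (?P i) (R Quot J)" by (rule ring_ideal_imp_quot_ideal[OF J Pi.is_ideal])
    show "cring (R Quot J)" by (rule J.quotient_is_cring[OF R])
    obtain r where "r \<in> carrier R" "r \<notin> P i" using Pi.I_notcarr Pi.a_subset by blast
    then show "carrier (R Quot J) \<noteq> ?P i" using mem[OF i] h.hom_closed by metis
    fix X Y assume XY: "X \<in> carrier (R Quot J)" "Y \<in> carrier (R Quot J)" "X \<otimes>\<^bsub>R Quot J\<^esub> Y \<in> ?P i"
    obtain x where x: "x \<in> carrier R" "X = J +>\<^bsub>R\<^esub> x" using el[OF XY(1)] by (elim bexE)
    obtain y where y: "y \<in> carrier R" "Y = J +>\<^bsub>R\<^esub> y" using el[OF XY(2)] by (elim bexE)
    note xy = x(1) y(1) x(2) y(2)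
    have "J +>\<^bsub>R\<^esub> (x \<otimes>\<^bsub>R\<^esub> y) \<in> ?P i"
      using XY(3) unfolding xy(3,4) h.hom_mult[OF xy(1,2)] .
    then have "x \<otimes>\<^bsub>R\<^esub> y \<in> P i" using mem[OF i m_closed[OF xy(1,2)]] by (rule iffD1[rotated])
    then show "X \<in> ?P i \<or> Y \<in> ?P i" using Pi.I_prime[OF xy(1,2)] xy(3,4) by blast
  qed
  have strict: "?P i \<subset> ?P (Suc i)" if i: "i < l" for i
  proof -
    interpret Pi: primeideal "P (Suc i)" R using P(1) i by simp
    obtain r where r: "r \<in> P (Suc i)" "r \<notin> P i" using P(2)[OF i] by blast
    then have "J +>\<^bsub>R\<^esub> r \<notin> ?P i" using mem[of i r] i Pi.Icarr by simp
    moreover have "J +>\<^bsub>R\<^esub> r \<in> ?P (Suc i)" using r(1) by (rule imageI)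
    moreover have "?P i \<subseteq> ?P (Suc i)" using P(2)[OF i] by (intro image_mono) simp
    ultimately show ?thesis by (intro psubset_witness)
  qed
  have "\<exists>P. (\<forall>i\<le>l. primeideal (P i) (R Quot J)) \<and> (\<forall>i<l. P i \<subset> P (Suc i))"
    by (intro exI[of _ ?P] conjI allI impI prime strict)
  then have "enat l \<in> {enat l | l. \<exists>P. (\<forall>i\<le>l. primeideal (P i) (R Quot J)) \<and> (\<forall>i<l. P i \<subset> P (Suc i))}"
    by (intro CollectI exI[of _ l] conjI refl)
  then show ?thesis unfolding krull_dim_def by (rule Sup_upper)
qed

lemma mdeg_superset:
  assumes "finite K" "supp m \<subseteq> K"
  shows "mdeg m = (\<Sum>j\<in>K. Poly_Mapping.lookup m j)"
  unfolding mdeg_def using assms by (intro sum.mono_neutral_left) (auto simp: Poly_Mapping.in_keys_iff)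

lemma mdeg_add: "mdeg (k + m) = mdeg k + mdeg m"
proof -
  let ?K = "supp k \<union> supp m"
  have "mdeg (k + m) = (\<Sum>j\<in>?K. Poly_Mapping.lookup (k + m) j)"
    by (rule mdeg_superset) (auto simp: supp_add)
  also have "\<dots> = (\<Sum>j\<in>?K. Poly_Mapping.lookup k j) + (\<Sum>j\<in>?K. Poly_Mapping.lookup m j)"
    by (simp add: Poly_Mapping.lookup_add sum.distrib)
  also have "\<dots> = mdeg k + mdeg m"
    using mdeg_superset[of ?K k] mdeg_superset[of ?K m] by simp
  finally show ?thesis .
qed

lemma mdeg_eq_0: "mdeg m = 0 \<Longrightarrow> m = 0"
  by (rule Poly_Mapping.poly_mapping_eqI) (auto simp: mdeg_def Poly_Mapping.in_keys_iff)

lemma mdeg_sqm: "finite F \<Longrightarrow> mdeg (sqm F) = card F"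
  using mdeg_superset[of F "sqm F"] by (simp add: supp_sqm lookup_sqm)

text \<open>A graded form of Nakayama's lemma: a monomial \<open>m\<close> of least degree in \<open>A\<close> but not in \<open>B\<close> cannot occur
  in \<open>(xs) A + B\<close>. If it occurred in \<open>x * a\<close> with \<open>x\<close> in \<open>xs\<close>, it would be a proper multiple of a monomial
  of \<open>A\<close>; the latter has smaller degree, so it lies in \<open>B\<close>, and then so does \<open>m\<close>.\<close>
lemma multsum_proper:
  fixes xs :: "(monomial \<Rightarrow>\<^sub>0 'k::field) list"
  assumes D: "upset n D" and D': "upset n D'" and sub: "D' \<subset> D"
    and xs: "\<And>x m. x \<in> set xs \<Longrightarrow> m \<in> terms x \<Longrightarrow> mdeg m > 0" "set xs \<subseteq> polys n"
  shows "multsum (sqf_ideal n D) (sqf_ideal n D') xs \<noteq> sqf_ideal n D"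
proof -
  obtain F where F: "F \<in> D" "F \<notin> D'" using sub by blast
  have Fn: "F \<subseteq> {1..n}" "finite F" using upset_subset[OF D F(1)] finite_subset by auto
  have "\<exists>m. supp m \<in> D - D'" using F Fn by (intro exI[of _ "sqm F"]) (simp add: supp_sqm)
  from exists_least_iff[of "\<lambda>k. \<exists>m. supp m \<in> D - D' \<and> mdeg m = k"] this
  obtain m where m: "supp m \<in> D - D'" and least: "\<And>m'. mdeg m' < mdeg m \<Longrightarrow> supp m' \<notin> D - D'"
    by blast
  note smD = submod_sqf_ideal[OF D]
  let ?N = "{p \<in> sqf_ideal n D. m \<notin> terms p} :: (monomial \<Rightarrow>\<^sub>0 'k) set"
  have fact: "m \<notin> terms (s * p)"
    if s: "s \<in> polys n" and p: "p \<in> sqf_ideal n D"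
      and disj: "m \<notin> terms p \<or> (\<forall>k\<in>terms s. mdeg k > 0)" for s p :: "monomial \<Rightarrow>\<^sub>0 'k"
  proof
    assume "m \<in> terms (s * p)"
    then obtain k l where kl: "k \<in> terms s" "l \<in> terms p" "m = k + l" by (rule terms_mult)
    have "mdeg k > 0"
    proof (rule ccontr)
      assume k0: "\<not> mdeg k > 0"
      then have "k = 0" using mdeg_eq_0 by simp
      then have "m \<in> terms p" using kl by simp
      then show False using disj kl(1) k0 by auto
    qed
    then have "mdeg l < mdeg m" by (simp add: kl(3) mdeg_add)
    then have "supp l \<in> D'" using least[of l] p kl(2) by (auto simp: sqf_ideal_def)
    moreover have "supp l \<subseteq> supp m" by (simp add: kl(3) supp_add)
    moreover have "supp m \<subseteq> {1..n}" using m upset_subset[OF D] by blast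
    ultimately show False using upsetD[OF D'] m by blast
  qed
  have "submod (polys n) ?N"
    unfolding submod_def
  proof (intro conjI ballI)
    show "0 \<in> ?N" using submod_zero[OF smD] by simp
    show "x - y \<in> ?N" if "x \<in> ?N" "y \<in> ?N" for x y :: "monomial \<Rightarrow>\<^sub>0 'k"
      using that submod_diff[OF smD, of x y] terms_diff[of m x y] by auto
    show "s * x \<in> ?N" if "s \<in> polys n" "x \<in> ?N" for s x :: "monomial \<Rightarrow>\<^sub>0 'k"
      using that fact[of s x] submod_smult[OF smD, of s x] by auto
  qed
  moreover have "sqf_ideal n D' \<subseteq> ?N" using m sub by (auto simp: sqf_ideal_def)
  moreover have "x * a \<in> ?N" if "x \<in> set xs" "a \<in> sqf_ideal n D" for x a :: "monomial \<Rightarrow>\<^sub>0 'k"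
    using that fact[of x a] xs submod_smult[OF smD, of x a] by auto
  ultimately have "multsum (sqf_ideal n D) (sqf_ideal n D') xs \<subseteq> ?N" by (rule multsum_least)
  moreover have "Poly_Mapping.single m 1 \<in> sqf_ideal n D - ?N"
    using m upset_subset[OF D, of "supp m"] by (auto simp: sqf_ideal_def polys_iff)
  ultimately show ?thesis by blast
qed

lemma theta_irrelevant:
  "set (theta n d :: (monomial \<Rightarrow>\<^sub>0 'k::field) list) \<subseteq> irrelevant_ideal (poly_ring n) (poly_grading n)"
proof -
  interpret cring "poly_ring n :: (monomial \<Rightarrow>\<^sub>0 'k) ring" by (rule cring_poly_ring)
  let ?G = "\<Union>d\<in>{0<..}. poly_grading n d :: (monomial \<Rightarrow>\<^sub>0 'k) set"
  have "(esym n j :: monomial \<Rightarrow>\<^sub>0 'k) \<in> poly_grading n (int j)" for j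
    unfolding poly_grading_def
    using esym_polys by (auto elim!: terms_esym simp: mdeg_sqm finite_subset)
  then have "(esym n j :: monomial \<Rightarrow>\<^sub>0 'k) \<in> ?G" if "1 \<le> j" for j
    using that by (intro UN_I[of "int j"]) auto
  then have "set (theta n d :: (monomial \<Rightarrow>\<^sub>0 'k) list) \<subseteq> ?G" unfolding set_theta by auto
  also have "?G \<subseteq> Idl\<^bsub>poly_ring n\<^esub> ?G"
    by (rule genideal_self) (auto simp: poly_grading_def)
  finally show ?thesis unfolding irrelevant_ideal_def .
qed

lemma primeideal_face_ideal:
  "primeideal (face_ideal n F :: (monomial \<Rightarrow>\<^sub>0 'k::field) set) (poly_ring n)"
proof (rule primeidealI[OF submod_ideal[OF submod_sqf_ideal[OF upset_nonfaces] sqf_ideal_polys] cring_poly_ring])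
  have "1 \<notin> (face_ideal n F :: (monomial \<Rightarrow>\<^sub>0 'k) set)" by (simp add: face_ideal_iff)
  then show "polys n \<noteq> (face_ideal n F :: (monomial \<Rightarrow>\<^sub>0 'k) set)" using one_polys by blast
qed (use face_ideal_prime in auto)

lemma face_ideal_strict_mono:
  assumes "F \<subset> G" "G \<subseteq> {1..n}"
  shows "(face_ideal n G :: (monomial \<Rightarrow>\<^sub>0 'k::field) set) \<subset> face_ideal n F"
proof -
  have "(face_ideal n G :: (monomial \<Rightarrow>\<^sub>0 'k) set) \<subseteq> face_ideal n F"
    by (rule sqf_ideal_mono) (use assms in \<open>auto simp: nonfaces_def\<close>)
  moreover have "(xmon G :: monomial \<Rightarrow>\<^sub>0 'k) \<in> face_ideal n F"
    unfolding xmon_sqf_ideal[OF assms(2)] using assms by (auto simp: nonfaces_def)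
  moreover have "(xmon G :: monomial \<Rightarrow>\<^sub>0 'k) \<notin> face_ideal n G"
    unfolding xmon_sqf_ideal[OF assms(2)] by (simp add: nonfaces_def)
  ultimately show ?thesis by blast
qed

text \<open>A monomial whose support has more than \<open>d\<close> elements annihilates \<open>A/B\<close>, since it takes the monomials
  of \<open>A\<close> to monomials of \<open>B\<close>. So both the ring \<open>S/ann\<close> and the module \<open>A/B\<close> satisfy the growth
  condition of \<open>regular_tower_length\<close>, which bounds dimension and depth by \<open>d\<close>. The depth is attained
  by \<open>theta\<close>, and the dimension by the chain of the face ideals of subsets of \<open>F\<close>; the annihilator
  lies in the first of them because the monomial of \<open>F\<close> belongs to \<open>A\<close> and not to that prime.\<close>
lemma cohen_macaulay_sqf_quotient:
  fixes X :: "(monomial \<Rightarrow>\<^sub>0 'k::field, 'x, 'd) module_scheme"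
  assumes D: "upset n D" and D': "upset n D'" and sub: "D' \<subseteq> D"
    and onto: "module_onto n (sqf_ideal n D) (sqf_ideal n D') X f"
    and reg: "wregular (sqf_ideal n D) (sqf_ideal n D' :: (monomial \<Rightarrow>\<^sub>0 'k) set) (theta n d)"
    and small: "\<And>H. H \<in> D \<Longrightarrow> H \<notin> D' \<Longrightarrow> card H \<le> d"
    and F: "F \<in> D" "F \<notin> D'" "card F = d"
  shows "module_dim (poly_ring n) X = enat d" and "cohen_macaulay (poly_ring n) (poly_grading n) X"
proof -
  let ?A = "sqf_ideal n D :: (monomial \<Rightarrow>\<^sub>0 'k) set" and ?B = "sqf_ideal n D' :: (monomial \<Rightarrow>\<^sub>0 'k) set"
  let ?R = "poly_ring n :: (monomial \<Rightarrow>\<^sub>0 'k) ring"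
  let ?J = "annihilator ?R X"
  have smA: "submod (polys n) ?A" and smB: "submod (polys n) ?B"
    by (rule submod_sqf_ideal[OF D], rule submod_sqf_ideal[OF D'])
  have Fn: "F \<subseteq> {1..n}" "finite F" using upset_subset[OF D F(1)] finite_subset by auto
  have J: "?J = {a \<in> polys n. \<forall>p\<in>?A. a * p \<in> ?B}" by (rule onto_annihilator[OF onto])
  have Jsm: "submod (polys n) ?J"
    unfolding submod_def J
    using submod_zero[OF smB] submod_zero[OF submod_polys] submod_diff[OF smB] submod_diff[OF submod_polys]
      submod_smult[OF smB] polys_mult
    by (auto simp: left_diff_distrib mult.assoc)
  have Jid: "ideal ?J ?R" by (rule submod_ideal[OF Jsm]) (auto simp: J)
  have large: "p \<in> ?B" if p: "p \<in> ?A" "\<And>m. m \<in> terms p \<Longrightarrow> d < card (supp m)" for p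
    unfolding sqf_ideal_def
  proof (intro CollectI conjI ballI)
    show "p \<in> polys n" using p(1) sqf_ideal_polys by blast
    fix m assume m: "m \<in> terms p"
    then have "supp m \<in> D" using p(1) by (simp add: sqf_ideal_def)
    then show "supp m \<in> D'" using small[of "supp m"] p(2)[OF m] by auto
  qed
  have largeJ: "p \<in> ?J" if p: "p \<in> polys n" "\<And>m. m \<in> terms p \<Longrightarrow> d < card (supp m)" for p
    unfolding J
  proof (intro CollectI conjI ballI p(1))
    fix q assume q: "q \<in> ?A"
    show "p * q \<in> ?B"
    proof (rule large)
      show "p * q \<in> ?A" by (rule submod_smult[OF smA p(1) q])
      fix m assume "m \<in> terms (p * q)"
      then obtain k l where kl: "k \<in> terms p" "m = k + l" by (rule terms_mult)
      have "card (supp k) \<le> card (supp m)" by (rule card_mono) (auto simp: kl(2) supp_add)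
      then show "d < card (supp m)" using p(2)[OF kl(1)] by simp
    qed
  qed
  have "krull_dim (?R Quot ?J) \<le> enat d"
  proof (rule krull_dim_quot_le[OF cring_poly_ring Jid])
    fix P :: "nat \<Rightarrow> (monomial \<Rightarrow>\<^sub>0 'k) set" and l
    assume P: "\<forall>i\<le>l. primeideal (P i) ?R" "\<forall>i<l. P i \<subset> P (Suc i)" "?J \<subseteq> P 0"
    have Pid: "ideal (P i) ?R" if "i \<le> l" for i using P(1) that by (auto intro: primeideal.axioms)
    have "\<forall>i. \<exists>a. i < l \<longrightarrow> a \<in> P (Suc i) \<and> a \<notin> P i" using P(2) by blast
    then obtain a where a: "\<And>i. i < l \<Longrightarrow> a i \<in> P (Suc i)" "\<And>i. i < l \<Longrightarrow> a i \<notin> P i"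
      using choice[of "\<lambda>i a. i < l \<longrightarrow> a \<in> P (Suc i) \<and> a \<notin> P i"] by blast
    have tower: "regular_tower n (polys n) P a l"
      unfolding regular_tower_def
    proof (intro conjI allI impI ballI)
      show "submod (polys n) (P i)" if "i \<le> l" for i by (rule ideal_submod(1)[OF Pid[OF that]])
      fix i assume i: "i < l"
      have sm: "submod (polys n) (P (Suc i))" "P (Suc i) \<subseteq> polys n"
        using ideal_submod[OF Pid[of "Suc i"]] i by auto
      show ai: "a i \<in> polys n" using a(1)[OF i] sm(2) by blast
      show "P i \<subseteq> P (Suc i)" using P(2) i by blast
      fix p :: "monomial \<Rightarrow>\<^sub>0 'k" assume p: "p \<in> polys n"
      show "a i * p \<in> P (Suc i)" using submod_smult[OF sm(1) p a(1)[OF i]] by (simp add: mult.commute)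
      have "primeideal (P i) ?R" using P(1) i by simp
      from primeideal.I_prime[OF this ai p]
      show "p \<in> P i" if "a i * p \<in> P i" using that a(2)[OF i] by simp
    qed
    (* for a chain of primes the vector v of the growth bound is 1 *)
    have "1 \<notin> P l"
    proof
      assume "1 \<in> P l"
      then have "P l = polys n" using ideal.one_imp_carrier[OF Pid[of l]] by simp
      then show False using primeideal.I_notcarr[OF P(1)[rule_format, OF order_refl]] by simp
    qed
    then show "l \<le> d"
    proof (rule regular_tower_length[OF submod_polys subset_refl tower one_polys])
      show "restrict_terms (\<lambda>m. d < card (supp m)) p \<in> P 0" if "p \<in> polys n" for p
        using largeJ[OF restrict_terms_polys[OF that]] P(3) by auto
    qed
  qed
  moreover have "enat d \<le> krull_dim (?R Quot ?J)"
  proof -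
    obtain h where h: "bij_betw h {0..<d} F" using ex_bij_betw_nat_finite[OF Fn(2)] F(3) by blast
    let ?P = "\<lambda>i. face_ideal n (h ` {i..<d}) :: (monomial \<Rightarrow>\<^sub>0 'k) set"
    have hF: "h ` {i..<d} \<subseteq> F" for i using h by (auto simp: bij_betw_def)
    show ?thesis
    proof (rule krull_dim_quot_ge[OF cring_poly_ring Jid, where P = ?P])
      show "primeideal (?P i) ?R" for i by (rule primeideal_face_ideal)
      show "?P i \<subset> ?P (Suc i)" if i: "i < d" for i
      proof (rule face_ideal_strict_mono)
        have "h i \<notin> h ` {Suc i..<d}"
          using inj_on_image_mem_iff[of h "{0..<d}" i "{Suc i..<d}"] h i by (auto simp: bij_betw_def)
        then show "h ` {Suc i..<d} \<subset> h ` {i..<d}" using i by auto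
        show "h ` {i..<d} \<subseteq> {1..n}" using hF Fn by blast
      qed
      have "?J \<subseteq> face_ideal n F"
      proof
        fix a assume a: "a \<in> ?J"
        have "?B \<subseteq> face_ideal n F"
        proof (rule sqf_ideal_mono, rule subsetI)
          fix H assume "H \<in> D'"
          then show "H \<in> nonfaces n F"
            using upsetD[OF D' _ _ Fn(1)] upset_subset[OF D'] F(2) by (auto simp: nonfaces_def)
        qed
        moreover have "xmon F \<in> ?A" using F by (simp add: xmon_sqf_ideal[OF Fn(1)])
        ultimately have "a * xmon F \<in> face_ideal n F" using a unfolding J by blast
        moreover have "(xmon F :: monomial \<Rightarrow>\<^sub>0 'k) \<notin> face_ideal n F"
          by (simp add: xmon_sqf_ideal[OF Fn(1)] nonfaces_def)
        ultimately show "a \<in> face_ideal n F"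
          using face_ideal_prime[OF _ xmon_polys[OF Fn(1)]] a unfolding J by blast
      qed
      then show "?J \<subseteq> ?P 0" using h by (simp add: bij_betw_def)
    qed
  qed
  ultimately show dim: "module_dim ?R X = enat d" unfolding module_dim_def by simp
  have "module_depth ?R (irrelevant_ideal ?R (poly_grading n)) X \<le> enat d"
    unfolding module_depth_def
  proof (rule Sup_least)
    fix x assume "x \<in> {enat (length xs) | xs. set xs \<subseteq> irrelevant_ideal ?R (poly_grading n) \<and> regular_sequence ?R X xs}"
    then obtain xs where x: "x = enat (length xs)" and "regular_sequence ?R X xs" by blast
    then have xs: "set xs \<subseteq> polys n" "wregular ?A ?B xs" "multsum ?A ?B xs \<noteq> ?A"
      using onto_regular_sequence[OF onto] by auto
    let ?N = "\<lambda>i. multsum ?A ?B (take i xs)"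
    have tower: "regular_tower n ?A ?N (\<lambda>i. xs ! i) (length xs)"
      unfolding regular_tower_def
    proof (intro conjI allI impI ballI)
      show sm: "submod (polys n) (?N i)" for i by (rule submod_multsum[OF smA smB])
      fix i assume i: "i < length xs"
      have el: "x * a \<in> ?N (Suc i)" if "x \<in> set (take (Suc i) xs)" "a \<in> ?A" for x a
        by (rule multsum_prod[OF submod_zero[OF smA] submod_zero[OF smB] that])
      have xi: "xs ! i \<in> set (take (Suc i) xs)" using i by (simp add: take_Suc_conv_app_nth)
      show "xs ! i \<in> polys n" by (rule subsetD[OF xs(1) nth_mem[OF i]])
      show "?N i \<subseteq> ?N (Suc i)"
      proof (rule multsum_least[OF sm])
        show "?B \<subseteq> ?N (Suc i)" by (rule multsum_base[OF submod_zero[OF smA]])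
        show "x * a \<in> ?N (Suc i)" if "x \<in> set (take i xs)" "a \<in> ?A" for x a
          using el[OF _ that(2), of x] that(1) i by (simp add: take_Suc_conv_app_nth)
      qed
      fix p assume p: "p \<in> ?A"
      show "xs ! i * p \<in> ?N (Suc i)" by (rule el[OF xi p])
      show "p \<in> ?N i" if "xs ! i * p \<in> ?N i"
        using xs(2) that p i unfolding wregular_iff_nth by blast
    qed
    have "multsum ?A ?B xs \<subseteq> ?A"
      by (rule multsum_subset[OF smA xs(1) sqf_ideal_mono[OF sub]])
    then obtain v where v: "v \<in> ?A" "v \<notin> ?N (length xs)" using xs(3) by auto
    have "length xs \<le> d"
    proof (rule regular_tower_length[OF smA sqf_ideal_polys tower v])
      fix p assume p: "p \<in> ?A"
      have "restrict_terms (\<lambda>m. d < card (supp m)) p \<in> ?B"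
        by (rule large) (use p in \<open>auto simp: sqf_ideal_def restrict_terms_polys\<close>)
      then show "restrict_terms (\<lambda>m. d < card (supp m)) p \<in> ?N 0" by simp
    qed
    then show "x \<le> enat d" by (simp add: x)
  qed
  moreover have "enat d \<le> module_depth ?R (irrelevant_ideal ?R (poly_grading n)) X"
  proof -
    have "multsum ?A ?B (theta n d) \<noteq> ?A"
    proof (rule multsum_proper[OF D D' _ _ theta_polys])
      show "D' \<subset> D" using sub F by blast
      show "0 < mdeg m" if "x \<in> set (theta n d)" "m \<in> terms x" for x :: "monomial \<Rightarrow>\<^sub>0 'k" and m
        using that by (auto simp: set_theta mdeg_sqm finite_subset elim!: terms_esym)
    qed
    then have "regular_sequence ?R X (theta n d)"
      unfolding onto_regular_sequence[OF onto] using reg theta_polys by blast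
    moreover have "enat d = enat (length (theta n d :: (monomial \<Rightarrow>\<^sub>0 'k) list))" by simp
    ultimately show ?thesis
      unfolding module_depth_def using theta_irrelevant by (intro Sup_upper CollectI exI conjI)
  qed
  ultimately show "cohen_macaulay ?R (poly_grading n) X" unfolding cohen_macaulay_def dim by simp
qed

section \<open>Gradings and the filtration criterion\<close>

text \<open>Existence and uniqueness of homogeneous components follow from additive projections: applying
  \<open>pr e\<close> to a decomposition of \<open>x\<close> recovers its component of degree \<open>e\<close>.\<close>
lemma gradingI:
  fixes A (structure)
  assumes A: "abelian_group A" and G: "\<And>d. additive_subgroup (G d) A"
    and proj: "\<And>d x. x \<in> carrier A \<Longrightarrow> pr d x \<in> G d"
    and add: "\<And>d x y. x \<in> carrier A \<Longrightarrow> y \<in> carrier A \<Longrightarrow> pr d (x \<oplus> y) = pr d x \<oplus> pr d y"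
    and pure: "\<And>d e x. x \<in> G e \<Longrightarrow> pr d x = (if d = e then x else \<zero>)"
    and fin: "\<And>x. x \<in> carrier A \<Longrightarrow> finite {d. pr d x \<noteq> \<zero>}"
    and sum: "\<And>x. x \<in> carrier A \<Longrightarrow> x = (\<Oplus>d\<in>{d. pr d x \<noteq> \<zero>}. pr d x)"
  shows "grading A G"
proof -
  interpret abelian_group A by (rule A)
  have Gc: "x \<in> carrier A" if "x \<in> G d" for x d using additive_subgroup.a_Hcarr[OF G that] .
  have pr_sum: "pr e (\<Oplus>d\<in>K. c d) = (if e \<in> K then c e else \<zero>)"
    if "finite K" "\<And>d. c d \<in> G d" for e K c
    using that(1)
  proof (induction K)
    case empty
    have "\<zero> \<in> G e" by (rule additive_subgroup.zero_closed[OF G])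
    then show ?case using pure[of \<zero> e e] by simp
  next
    case (insert d K)
    have c: "c d \<in> carrier A" for d using Gc that(2) by blast
    have "pr e (\<Oplus>d\<in>insert d K. c d) = pr e (c d) \<oplus> pr e (\<Oplus>d\<in>K. c d)"
      using insert.hyps c by (simp add: add finsum_insert Pi_def)
    then show ?case using insert c pure[OF that(2)[of d], of e] by auto
  qed
  show ?thesis
    unfolding grading_def
  proof (intro conjI allI ballI)
    fix x assume x: "x \<in> carrier A"
    show "\<exists>!c. (\<forall>d. c d \<in> G d) \<and> finite {d. c d \<noteq> \<zero>} \<and> x = (\<Oplus>d\<in>{d. c d \<noteq> \<zero>}. c d)"
    proof (rule ex1I[of _ "\<lambda>d. pr d x"])
      fix c assume c: "(\<forall>d. c d \<in> G d) \<and> finite {d. c d \<noteq> \<zero>} \<and> x = (\<Oplus>d\<in>{d. c d \<noteq> \<zero>}. c d)"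
      show "c = (\<lambda>d. pr d x)"
      proof
        fix e
        have "pr e x = pr e (\<Oplus>d\<in>{d. c d \<noteq> \<zero>}. c d)" using c by metis
        also have "\<dots> = c e" using pr_sum[of "{d. c d \<noteq> \<zero>}" c e] c by auto
        finally show "c e = pr e x" by simp
      qed
    qed (use proj fin sum x in blast)
  qed (rule G)
qed

lemma grading_cong:
  assumes c: "carrier A = carrier A'" "zero A = zero A'" "add A = add A'"
  shows "grading A G = grading A' G"
proof -
  have s: "additive_subgroup H A = additive_subgroup H A'" for H
    unfolding additive_subgroup_def subgroup_def m_inv_def by (simp add: c)
  have f: "finsum A = (finsum A' :: (int \<Rightarrow> _) \<Rightarrow> _)"
    unfolding finsum_def finprod_def by (intro ext) (simp add: c)
  show ?thesis unfolding grading_def c s f ..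
qed

definition homogeneous_component :: "int \<Rightarrow> (monomial \<Rightarrow>\<^sub>0 'k::field) \<Rightarrow> (monomial \<Rightarrow>\<^sub>0 'k)" where
  "homogeneous_component d = restrict_terms (\<lambda>m. int (mdeg m) = d)"

lemma coeff_homogeneous_component: "coeff (homogeneous_component d p) m = (if int (mdeg m) = d then coeff p m else 0)"
  by (simp add: homogeneous_component_def coeff_restrict_terms)

lemma homogeneous_component_add: "homogeneous_component d (p + q) = homogeneous_component d p + homogeneous_component d q"
  by (rule Poly_Mapping.poly_mapping_eqI) (simp add: coeff_homogeneous_component Poly_Mapping.lookup_add)

lemma homogeneous_component_diff: "homogeneous_component d (p - q) = homogeneous_component d p - homogeneous_component d q"
  by (rule Poly_Mapping.poly_mapping_eqI) (simp add: coeff_homogeneous_component Poly_Mapping.lookup_minus)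

lemma homogeneous_component_homogeneous:
  assumes "p \<in> poly_grading n e"
  shows "homogeneous_component d p = (if d = e then p else 0)"
proof (rule Poly_Mapping.poly_mapping_eqI)
  fix m
  have "coeff p m = 0" if "int (mdeg m) \<noteq> e"
    using assms that by (auto simp: poly_grading_def Poly_Mapping.in_keys_iff)
  then show "coeff (homogeneous_component d p) m = coeff (if d = e then p else 0) m" by (auto simp: coeff_homogeneous_component)
qed

lemma homogeneous_component_nonzero: "homogeneous_component d p \<noteq> 0 \<Longrightarrow> d \<in> (\<lambda>m. int (mdeg m)) ` terms p"
proof -
  assume "homogeneous_component d p \<noteq> 0"
  then have "terms (homogeneous_component d p) \<noteq> {}" by simp
  then show ?thesis by (auto simp: homogeneous_component_def)
qed

lemma sum_homogeneous_component: "p = (\<Sum>d\<in>(\<lambda>m. int (mdeg m)) ` terms p. homogeneous_component d p)"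
proof (rule Poly_Mapping.poly_mapping_eqI)
  fix m
  have "coeff (\<Sum>d\<in>(\<lambda>m. int (mdeg m)) ` terms p. homogeneous_component d p) m =
      (\<Sum>d\<in>(\<lambda>m. int (mdeg m)) ` terms p. if int (mdeg m) = d then coeff p m else 0)"
    by (simp add: Poly_Mapping.lookup_sum coeff_homogeneous_component)
  also have "\<dots> = coeff p m" by (auto simp: sum.delta Poly_Mapping.in_keys_iff)
  finally show "coeff p m = coeff (\<Sum>d\<in>(\<lambda>m. int (mdeg m)) ` terms p. homogeneous_component d p) m" by simp
qed

lemma submod_poly_grading: "submod {} (poly_grading n d :: (monomial \<Rightarrow>\<^sub>0 'k::field) set)"
  unfolding submod_def
proof (intro conjI ballI)
  show "0 \<in> (poly_grading n d :: (monomial \<Rightarrow>\<^sub>0 'k) set)"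
    by (simp add: poly_grading_def submod_zero[OF submod_polys])
  fix x y :: "monomial \<Rightarrow>\<^sub>0 'k" assume "x \<in> poly_grading n d" "y \<in> poly_grading n d"
  then show "x - y \<in> poly_grading n d"
    using submod_diff[OF submod_polys, of x n y] by (auto simp: poly_grading_def dest!: terms_diff)
qed simp

definition homogeneous :: "(monomial \<Rightarrow>\<^sub>0 'k::field) set \<Rightarrow> bool" where
  "homogeneous A \<longleftrightarrow> (\<forall>p\<in>A. \<forall>d. homogeneous_component d p \<in> A)"

lemma homogeneous_sqf_ideal: "homogeneous (sqf_ideal n D)"
  by (auto simp: homogeneous_def homogeneous_component_def sqf_ideal_def restrict_terms_polys)

lemma poly_grading_polys: "poly_grading n d \<subseteq> polys n"
  by (auto simp: poly_grading_def)

lemma polys_Int_poly_grading: "polys n \<inter> poly_grading n d = poly_grading n d"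
  using poly_grading_polys by blast

lemma onto_sum:
  assumes onto: "module_onto n A B X f" and "\<And>i. i \<in> K \<Longrightarrow> g i \<in> A" "finite K"
  shows "f (sum g K) = finsum X (\<lambda>i. f (g i)) K"
proof -
  interpret Module.module "poly_ring n" X by (rule onto_module[OF onto])
  note A = onto_A[OF onto]
  show ?thesis
    using assms(3,2)
  proof (induction K)
    case empty
    then show ?case using onto_zero[OF onto] by simp
  next
    case (insert i K)
    have "f (g i + sum g K) = f (g i) \<oplus>\<^bsub>X\<^esub> f (sum g K)"
      by (rule onto_add[OF onto]) (use insert.prems in \<open>auto intro: submod_sum[OF A]\<close>)
    then show ?case
      using insert onto_closed[OF onto] by (simp add: Pi_def)
  qed
qed

text \<open>The projections of the polynomial ring descend to \<open>A/B\<close> because \<open>B\<close> is homogeneous.\<close>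
lemma grading_onto:
  assumes onto: "module_onto n A B X f" and hA: "homogeneous A" and hB: "homogeneous B"
  shows "grading X (\<lambda>d. f ` (A \<inter> poly_grading n d))"
proof -
  interpret X: Module.module "poly_ring n" X by (rule onto_module[OF onto])
  note A = onto_A[OF onto]
  let ?G = "\<lambda>d. f ` (A \<inter> poly_grading n d)"
  (* the choice of a preimage does not matter: see the fact pr below *)
  define pr where "pr = (\<lambda>d x. f (homogeneous_component d (SOME p. p \<in> A \<and> f p = x)))"
  have hcA: "homogeneous_component d p \<in> A \<inter> poly_grading n d" if "p \<in> A" for d p
    using hA that onto_sub(2)[OF onto]
    by (auto simp: homogeneous_def poly_grading_def homogeneous_component_def restrict_terms_polys subset_iff)
  have pr: "pr d (f p) = f (homogeneous_component d p)" if p: "p \<in> A" for d p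
  proof -
    let ?q = "SOME q. q \<in> A \<and> f q = f p"
    have q: "?q \<in> A \<and> f ?q = f p" by (rule someI[of _ p]) (use p in simp)
    then have "?q - p \<in> B" using onto_eq_iff[OF onto, of ?q p] p by simp
    then have "homogeneous_component d ?q - homogeneous_component d p \<in> B" using hB by (simp add: homogeneous_def flip: homogeneous_component_diff)
    then show ?thesis unfolding pr_def using onto_eq_iff[OF onto, of "homogeneous_component d ?q" "homogeneous_component d p"] hcA q p by auto
  qed
  have el: "\<exists>p\<in>A. x = f p" if "x \<in> carrier X" for x using that onto_image[OF onto] by blast
  show ?thesis
  proof (rule gradingI[where pr = pr])
    show "abelian_group X" by (rule X.M.abelian_group_axioms)
    show "additive_subgroup (?G d) X" for d
    proof (rule additive_subgroup.intro, rule X.M.add.subgroupI)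
      have sm: "submod {} (A \<inter> poly_grading n d)"
        using A submod_poly_grading[of n d] unfolding submod_def by blast
      show "?G d \<subseteq> carrier X" using onto_closed[OF onto] by auto
      show "?G d \<noteq> {}" using submod_zero[OF sm] by auto
      fix x assume "x \<in> ?G d"
      then obtain p where p: "p \<in> A \<inter> poly_grading n d" "x = f p" by (elim imageE)
      have "\<ominus>\<^bsub>X\<^esub> x = f (- p)" using onto_uminus[OF onto, of p] p by simp
      then show "\<ominus>\<^bsub>X\<^esub> x \<in> ?G d" using submod_uminus[OF sm p(1)] by (simp only: imageI)
      fix y assume "y \<in> ?G d"
      then obtain q where q: "q \<in> A \<inter> poly_grading n d" "y = f q" by (elim imageE)
      have "x \<oplus>\<^bsub>X\<^esub> y = f (p + q)" using onto_add[OF onto, of p q] p q by simp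
      then show "x \<oplus>\<^bsub>X\<^esub> y \<in> ?G d" using submod_add[OF sm p(1) q(1)] by (simp only: imageI)
    qed
    show "pr d x \<in> ?G d" if "x \<in> carrier X" for d x
      using el[OF that] pr hcA by auto
    show "pr d (x \<oplus>\<^bsub>X\<^esub> y) = pr d x \<oplus>\<^bsub>X\<^esub> pr d y" if xy: "x \<in> carrier X" "y \<in> carrier X" for d x y
    proof -
      obtain p where p: "p \<in> A" "x = f p" using el[OF xy(1)] by (elim bexE)
      obtain q where q: "q \<in> A" "y = f q" using el[OF xy(2)] by (elim bexE)
      have "x \<oplus>\<^bsub>X\<^esub> y = f (p + q)" using onto_add[OF onto p(1) q(1)] p q by simp
      then show ?thesis
        using pr[OF submod_add[OF A p(1) q(1)]] pr p q hcA onto_add[OF onto, of "homogeneous_component d p" "homogeneous_component d q"]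
        by (simp add: homogeneous_component_add)
    qed
    show "pr d x = (if d = e then x else \<zero>\<^bsub>X\<^esub>)" if x: "x \<in> ?G e" for d e x
    proof -
      obtain p where p: "p \<in> A \<inter> poly_grading n e" "x = f p" using x by (elim imageE)
      then show ?thesis using pr[of p d] homogeneous_component_homogeneous[of p n e d] onto_zero[OF onto] by auto
    qed
    fix x assume "x \<in> carrier X"
    then obtain p where p: "p \<in> A" "x = f p" using el by blast
    let ?K = "(\<lambda>m. int (mdeg m)) ` terms p"
    have z: "pr d x = \<zero>\<^bsub>X\<^esub>" if "d \<notin> ?K" for d
    proof -
      have "homogeneous_component d p = 0" using homogeneous_component_nonzero[of d p] that by blast
      then show ?thesis using pr[OF p(1)] p onto_zero[OF onto] by simp
    qed
    then have K: "{d. pr d x \<noteq> \<zero>\<^bsub>X\<^esub>} \<subseteq> ?K" by blast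
    then show "finite {d. pr d x \<noteq> \<zero>\<^bsub>X\<^esub>}" by (rule finite_subset) simp
    have "x = f (\<Sum>d\<in>?K. homogeneous_component d p)" using p(2) sum_homogeneous_component[of p] by simp
    also have "\<dots> = finsum X (\<lambda>d. f (homogeneous_component d p)) ?K"
      by (rule onto_sum[OF onto]) (use hcA[OF p(1)] in auto)
    also have "\<dots> = finsum X (\<lambda>d. pr d x) ?K"
      by (simp add: pr p)
    also have "\<dots> = finsum X (\<lambda>d. pr d x) {d. pr d x \<noteq> \<zero>\<^bsub>X\<^esub>}"
    proof (rule X.M.add.finprod_mono_neutral_cong_left[symmetric])
      show "(\<lambda>d. pr d x) \<in> ?K \<rightarrow> carrier X" using pr p hcA onto_closed[OF onto] by auto
    qed (use K in auto)
    finally show "x = finsum X (\<lambda>d. pr d x) {d. pr d x \<noteq> \<zero>\<^bsub>X\<^esub>}" .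
  qed
qed

lemma poly_grading_mult:
  assumes "a \<in> poly_grading n d" "b \<in> poly_grading n e"
  shows "a * b \<in> poly_grading n (d + e)"
  using assms polys_mult[of a n b] by (auto simp: poly_grading_def mdeg_add elim!: terms_mult)

text \<open>The grading of the ring itself is the case \<open>A/{0}\<close> of \<open>grading_onto\<close>, as grading only depends on the
  additive structure.\<close>
lemma graded_poly_ring:
  "graded_ring (poly_ring n :: (monomial \<Rightarrow>\<^sub>0 'k::field) ring) (poly_grading n)"
  unfolding graded_ring_def
proof (intro conjI allI ballI)
  let ?R = "poly_ring n :: (monomial \<Rightarrow>\<^sub>0 'k) ring"
  show "cring ?R" by (rule cring_poly_ring)
  have "homogeneous (polys n :: (monomial \<Rightarrow>\<^sub>0 'k) set)" "homogeneous {0 :: monomial \<Rightarrow>\<^sub>0 'k}"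
    using homogeneous_sqf_ideal[of n "Pow {1..n}"] homogeneous_component_diff[of _ 0 "0 :: monomial \<Rightarrow>\<^sub>0 'k"]
    by (simp_all add: sqf_ideal_Pow homogeneous_def)
  from grading_onto[OF regular_module_onto this]
  have "grading (regular_module ?R) (poly_grading n)"
    by (simp add: polys_Int_poly_grading)
  moreover have "grading ?R (poly_grading n) = grading (regular_module ?R) (poly_grading n)"
    by (rule grading_cong) (simp_all add: regular_module_def)
  ultimately show "grading ?R (poly_grading n)" by simp
  show "\<one>\<^bsub>?R\<^esub> \<in> poly_grading n 0" by (simp add: poly_grading_def one_polys mdeg_def)
qed (simp add: poly_grading_mult)

lemma graded_module_onto:
  fixes A B :: "(monomial \<Rightarrow>\<^sub>0 'k::field) set"
  assumes onto: "module_onto n A B X f" and hA: "homogeneous A" and hB: "homogeneous B"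
  shows "graded_module (poly_ring n) (poly_grading n) X (\<lambda>d. f ` (A \<inter> poly_grading n d))"
  unfolding graded_module_def
proof (intro conjI allI ballI)
  fix d e a x assume a: "(a :: monomial \<Rightarrow>\<^sub>0 'k) \<in> poly_grading n d" and x: "x \<in> f ` (A \<inter> poly_grading n e)"
  obtain p where p: "p \<in> A \<inter> poly_grading n e" "x = f p" using x by (elim imageE)
  have an: "a \<in> polys n" using a poly_grading_polys by blast
  have "a \<odot>\<^bsub>X\<^esub> x = f (a * p)" using onto_smult[OF onto an, of p] p by simp
  moreover have "a * p \<in> A \<inter> poly_grading n (d + e)"
    using submod_smult[OF onto_A[OF onto] an] poly_grading_mult[OF a] p by auto
  ultimately show "a \<odot>\<^bsub>X\<^esub> x \<in> f ` (A \<inter> poly_grading n (d + e))" by (simp only: imageI)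
qed (rule graded_poly_ring onto_module[OF onto] grading_onto[OF assms])+

lemma graded_submodule_onto:
  assumes onto: "module_onto n A B X f" and h: "homogeneous B" "homogeneous C"
    and C: "submod (polys n) C" "B \<subseteq> C" "C \<subseteq> A"
  shows "graded_submodule (f ` C) (poly_ring n) (poly_grading n) X (\<lambda>d. f ` (A \<inter> poly_grading n d))"
  unfolding graded_submodule_def
proof
  show "submodule (f ` C) (poly_ring n) X" by (rule onto_image_submodule[OF onto C(1,3)])
  have "f ` C \<inter> f ` (A \<inter> poly_grading n d) = f ` (C \<inter> poly_grading n d)" for d
  proof (intro equalityI subsetI)
    fix x assume x: "x \<in> f ` C \<inter> f ` (A \<inter> poly_grading n d)"
    obtain p where p: "p \<in> A \<inter> poly_grading n d" "x = f p" using IntD2[OF x] by (rule imageE) blast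
    then have "p \<in> C" using onto_image_mem[OF onto C, of p] x by simp
    then show "x \<in> f ` (C \<inter> poly_grading n d)" using p by simp
  qed (use C(3) in auto)
  then show "graded_module (poly_ring n) (poly_grading n) (X\<lparr>carrier := f ` C\<rparr>)
      (\<lambda>d. f ` C \<inter> f ` (A \<inter> poly_grading n d))"
    using graded_module_onto[OF module_onto_sub[OF onto C] h(2,1)] by simp
qed

text \<open>A filtration of \<open>S\<close> by squarefree monomial ideals, starting with \<open>I\<close>, induces a filtration of
  \<open>S/I\<close> whose factors are presented by consecutive ideals, so \<open>cohen_macaulay_sqf_quotient\<close> applies to
  each of them.\<close>
theorem sequentially_cohen_macaulay_sqf_ideal:
  assumes up: "\<And>i. i \<le> r \<Longrightarrow> upset n (D i)" and top: "D r = Pow {1..n}"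
    and strict: "\<And>i. i < r \<Longrightarrow> D i \<subset> D (Suc i)"
    and reg: "\<And>i. i < r \<Longrightarrow>
      wregular (sqf_ideal n (D (Suc i))) (sqf_ideal n (D i) :: (monomial \<Rightarrow>\<^sub>0 'k::field) set) (theta n (d i))"
    and small: "\<And>i H. i < r \<Longrightarrow> H \<in> D (Suc i) \<Longrightarrow> H \<notin> D i \<Longrightarrow> card H \<le> d i"
    and dim: "\<And>i. i < r \<Longrightarrow> \<exists>F. F \<in> D (Suc i) \<and> F \<notin> D i \<and> card F = d i"
    and incr: "\<And>i. Suc i < r \<Longrightarrow> d i < d (Suc i)"
  shows "sequentially_cohen_macaulay_ideal n (sqf_ideal n (D 0) :: (monomial \<Rightarrow>\<^sub>0 'k) set)"
proof -
  let ?R = "poly_ring n :: (monomial \<Rightarrow>\<^sub>0 'k) ring"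
  let ?C = "\<lambda>i. sqf_ideal n (D i) :: (monomial \<Rightarrow>\<^sub>0 'k) set"
  let ?I = "?C 0"
  let ?M = "quot_module ?R (regular_module ?R) ?I"
  let ?f = "\<lambda>p. ?I +>\<^bsub>?R\<^esub> p"
  have DD: "D i \<subseteq> D j" if "i \<le> j" "j \<le> r" for i j
    using that
  proof (induction j)
    case (Suc j)
    show ?case
    proof (cases "i = Suc j")
      case False
      then have "D i \<subseteq> D j" using Suc by simp
      also have "D j \<subseteq> D (Suc j)" using strict[of j] Suc.prems by auto
      finally show ?thesis .
    qed simp
  qed simp
  have sm: "submod (polys n) (?C i)" if "i \<le> r" for i by (rule submod_sqf_ideal[OF up[OF that]])
  have CC: "?C i \<subseteq> ?C j" if "i \<le> j" "j \<le> r" for i j by (rule sqf_ideal_mono[OF DD[OF that]])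
  have "(\<lambda>p. ?I +>\<^bsub>regular_module ?R\<^esub> p) = ?f"
    by (simp add: a_r_coset_def' regular_module_def)
  then have onto: "module_onto n (polys n) ?I ?M ?f"
    using module_onto_quot[OF regular_module_onto sm[of 0]] sqf_ideal_polys
      submod_zero[OF sm[of 0]] by auto
  let ?MG = "\<lambda>d. ?f ` poly_grading n d"
  have MG: "?MG = (\<lambda>d. ?f ` (polys n \<inter> poly_grading n d))"
    by (simp add: polys_Int_poly_grading)
  have hS: "homogeneous (polys n :: (monomial \<Rightarrow>\<^sub>0 'k) set)"
    using homogeneous_sqf_ideal[of n "Pow {1..n}"] by (simp add: sqf_ideal_Pow)
  interpret M: Module.module ?R ?M by (rule onto_module[OF onto])
  let ?F = "\<lambda>i. ?f ` ?C i"
  let ?Q = "\<lambda>i. quot_module ?R (?M\<lparr>carrier := ?F i\<rparr>) (?F (i - 1))"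
  have Q: "module_dim ?R (?Q (Suc i)) = enat (d i) \<and> cohen_macaulay ?R (poly_grading n) (?Q (Suc i))"
    if i: "i < r" for i
  proof -
    have le: "i \<le> r" "Suc i \<le> r" using i by auto
    have sub: "module_onto n (?C (Suc i)) ?I (?M\<lparr>carrier := ?F (Suc i)\<rparr>) ?f"
      by (rule module_onto_sub[OF onto sm[OF le(2)] CC[OF _ le(2)] sqf_ideal_polys]) simp
    have "module_onto n (?C (Suc i)) (?C i) (?Q (Suc i)) (\<lambda>p. ?F i +>\<^bsub>?M\<lparr>carrier := ?F (Suc i)\<rparr>\<^esub> ?f p)"
      using module_onto_quot[OF sub sm[OF le(1)] CC[OF _ le(1)] CC[OF _ le(2)]] by simp
    note Q = this
    obtain F where F: "F \<in> D (Suc i)" "F \<notin> D i" "card F = d i" using dim[OF i] by (elim exE conjE)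
    have "D i \<subseteq> D (Suc i)" by (rule DD[OF _ le(2)]) simp
    note cm = cohen_macaulay_sqf_quotient[OF up[OF le(2)] up[OF le(1)] this Q reg[OF i] _ F]
    show ?thesis by (intro conjI cm small[OF i])
  qed
  have "graded_module ?R (poly_grading n) ?M ?MG"
    unfolding MG by (rule graded_module_onto[OF onto hS homogeneous_sqf_ideal])
  moreover have "fin_gen_module ?R ?M"
    unfolding fin_gen_module_def
  proof (intro exI conjI)
    have f1: "?f 1 \<in> carrier ?M" by (rule onto_closed[OF onto one_polys])
    show "finite {?f 1}" by simp
    show "{?f 1} \<subseteq> carrier ?M" using f1 by simp
    have "carrier ?M \<subseteq> N" if N: "submodule N ?R ?M" "{?f 1} \<subseteq> N" for N
    proof
      fix x assume "x \<in> carrier ?M"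
      then obtain p where p: "p \<in> polys n" "x = ?f p" unfolding onto_image[OF onto, symmetric] by (elim imageE)
      have "x = p \<odot>\<^bsub>?M\<^esub> ?f 1" using onto_smult[OF onto p(1) one_polys] p(2) by simp
      then show "x \<in> N" using M.submoduleE(4)[OF N(1) p(1)] N(2) by simp
    qed
    moreover have "submodule (carrier ?M) ?R ?M"
      using onto_image_submodule[OF onto submod_polys subset_refl] unfolding onto_image[OF onto] .
    ultimately show "gen_submodule ?R ?M {?f 1} = carrier ?M"
      unfolding gen_submodule_def using f1 by (intro equalityI Inter_lower Inter_greatest) auto
  qed
  moreover have "?F 0 = {\<zero>\<^bsub>?M\<^esub>}"
  proof -
    have "?f p = \<zero>\<^bsub>?M\<^esub>" if "p \<in> ?I" for p
      using onto_ker[OF onto, of p] that sqf_ideal_polys by blast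
    moreover have "0 \<in> ?I" by (rule submod_zero[OF sm]) simp
    ultimately show ?thesis by auto
  qed
  moreover have "?F r = carrier ?M"
    using onto_image[OF onto] by (simp add: top sqf_ideal_Pow)
  moreover have "\<forall>i\<le>r. graded_submodule (?F i) ?R (poly_grading n) ?M ?MG"
    unfolding MG using graded_submodule_onto[OF onto homogeneous_sqf_ideal homogeneous_sqf_ideal sm CC[of 0] sqf_ideal_polys]
    by simp
  moreover have "\<forall>i<r. ?F i \<subset> ?F (Suc i)"
  proof (intro allI impI)
    fix i assume i: "i < r"
    then have le: "i \<le> r" "Suc i \<le> r" by auto
    obtain F where F: "F \<in> D (Suc i)" "F \<notin> D i" using strict[OF i] by blast
    have Fn: "F \<subseteq> {1..n}" by (rule upset_subset[OF up[OF le(2)] F(1)])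
    show "?F i \<subset> ?F (Suc i)"
    proof (rule psubset_witness)
      show "?F i \<subseteq> ?F (Suc i)" by (rule image_mono[OF CC[OF _ le(2)]]) simp
      show "?f (xmon F) \<in> ?F (Suc i)" by (rule imageI) (simp add: xmon_sqf_ideal[OF Fn] F)
      show "?f (xmon F) \<notin> ?F i"
        using onto_image_mem[OF onto sm[OF le(1)] CC[OF _ le(1)] sqf_ideal_polys xmon_polys[OF Fn]]
        by (simp add: xmon_sqf_ideal[OF Fn] F)
    qed
  qed
  moreover have "\<forall>i\<in>{1..r}. cohen_macaulay ?R (poly_grading n) (?Q i)"
  proof
    fix i assume "i \<in> {1..r}"
    then obtain j where "i = Suc j" "j < r" by (cases i) auto
    then show "cohen_macaulay ?R (poly_grading n) (?Q i)" using Q[of j] by (simp only:)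
  qed
  moreover have "\<forall>i\<in>{1..<r}. module_dim ?R (?Q i) < module_dim ?R (?Q (Suc i))"
  proof
    fix i assume "i \<in> {1..<r}"
    then obtain j where j: "i = Suc j" "Suc j < r" by (cases i) auto
    then show "module_dim ?R (?Q i) < module_dim ?R (?Q (Suc i))"
      using Q[of j] Q[of "Suc j"] incr[of j] by (simp only: Suc_lessD enat_ord_simps)
  qed
  ultimately show ?thesis
    unfolding sequentially_cohen_macaulay_ideal_def sequentially_cohen_macaulay_def Let_def
    by (intro conjI exI[of _ r] exI[of _ ?F])
qed

section \<open>Final squarefree lexsegments\<close>

lemma upset_generated: "upset n {H. H \<subseteq> {1..n} \<and> (\<exists>Z\<in>W. Z \<subseteq> H)}"
  unfolding upset_def by blast

lemma genideal_xmon: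
  assumes W: "\<And>Z. Z \<in> W \<Longrightarrow> Z \<subseteq> {1..n}"
  shows "genideal (poly_ring n) (xmon ` W :: (monomial \<Rightarrow>\<^sub>0 'k::field) set) =
    sqf_ideal n {H. H \<subseteq> {1..n} \<and> (\<exists>Z\<in>W. Z \<subseteq> H)}" (is "?G = sqf_ideal n ?D")
proof
  interpret cring "poly_ring n :: (monomial \<Rightarrow>\<^sub>0 'k) ring" by (rule cring_poly_ring)
  have D: "upset n ?D" by (rule upset_generated)
  have "xmon Z \<in> sqf_ideal n ?D" if "Z \<in> W" for Z
    using that W[OF that] xmon_sqf_ideal[OF W[OF that], of ?D] by blast
  then show "?G \<subseteq> sqf_ideal n ?D"
    by (intro genideal_minimal submod_ideal submod_sqf_ideal D sqf_ideal_polys) blast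
  have X: "xmon ` W \<subseteq> polys n" using W xmon_polys by blast
  have G: "submod (polys n) ?G" by (rule ideal_submod(1)[OF genideal_ideal[OF X]])
  have WG: "xmon Z \<in> ?G" if "Z \<in> W" for Z using genideal_self[OF X] that by blast
  show "sqf_ideal n ?D \<subseteq> ?G"
  proof
    fix p :: "monomial \<Rightarrow>\<^sub>0 'k" assume p: "p \<in> sqf_ideal n ?D"
    have "Poly_Mapping.single m (coeff p m) \<in> ?G" if m: "m \<in> terms p" for m
    proof -
      have "supp m \<in> ?D" using p m by (simp add: sqf_ideal_def)
      then obtain Z where Z: "Z \<in> W" "Z \<subseteq> supp m" "supp m \<subseteq> {1..n}" by blast
      let ?y = "Poly_Mapping.single m (coeff p m)"
      have "?y \<in> polys n" using Z(3) by (simp add: polys_iff)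
      moreover have "finite Z" by (rule finite_subset[OF Z(2)]) simp
      moreover have "Z \<subseteq> supp m'" if "m' \<in> terms ?y" for m'
        using that Z(2) by (simp split: if_splits)
      ultimately obtain a where a: "a \<in> polys n" "?y = xmon Z * a" by (rule xmon_divides)
      then show ?thesis using submod_smult[OF G a(1) WG[OF Z(1)]] by (simp add: mult.commute)
    qed
    then have "(\<Sum>m\<in>terms p. Poly_Mapping.single m (coeff p m)) \<in> ?G" by (rule submod_sum[OF G])
    then show "p \<in> ?G" unfolding sum_of_terms[symmetric] .
  qed
qed

lemma squarefree_sqm:
  assumes "squarefree_monomial w"
  shows "w = sqm (supp w)"
proof (rule Poly_Mapping.poly_mapping_eqI)
  fix j
  have "Poly_Mapping.lookup w j \<le> 1" using assms by (simp add: squarefree_monomial_def)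
  then show "Poly_Mapping.lookup w j = Poly_Mapping.lookup (sqm (supp w)) j"
    by (auto simp: lookup_sqm Poly_Mapping.in_keys_iff)
qed

lemma final_lexsegment_sqm:
  assumes U: "U \<subseteq> {1..n}"
  shows "final_squarefree_lexsegment n (sqm U) =
    sqm ` {Z. Z \<subseteq> {1..n} \<and> card Z = card U \<and> sqm Z \<le> sqm U}" (is "_ = sqm ` ?W")
proof -
  have fin: "finite Z" if "Z \<subseteq> {1..n}" for Z using that finite_subset by blast
  show ?thesis
  proof (intro equalityI subsetI)
    fix w assume w: "w \<in> final_squarefree_lexsegment n (sqm U)"
    then have eq: "w = sqm (supp w)" and s: "supp w \<subseteq> {1..n}"
      using squarefree_sqm by (auto simp: final_squarefree_lexsegment_def monomials_def)
    have "mdeg w = card (supp w)" using mdeg_sqm[of "supp w"] eq by simp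
    then have "supp w \<in> ?W"
      using w s eq mdeg_sqm[OF fin[OF U]] by (simp add: final_squarefree_lexsegment_def)
    then show "w \<in> sqm ` ?W" using eq by (rule image_eqI[rotated])
  next
    fix w assume "w \<in> sqm ` ?W"
    then obtain Z where "Z \<subseteq> {1..n}" "card Z = card U" "sqm Z \<le> sqm U" "w = sqm Z" by blast
    then show "w \<in> final_squarefree_lexsegment n (sqm U)"
      using fin[of Z] mdeg_sqm[OF fin[OF U]]
      by (simp add: final_squarefree_lexsegment_def monomials_def supp_sqm mdeg_sqm
          squarefree_monomial_def lookup_sqm)
  qed
qed

text \<open>The first index at which the two sets differ belongs to \<open>Z\<close> and not to \<open>U\<close>, so it is greater than \<open>1\<close>.\<close>
lemma lex_greater_contains_one:
  assumes U: "U \<subseteq> {1..n}" "1 \<in> U" and Z: "Z \<subseteq> {1..n}" and less: "sqm U < sqm Z"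
  shows "1 \<in> Z"
proof -
  have "finite U" "finite Z" using U Z finite_subset by auto
  then obtain j where j: "j \<in> Z" "j \<notin> U" "\<And>j'. j' < j \<Longrightarrow> j' \<in> U \<longleftrightarrow> j' \<in> Z"
    using less sqm_less_iff by blast
  have "1 \<le> j" using j(1) Z by auto
  moreover have "j \<noteq> 1" using j(2) U(2) by blast
  ultimately have "1 < j" by simp
  then show ?thesis using j(3)[of 1] U(2) by simp
qed

text \<open>Here \<open>D0\<close> and \<open>D1\<close> are the families of supports for the ideals \<open>I\<close> and \<open>I'\<close> of the
  filtration, \<open>W\<close> is the set of facets of the complex of \<open>I'\<close>, and \<open>V\<close> is the set of all sets of size
  \<open>q - 1\<close>. Adding \<open>V\<close> to the complex of \<open>I'\<close> gives the complex of \<open>I\<close>. If some \<open>F \<in> V\<close> with initial run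
  \<open>{1..c}\<close> had its remainder \<open>F - {1..c}\<close> inside a facet \<open>Z \<in> W\<close>, then \<open>insert (Suc c) F\<close> would be at
  least as large as \<open>Z\<close>, hence in \<open>W\<close>, and \<open>F\<close> would already be a face. This is the compatibility
  required by \<open>wregular_lex_shelling\<close>.\<close>
lemma sequentially_cohen_macaulay_lexsegment:
  assumes U: "U \<subseteq> {1..n}" "1 \<in> U"
  shows "sequentially_cohen_macaulay_ideal n
    (final_squarefree_lexsegment_ideal n (sqm U) :: (monomial \<Rightarrow>\<^sub>0 'k::field) set)"
proof -
  define q where "q = card U"
  have finU: "finite U" using U finite_subset by blast
  have q: "q > 0" using U finU unfolding q_def by (auto simp: card_gt_0_iff)
  have fin: "finite H" if "H \<subseteq> {1..n}" for H using that finite_subset by blast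
  define W where "W = {Z. Z \<subseteq> {1..n} \<and> card Z = q \<and> sqm U < sqm Z}"
  define V where "V = {F. F \<subseteq> {1..n} \<and> card F = q - 1}"
  define D0 where "D0 = {H. H \<subseteq> {1..n} \<and> (\<exists>Z\<in>{Z. Z \<subseteq> {1..n} \<and> card Z = q \<and> sqm Z \<le> sqm U}. Z \<subseteq> H)}"
  define D1 where "D1 = {H. H \<subseteq> {1..n} \<and> (\<forall>Z\<in>W. \<not> H \<subseteq> Z)}"
  have WD: "Z \<subseteq> {1..n}" "card Z = q" "sqm U < sqm Z" "1 \<in> Z" "finite Z" if "Z \<in> W" for Z
    using that lex_greater_contains_one[OF U] fin[of Z] by (auto simp: W_def)
  have finW: "finite W" "finite V"
    by (rule finite_subset[of _ "Pow {1..n}"]; auto simp: W_def V_def)+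
  have ideal: "final_squarefree_lexsegment_ideal n (sqm U) = (sqf_ideal n D0 :: (monomial \<Rightarrow>\<^sub>0 'k) set)"
  proof -
    let ?W = "{Z. Z \<subseteq> {1..n} \<and> card Z = q \<and> sqm Z \<le> sqm U}"
    have gens: "(\<lambda>w. Poly_Mapping.single w 1) ` final_squarefree_lexsegment n (sqm U) = (xmon ` ?W :: (monomial \<Rightarrow>\<^sub>0 'k) set)"
      unfolding final_lexsegment_sqm[OF U(1)] q_def xmon_def by (simp add: image_image)
    show ?thesis
      unfolding final_squarefree_lexsegment_ideal_def D0_def gens by (rule genideal_xmon) blast
  qed
  have up1: "upset n D1" unfolding upset_def D1_def by blast
  have up0: "upset n D0" unfolding D0_def by (rule upset_generated)
  have D0_eq: "D0 = {H \<in> D1. \<forall>F\<in>V. \<not> H \<subseteq> F}"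
  proof (intro equalityI subsetI)
    fix H assume "H \<in> D0"
    then obtain Z where Z: "Z \<subseteq> {1..n}" "card Z = q" "sqm Z \<le> sqm U" "Z \<subseteq> H" "H \<subseteq> {1..n}"
      unfolding D0_def by blast
    have "\<not> H \<subseteq> Z'" if Z': "Z' \<in> W" for Z'
    proof
      assume "H \<subseteq> Z'"
      then have "Z = Z'" using card_subset_eq[of Z' Z] WD[OF Z'] Z by auto
      then show False using WD(3)[OF Z'] Z(3) by simp
    qed
    moreover have "\<not> H \<subseteq> F" if F: "F \<in> V" for F
    proof
      assume "H \<subseteq> F"
      then have "card Z \<le> card F" using F Z fin[of F] by (intro card_mono) (auto simp: V_def)
      then show False using F Z(2) q by (simp add: V_def)
    qed
    ultimately show "H \<in> {H \<in> D1. \<forall>F\<in>V. \<not> H \<subseteq> F}" using Z(5) by (simp add: D1_def)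
  next
    fix H assume H: "H \<in> {H \<in> D1. \<forall>F\<in>V. \<not> H \<subseteq> F}"
    then have Hn: "H \<subseteq> {1..n}" and HW: "\<And>Z. Z \<in> W \<Longrightarrow> \<not> H \<subseteq> Z" by (auto simp: D1_def)
    have cardH: "q \<le> card H"
    proof (rule ccontr)
      assume "\<not> q \<le> card H"
      then have 1: "card H \<le> q - 1" by simp
      have "q \<le> card {1..n}" using card_mono[OF _ U(1)] by (simp add: q_def)
      then have 2: "q - 1 \<le> card {1..n}" by simp
      obtain F where "H \<subseteq> F" "F \<subseteq> {1..n}" "card F = q - 1"
        using exists_subset_between[OF 1 2 Hn] by auto
      then show False using H by (auto simp: V_def)
    qed
    have "\<exists>Z. Z \<subseteq> H \<and> card Z = q \<and> sqm Z \<le> sqm U"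
    proof (cases "card H = q")
      case True
      then have "H \<notin> W" using HW[of H] by blast
      then have "sqm H \<le> sqm U" using Hn True by (simp add: W_def)
      then show ?thesis using True by blast
    next
      case False
      (* a q-subset that avoids 1 cannot be greater than U *)
      have "card H - 1 \<le> card (H - {1})" using fin[OF Hn] by (simp add: card_Diff_singleton_if)
      then have "q \<le> card (H - {1})" using False cardH by simp
      then obtain Z where Z: "Z \<subseteq> H - {1}" "card Z = q"
        using obtain_subset_with_card_n by metis
      then have "Z \<notin> W" using WD(4)[of Z] by blast
      moreover have "Z \<subseteq> {1..n}" using Z Hn by blast
      ultimately have "sqm Z \<le> sqm U" using Z by (simp add: W_def)
      then show ?thesis using Z by blast
    qed
    then obtain Z where "Z \<subseteq> H" "card Z = q" "sqm Z \<le> sqm U" by blast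
    then show "H \<in> D0" unfolding D0_def using Hn by auto
  qed
  (* U - {1} is not a face of the complex of I', so I' is different from I *)
  have VU: "U - {1} \<in> D1" "U - {1} \<in> V"
  proof -
    show UV: "U - {1} \<in> V" using U finU by (auto simp: V_def q_def card_Diff_singleton)
    have "\<not> U - {1} \<subseteq> Z" if Z: "Z \<in> W" for Z
    proof
      assume "U - {1} \<subseteq> Z"
      then have "U \<subseteq> Z" using WD(4)[OF Z] by blast
      then have "U = Z" using card_subset_eq[of Z U] WD[OF Z] by (simp add: q_def)
      then show False using WD(3)[OF Z] by simp
    qed
    then show "U - {1} \<in> D1" using UV by (auto simp: D1_def V_def)
  qed
  have reg1: "wregular (sqf_ideal n D1) (sqf_ideal n D0 :: (monomial \<Rightarrow>\<^sub>0 'k) set) (theta n (q - 1))"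
    unfolding D0_eq
  proof (rule wregular_lex_shelling[OF up1 finW(2)])
    fix F c assume F: "F \<in> V" "F \<in> D1" and c: "{1..c} \<subseteq> F" "Suc c \<notin> F"
    have Fn: "F \<subseteq> {1..n}" "card F = q - 1" "finite F" using F fin by (auto simp: V_def)
    have "\<not> F - {1..c} \<subseteq> Z" if Z: "Z \<in> W" for Z
    proof
      assume sub: "F - {1..c} \<subseteq> Z"
      let ?F = "insert (Suc c) F"
      have "c < n"
      proof (rule ccontr)
        assume "\<not> c < n"
        then have "{1..n} \<subseteq> {1..c}" by auto
        then have "Z \<subseteq> F" using c(1) WD(1)[OF Z] by (meson subset_trans)
        then have "card Z \<le> card F" by (rule card_mono[OF Fn(3)])
        then show False using WD(2)[OF Z] Fn(2) q by simp
      qed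
      then have n: "?F \<subseteq> {1..n}" using Fn by auto
      have card: "card ?F = q" using Fn c q by simp
      have "sqm Z \<le> sqm ?F"
      proof (rule sqm_le_of_run[OF n WD(1)[OF Z], of "Suc c"])
        show "card Z = card ?F" using WD(2)[OF Z] card by simp
        show "{1..Suc c} \<subseteq> ?F" using c(1) by (auto simp: atLeastAtMostSuc_conv)
        show "?F - {1..Suc c} \<subseteq> Z" using sub by auto
      qed
      then have "?F \<in> W" using WD(3)[OF Z] n card by (simp add: W_def)
      then show False using F(2) by (auto simp: D1_def)
    qed
    then show "F - {1..c} \<in> D1" using Fn by (auto simp: D1_def)
  qed (auto simp: V_def)
  have small1: "card H \<le> q - 1" if H: "H \<in> D1" "H \<notin> D0" for H
  proof -
    obtain F where F: "F \<in> V" "H \<subseteq> F" using H unfolding D0_eq by blast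
    then have "card H \<le> card F" using fin[of F] by (intro card_mono) (auto simp: V_def)
    then show ?thesis using F by (simp add: V_def)
  qed
  have strict1: "D0 \<subset> D1" and dim1: "\<exists>F. F \<in> D1 \<and> F \<notin> D0 \<and> card F = q - 1"
    using VU unfolding D0_eq V_def by auto
  show ?thesis
  proof (cases "W = {}")
    (* here D1 is the family of all subsets, so the filtration has one step *)
    case True
    then have D1: "D1 = Pow {1..n}" by (auto simp: D1_def)
    have "sequentially_cohen_macaulay_ideal n
        (sqf_ideal n ((\<lambda>i::nat. if i = 0 then D0 else D1) 0) :: (monomial \<Rightarrow>\<^sub>0 'k) set)"
      by (rule sequentially_cohen_macaulay_sqf_ideal[where r = 1 and D = "\<lambda>i. if i = 0 then D0 else D1" and d = "\<lambda>_. q - 1"])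
        (use up0 up1 D1 strict1 reg1 small1 dim1 in auto)
    then show ?thesis unfolding ideal by simp
  next
    case False
    then obtain Z where Z: "Z \<in> W" by blast
    let ?D = "\<lambda>i::nat. if i = 0 then D0 else if i = 1 then D1 else Pow {1..n}"
    let ?d = "\<lambda>i::nat. if i = 0 then q - 1 else q"
    have up2: "upset n (Pow {1..n})" by (auto simp: upset_def)
    have D1_eq: "D1 = {H \<in> Pow {1..n}. \<forall>F\<in>W. \<not> H \<subseteq> F}" by (auto simp: D1_def)
    have reg2: "wregular (sqf_ideal n (Pow {1..n})) (sqf_ideal n D1 :: (monomial \<Rightarrow>\<^sub>0 'k) set) (theta n q)"
      unfolding D1_eq
      by (rule wregular_lex_shelling[OF up2 finW(1)]) (auto simp: W_def)
    have small2: "card H \<le> q" if H: "H \<subseteq> {1..n}" "H \<notin> D1" for H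
    proof -
      obtain F where F: "F \<in> W" "H \<subseteq> F" using H unfolding D1_def by blast
      then show ?thesis using card_mono[OF WD(5)[OF F(1)] F(2)] WD(2)[OF F(1)] by simp
    qed
    have Z1: "Z \<notin> D1" "Z \<subseteq> {1..n}" "card Z = q" using Z WD[OF Z] by (auto simp: D1_def)
    have cases: "i = 0 \<or> i = 1" if "i < 2" for i :: nat using that by auto
    have "sequentially_cohen_macaulay_ideal n (sqf_ideal n (?D 0) :: (monomial \<Rightarrow>\<^sub>0 'k) set)"
    proof (rule sequentially_cohen_macaulay_sqf_ideal[where r = 2 and D = ?D and d = ?d])
      show "upset n (?D i)" for i using up0 up1 up2 by simp
      show "?D i \<subset> ?D (Suc i)" if "i < 2" for i
        using cases[OF that] strict1 Z1 by (auto simp: D1_def)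
      show "wregular (sqf_ideal n (?D (Suc i))) (sqf_ideal n (?D i) :: (monomial \<Rightarrow>\<^sub>0 'k) set) (theta n (?d i))"
        if "i < 2" for i
        using cases[OF that] reg1 reg2 by auto
      show "card H \<le> ?d i" if "i < 2" "H \<in> ?D (Suc i)" "H \<notin> ?D i" for i H
        using cases[OF that(1)] small1[of H] small2[of H] that(2,3) by auto
      show "\<exists>F. F \<in> ?D (Suc i) \<and> F \<notin> ?D i \<and> card F = ?d i" if "i < 2" for i
        using cases[OF that] dim1 Z1 by auto
      show "?d i < ?d (Suc i)" if "Suc i < 2" for i using that q by auto
    qed simp
    then show ?thesis unfolding ideal by simp
  qed
qed

theorem proposition2p2p5:
  fixes n q :: nat and i :: "nat \<Rightarrow> nat" and u :: monomial
    and I :: "(monomial \<Rightarrow>\<^sub>0 'k::field) set"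
  assumes "q \<ge> 2"
    and "strict_mono_on {2..q} i"
    and "\<forall>j\<in>{2..q}. 2 \<le> i j \<and> i j \<le> n"
    and "u = Poly_Mapping.single 1 1 + (\<Sum>j\<in>{2..q}. Poly_Mapping.single (i j) 1)"
    and "I = final_squarefree_lexsegment_ideal n u"
  shows "sequentially_cohen_macaulay_ideal n I"
proof -
  let ?U = "insert 1 (i ` {2..q})"
  have "inj_on i {2..q}" by (rule strict_mono_on_imp_inj_on[OF assms(2)])
  moreover have "1 \<notin> i ` {2..q}" using assms(3) by auto
  ultimately have "u = sqm ?U"
    unfolding assms(4) sqm_def by (simp add: sum.reindex)
  moreover have "?U \<subseteq> {1..n}"
  proof -
    have "2 \<le> i 2 \<and> i 2 \<le> n" using assms(1,3) by simp
    then show ?thesis using assms(3) by auto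
  qed
  ultimately show ?thesis
    unfolding assms(5) using sequentially_cohen_macaulay_lexsegment[of ?U n] by simp
qed

end
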